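(* Let $n\geq 1$ and let $F:\mathbb C\to\mathbb R^n$ be a branched minimal immersion. Then $F$ is stable if and only if $F$ is holomorphic up to a rigid motion.
   Context: A branched minimal immersion of a Riemann surface $\Sigma$ (possibly with boundary) into $\mathbb R^n$ is a nonconstant smooth map $F$ that is harmonic and conformal in local holomorphic coordinates; equivalently, it is a critical point of the area functional $A(F(\Omega))=\int_\Omega \sqrt{\det F^*\delta}$ ($\delta$ the Euclidean metric) for all compact subsurfaces $\Omega$ with smooth boundary, under smooth variations vanishing on $\partial\Omega$. For a compact surface $\Omega$ with smooth boundary, $F$ is stable if $\frac{d^2}{dt^2}\big|_{t=0}A(F+tW)\geq 0$ for every smooth $W:\Omega\to\mathbb R^n$ vanishing on $\partial\Omega$ (variations of the map, not only of the image surface); for an open surface, $F$ is stable if its restriction to every compact subsurface with smooth boundary is stable. $F$ is holomorphic up to a rigid motion if its image lies in an even-dimensional affine subspace $A=b+W\subset\mathbb R^n$ and there is an orthogonal complex structure $J$ on $W$ (a linear map $J:W\to W$ with $J^2=-I$ preserving the Euclidean inner product) such that $dF\circ j=J\circ dF$, where $j$ is the complex structure of the source. *)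

theory Defs
  imports "HOL-Analysis.Analysis"
begin

definition pdx :: "(complex \<Rightarrow> 'a::real_normed_vector) \<Rightarrow> complex \<Rightarrow> 'a" where
  "pdx f z = frechet_derivative f (at z) 1"

definition pdy :: "(complex \<Rightarrow> 'a::real_normed_vector) \<Rightarrow> complex \<Rightarrow> 'a" where
  "pdy f z = frechet_derivative f (at z) \<i>"

fun Ck_on :: "nat \<Rightarrow> complex set \<Rightarrow> (complex \<Rightarrow> 'a::real_normed_vector) \<Rightarrow> bool" where
  "Ck_on 0 S f = continuous_on S f"
| "Ck_on (Suc k) S f =
     ((\<forall>z\<in>S. f differentiable (at z)) \<and> Ck_on k S (pdx f) \<and> Ck_on k S (pdy f))"

definition smooth_on :: "complex set \<Rightarrow> (complex \<Rightarrow> 'a::real_normed_vector) \<Rightarrow> bool" where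
  "smooth_on S f \<longleftrightarrow> (\<forall>k. Ck_on k S f)"

definition branched_minimal_immersion :: "(complex \<Rightarrow> real ^ 'n) \<Rightarrow> bool" where
  "branched_minimal_immersion F \<longleftrightarrow>
     smooth_on UNIV F \<and>
     (\<forall>z. pdx (pdx F) z + pdy (pdy F) z = 0) \<and>
     (\<forall>z. pdx F z \<bullet> pdy F z = 0 \<and> norm (pdx F z) = norm (pdy F z)) \<and>
     \<not> (\<exists>c. \<forall>z. F z = c)"

definition smooth_compact_domain :: "complex set \<Rightarrow> bool" where
  "smooth_compact_domain \<Omega> \<longleftrightarrow>
     compact \<Omega> \<and>
     (\<forall>p\<in>frontier \<Omega>. \<exists>U (\<rho>::complex \<Rightarrow> real).
        open U \<and> p \<in> U \<and> smooth_on U \<rho> \<and>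
        (\<forall>z\<in>U. pdx \<rho> z \<noteq> 0 \<or> pdy \<rho> z \<noteq> 0) \<and>
        \<Omega> \<inter> U = {z\<in>U. \<rho> z \<le> 0})"

text \<open>Area A(G(\<Omega>)) = integral over \<Omega> of sqrt(det G^*\<delta>), where G^*\<delta> has matrix
  [[G_x.G_x, G_x.G_y],[G_x.G_y, G_y.G_y]] in the coordinates (x,y).\<close>
definition area_on :: "complex set \<Rightarrow> (complex \<Rightarrow> real ^ 'n) \<Rightarrow> real" where
  "area_on \<Omega> G = integral \<Omega> (\<lambda>z. sqrt ((pdx G z \<bullet> pdx G z) * (pdy G z \<bullet> pdy G z)
                                         - (pdx G z \<bullet> pdy G z) * (pdx G z \<bullet> pdy G z)))"

text \<open>Stability on a compact domain: for every variation W, smooth up to the boundary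
  (i.e. smooth on an open neighbourhood of \<Omega>) and vanishing on the boundary, the
  second derivative at t = 0 of t \<mapsto> A(F + tW) exists and is nonnegative.\<close>
definition stable_on :: "(complex \<Rightarrow> real ^ 'n) \<Rightarrow> complex set \<Rightarrow> bool" where
  "stable_on F \<Omega> \<longleftrightarrow>
     (\<forall>(W::complex \<Rightarrow> real ^ 'n) U. open U \<and> \<Omega> \<subseteq> U \<and> smooth_on U W \<and>
        (\<forall>z\<in>frontier \<Omega>. W z = 0) \<longrightarrow>
        (\<exists>a' d. (\<forall>\<^sub>F t in nhds 0.
                   ((\<lambda>s. area_on \<Omega> (\<lambda>z. F z + s *\<^sub>R W z)) has_real_derivative a' t) (at t)) \<and>
                 (a' has_real_derivative d) (at 0) \<and> d \<ge> 0))"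

definition stable :: "(complex \<Rightarrow> real ^ 'n) \<Rightarrow> bool" where
  "stable F \<longleftrightarrow> (\<forall>\<Omega>. smooth_compact_domain \<Omega> \<longrightarrow> stable_on F \<Omega>)"

definition holomorphic_up_to_rigid_motion :: "(complex \<Rightarrow> real ^ 'n) \<Rightarrow> bool" where
  "holomorphic_up_to_rigid_motion F \<longleftrightarrow>
     (\<exists>b V (J :: real ^ 'n \<Rightarrow> real ^ 'n).
        subspace V \<and> even (dim V) \<and> (\<forall>z. F z \<in> (\<lambda>w. b + w) ` V) \<and>
        linear J \<and> J ` V \<subseteq> V \<and> (\<forall>v\<in>V. J (J v) = - v) \<and>
        (\<forall>v\<in>V. \<forall>w\<in>V. J v \<bullet> J w = v \<bullet> w) \<and>
        (\<forall>z v. frechet_derivative F (at z) (\<i> * v) = J (frechet_derivative F (at z) v)))"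

end

theory Submission
  imports Defs "HOL-Complex_Analysis.Complex_Analysis"
begin

text \<open>Put $\phi = F_x - i F_y$, an entire map into $\<complex>^n$ with $\phi \cdot \phi = 0$. For a real
  variation $W$ with $\omega = W_x - i W_y$ the second variation of area is
  $\int |\omega|^2 - 2 |\phi \cdot \omega|^2 / |\phi|^2$.

  If $F$ is stable, apply this on the disc of radius $R$ about $w$ to the real and imaginary parts of
  $s = \eta (\phi(w) - \eta \phi) / (z - w)$, where $\eta = 1 - |z - w|^2 / R^2$. Up to the integral
  of a Jacobian, which vanishes by Stokes, the sum of the two second variations is at most
  $C / R^2 - 4 \int |\phi(z) \cdot \phi(w)|^2 / (|\phi(z)|^2 |z - w|^4)$. Letting $R \to \infty$ gives
  $\phi(z) \cdot \phi(w) = 0$ for all $z, w$, that is, the values of $\phi$ span an isotropic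
  subspace, which is holomorphicity up to a rigid motion.

  Conversely, a holomorphic map is calibrated by the Kaehler form, so $t = 0$ minimizes
  $A(F + tW)$. That $A(F + tW)$ is differentiable for small $t$ uses that some $x$-derivative of
  $|F_x|^2$ is nonzero at each point, so that the set where $F + tW$ fails to be immersed is null.\<close>

section \<open>Partial derivatives and smooth functions\<close>

text \<open>An entire \<open>\<phi>\<close> obeys no growth bound, so a cutoff error containing
  \<open>\<phi>\<close> could not be controlled. The second variation sees the dbar-derivative of
  \<open>s\<close> only modulo \<open>\<phi>\<close>, because the subtracted term removes exactly
  that component. What survives is the constant vector phi(w) / R^2, whose squared norm has integral
  O(1 / R^2) over a disc of area pi R^2. The gain does not decay with R, since phi . phi = 0 and phi
  . phi' = 0 collapse the contraction of \<open>\<phi>\<close> with the z-derivative of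
  \<open>s\<close> to an expression free of R.

  The analytic obstacle is that the area element is a norm, hence not smooth in t where F + tW fails
  to be immersed, in particular at branch points. Conformality bounds the first-order term of the
  2-vector by the square root of its zeroth-order term, and this keeps all second differences
  bounded. The two directions need different amounts of this: if F is stable, the derivatives exist
  by hypothesis and second differences at t = 0 identify their value, so only the branch points must
  form a null set; conversely, existence has to be proved at every small t.\<close>

lemma pdx_eq: "(f has_derivative f') (at z) \<Longrightarrow> pdx f z = f' 1"
  and pdy_eq: "(f has_derivative f') (at z) \<Longrightarrow> pdy f z = f' \<i>"
  by (simp_all add: pdx_def pdy_def frechet_derivative_at [symmetric])

lemma frechet_derivative_pd:
  assumes "f differentiable (at z)"
  shows "frechet_derivative f (at z) h = Re h *\<^sub>R pdx f z + Im h *\<^sub>R pdy f z"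
proof -
  have "linear (frechet_derivative f (at z))"
    using assms by (simp add: linear_frechet_derivative)
  moreover have "h = Re h *\<^sub>R 1 + Im h *\<^sub>R \<i>"
    by (simp add: complex_eq_iff)
  ultimately have "frechet_derivative f (at z) h = frechet_derivative f (at z) (Re h *\<^sub>R 1 + Im h *\<^sub>R \<i>)"
    by simp
  also have "\<dots> = Re h *\<^sub>R pdx f z + Im h *\<^sub>R pdy f z"
    using \<open>linear (frechet_derivative f (at z))\<close>
    by (simp only: linear_add linear_scale pdx_def pdy_def)
  finally show ?thesis .
qed

lemma has_derivative_pd:
  assumes "f differentiable (at z)"
  shows "(f has_derivative (\<lambda>h. Re h *\<^sub>R pdx f z + Im h *\<^sub>R pdy f z)) (at z)"
proof -
  have "frechet_derivative f (at z) = (\<lambda>h. Re h *\<^sub>R pdx f z + Im h *\<^sub>R pdy f z)"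
    using frechet_derivative_pd[OF assms] by (rule ext)
  then show ?thesis
    using assms frechet_derivative_works[of f "at z"] by simp
qed

text \<open>No differentiability is involved: \<open>frechet_derivative\<close> chooses from the set
  of all derivatives at \<open>z\<close>, and that set depends only on the germ of the
  function.\<close>

lemma frechet_derivative_cong_open:
  assumes "open S" "z \<in> S" "\<And>w. w \<in> S \<Longrightarrow> f w = g w"
  shows "frechet_derivative f (at z) = frechet_derivative g (at z)"
proof -
  have "(f has_derivative f') (at z) \<longleftrightarrow> (g has_derivative f') (at z)" for f'
    using assms has_derivative_transform_within_open[of f f' z UNIV S g]
      has_derivative_transform_within_open[of g f' z UNIV S f] by auto
  then show ?thesis
    by (simp add: frechet_derivative_def)
qed

lemma pdx_cong: "open S \<Longrightarrow> z \<in> S \<Longrightarrow> (\<And>w. w \<in> S \<Longrightarrow> f w = g w) \<Longrightarrow> pdx f z = pdx g z"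
  and pdy_cong: "open S \<Longrightarrow> z \<in> S \<Longrightarrow> (\<And>w. w \<in> S \<Longrightarrow> f w = g w) \<Longrightarrow> pdy f z = pdy g z"
  using frechet_derivative_cong_open[of S z f g] by (simp_all add: pdx_def pdy_def)

lemma Ck_on_cong:
  assumes "open S" "\<And>w. w \<in> S \<Longrightarrow> f w = g w" "Ck_on k S f"
  shows "Ck_on k S g"
  using assms(2,3)
proof (induction k arbitrary: f g)
  case 0
  then show ?case by (simp cong: continuous_on_cong)
next
  case (Suc k)
  have "g differentiable (at z)" if "z \<in> S" for z
  proof -
    have "f differentiable (at z)"
      using Suc.prems(2) that by simp
    then obtain f' where "(f has_derivative f') (at z)"
      unfolding differentiable_def by blast
    then have "(g has_derivative f') (at z)"
      using has_derivative_transform_within_open[OF _ \<open>open S\<close> \<open>z \<in> S\<close>] Suc.prems(1) by blast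
    then show ?thesis
      by (auto simp: differentiable_def)
  qed
  moreover have "Ck_on k S (pdx g)" "Ck_on k S (pdy g)"
    using Suc.IH[of "pdx f" "pdx g"] Suc.IH[of "pdy f" "pdy g"] Suc.prems
      pdx_cong[OF \<open>open S\<close>, of _ f g] pdy_cong[OF \<open>open S\<close>, of _ f g] by auto
  ultimately show ?case by simp
qed

lemma Ck_on_SucD: "Ck_on (Suc k) S f \<Longrightarrow> Ck_on k S f"
proof (induction k arbitrary: f)
  case 0
  then show ?case
    by (auto intro!: continuous_at_imp_continuous_on differentiable_imp_continuous_within)
next
  case (Suc k)
  then show ?case by (metis Ck_on.simps(2))
qed

lemma Ck_on_subset: "Ck_on k S f \<Longrightarrow> T \<subseteq> S \<Longrightarrow> Ck_on k T f"
  by (induction k arbitrary: f) (auto intro: continuous_on_subset)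

lemma Ck_on_const: "open S \<Longrightarrow> Ck_on k S (\<lambda>_. c)"
proof (induction k arbitrary: c)
  case (Suc k)
  have "pdx (\<lambda>_. c) = (\<lambda>_. 0)" "pdy (\<lambda>_. c) = (\<lambda>_. 0)"
    by (auto simp: pdx_def pdy_def)
  with Suc show ?case by simp
qed simp

lemma pd_bounded_linear:
  assumes "bounded_linear L" "f differentiable (at z)"
  shows "(\<lambda>z. L (f z)) differentiable (at z)"
    and "pdx (\<lambda>z. L (f z)) z = L (pdx f z)"
    and "pdy (\<lambda>z. L (f z)) z = L (pdy f z)"
proof -
  have *: "((\<lambda>z. L (f z)) has_derivative (\<lambda>h. L (Re h *\<^sub>R pdx f z + Im h *\<^sub>R pdy f z))) (at z)"
    using bounded_linear.has_derivative[OF assms(1) has_derivative_pd[OF assms(2)]] .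
  then show "(\<lambda>z. L (f z)) differentiable (at z)"
    by (auto simp: differentiable_def)
  show "pdx (\<lambda>z. L (f z)) z = L (pdx f z)" "pdy (\<lambda>z. L (f z)) z = L (pdy f z)"
    using pdx_eq[OF *] pdy_eq[OF *] by simp_all
qed

lemma pd_add:
  assumes "f differentiable (at z)" "g differentiable (at z)"
  shows "pdx (\<lambda>z. f z + g z) z = pdx f z + pdx g z"
    and "pdy (\<lambda>z. f z + g z) z = pdy f z + pdy g z"
  using pdx_eq[OF has_derivative_add[OF has_derivative_pd[OF assms(1)] has_derivative_pd[OF assms(2)]]]
    pdy_eq[OF has_derivative_add[OF has_derivative_pd[OF assms(1)] has_derivative_pd[OF assms(2)]]]
  by simp_all

lemma pd_bilinear:
  assumes "bounded_bilinear B" "f differentiable (at z)" "g differentiable (at z)"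
  shows "(\<lambda>z. B (f z) (g z)) differentiable (at z)"
    and "pdx (\<lambda>z. B (f z) (g z)) z = B (f z) (pdx g z) + B (pdx f z) (g z)"
    and "pdy (\<lambda>z. B (f z) (g z)) z = B (f z) (pdy g z) + B (pdy f z) (g z)"
proof -
  note * = bounded_bilinear.FDERIV[OF assms(1) has_derivative_pd[OF assms(2)] has_derivative_pd[OF assms(3)]]
  then show "(\<lambda>z. B (f z) (g z)) differentiable (at z)"
    by (auto simp: differentiable_def)
  show "pdx (\<lambda>z. B (f z) (g z)) z = B (f z) (pdx g z) + B (pdx f z) (g z)"
    "pdy (\<lambda>z. B (f z) (g z)) z = B (f z) (pdy g z) + B (pdy f z) (g z)"
    using pdx_eq[OF *] pdy_eq[OF *] by simp_all
qed

lemma Ck_on_bounded_linear: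
  assumes "bounded_linear L" "open S" "Ck_on k S f"
  shows "Ck_on k S (\<lambda>z. L (f z))"
  using assms(3)
proof (induction k arbitrary: f)
  case 0
  then show ?case by (simp add: assms(1) bounded_linear.continuous_on)
next
  case (Suc k)
  then have d: "f differentiable (at z)" if "z \<in> S" for z
    using that by simp
  have "Ck_on k S (\<lambda>z. L (pdx f z))" "Ck_on k S (\<lambda>z. L (pdy f z))"
    using Suc by simp_all
  then have "Ck_on k S (pdx (\<lambda>z. L (f z)))" "Ck_on k S (pdy (\<lambda>z. L (f z)))"
    using pd_bounded_linear(2,3)[OF assms(1) d]
    by (auto intro: Ck_on_cong[OF \<open>open S\<close>, rotated])
  then show ?case
    using pd_bounded_linear(1)[OF assms(1) d] by simp
qed

lemma Ck_on_add:
  assumes "open S" "Ck_on k S f" "Ck_on k S g"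
  shows "Ck_on k S (\<lambda>z. f z + g z)"
  using assms(2,3)
proof (induction k arbitrary: f g)
  case 0
  then show ?case by (simp add: continuous_on_add)
next
  case (Suc k)
  then have d: "f differentiable (at z)" "g differentiable (at z)" if "z \<in> S" for z
    using that by simp_all
  have "Ck_on k S (\<lambda>z. pdx f z + pdx g z)" "Ck_on k S (\<lambda>z. pdy f z + pdy g z)"
    using Suc by simp_all
  then have "Ck_on k S (pdx (\<lambda>z. f z + g z))" "Ck_on k S (pdy (\<lambda>z. f z + g z))"
    using pd_add[OF d] by (auto intro: Ck_on_cong[OF \<open>open S\<close>, rotated])
  then show ?case
    using d by simp
qed

lemma Ck_on_sum:
  assumes "open S" "finite I" "\<And>i. i \<in> I \<Longrightarrow> Ck_on k S (f i)"
  shows "Ck_on k S (\<lambda>z. \<Sum>i\<in>I. f i z)"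
  using assms(2,3)
  by (induction I rule: finite_induct) (auto intro: Ck_on_const[OF assms(1)] Ck_on_add[OF assms(1)])

text \<open>One product rule serves scalar and complex multiplication, inner products and the form
  \<open>K x \<bullet> y\<close> used later.\<close>

lemma Ck_on_bilinear:
  assumes "bounded_bilinear B" "open S" "Ck_on k S f" "Ck_on k S g"
  shows "Ck_on k S (\<lambda>z. B (f z) (g z))"
  using assms(3,4)
proof (induction k arbitrary: f g)
  case 0
  then show ?case by (simp add: assms(1) bounded_bilinear.continuous_on)
next
  case (Suc k)
  then have d: "f differentiable (at z)" "g differentiable (at z)" if "z \<in> S" for z
    using that by simp_all
  have "Ck_on k S f" "Ck_on k S g"
    using Suc.prems Ck_on_SucD by blast+
  then have "Ck_on k S (\<lambda>z. B (f z) (pdx g z) + B (pdx f z) (g z))"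
    "Ck_on k S (\<lambda>z. B (f z) (pdy g z) + B (pdy f z) (g z))"
    using Suc by (auto intro!: Ck_on_add[OF \<open>open S\<close>])
  then have "Ck_on k S (pdx (\<lambda>z. B (f z) (g z)))" "Ck_on k S (pdy (\<lambda>z. B (f z) (g z)))"
    using pd_bilinear(2,3)[OF assms(1) d]
    by (auto intro: Ck_on_cong[OF \<open>open S\<close>, rotated])
  then show ?case
    using pd_bilinear(1)[OF assms(1) d] by simp
qed

section \<open>Smoothness of holomorphic functions and of vectors of smooth functions\<close>

lemma has_derivative_complex:
  "(f has_field_derivative f') (at z) \<Longrightarrow> pdx f z = f'"
  "(f has_field_derivative f') (at z) \<Longrightarrow> pdy f z = f' * \<i>"
  using pdx_eq pdy_eq unfolding has_field_derivative_def by fastforce+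

lemma Ck_on_holomorphic:
  assumes "open S" "f holomorphic_on S"
  shows "Ck_on k S f"
  using assms(2)
proof (induction k arbitrary: f)
  case 0
  then show ?case by (simp add: holomorphic_on_imp_continuous_on)
next
  case (Suc k)
  have D: "(f has_field_derivative deriv f z) (at z)" if "z \<in> S" for z
    using that Suc.prems assms(1) holomorphic_derivI by blast
  then have "f differentiable (at z)" if "z \<in> S" for z
    using that field_differentiable_imp_differentiable field_differentiable_def by blast
  moreover have "deriv f holomorphic_on S"
    using Suc.prems assms(1) holomorphic_deriv by blast
  then have "Ck_on k S (deriv f)" "Ck_on k S (\<lambda>z. deriv f z * \<i>)"
    using Suc.IH by (auto intro!: holomorphic_intros)
  then have "Ck_on k S (pdx f)" "Ck_on k S (pdy f)"
    using has_derivative_complex[OF D] by (auto intro: Ck_on_cong[OF \<open>open S\<close>, rotated])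
  ultimately show ?case by simp
qed

lemma Ck_on_vec:
  assumes "open S" "\<And>j. Ck_on k S (f j)"
  shows "Ck_on k S (\<lambda>z. (\<chi> j. f j z) :: real ^ 'n)"
proof -
  have "Ck_on k S (\<lambda>z. \<Sum>j\<in>UNIV. f j z *\<^sub>R (axis j 1 :: real ^ 'n))"
    using bounded_bilinear_scaleR assms(1)
    by (intro Ck_on_sum) (auto intro!: Ck_on_bilinear[where B=scaleR] assms Ck_on_const)
  moreover have "(\<Sum>j\<in>UNIV. f j z *\<^sub>R axis j 1) = (\<chi> j. f j z)" for z
    by (simp add: vec_eq_iff axis_def if_distrib cong: if_cong)
  ultimately show ?thesis by simp
qed

lemma smooth_onD:
  assumes "smooth_on S f"
  shows "continuous_on S f" "\<And>z. z \<in> S \<Longrightarrow> f differentiable (at z)"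
    "smooth_on S (pdx f)" "smooth_on S (pdy f)"
proof -
  have "Ck_on 0 S f" "Ck_on (Suc k) S f" for k
    using assms unfolding smooth_on_def by blast+
  then show "continuous_on S f" "\<And>z. z \<in> S \<Longrightarrow> f differentiable (at z)"
    "smooth_on S (pdx f)" "smooth_on S (pdy f)"
    by (simp_all add: smooth_on_def)
qed

lemma smooth_on_subset: "smooth_on S f \<Longrightarrow> T \<subseteq> S \<Longrightarrow> smooth_on T f"
  unfolding smooth_on_def using Ck_on_subset by blast

section \<open>Symmetry of mixed second derivatives\<close>

lemma has_real_derivative_line:
  fixes f :: "complex \<Rightarrow> real"
  assumes "f differentiable (at (w + of_real s * d))"
  shows "((\<lambda>s. f (w + of_real s * d)) has_real_derivative frechet_derivative f (at (w + of_real s * d)) d) (at s)"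
proof -
  have 1: "((\<lambda>s::real. w + of_real s * d) has_derivative (\<lambda>h. of_real h * d)) (at s)"
    by (auto intro!: derivative_eq_intros)
  have 2: "(f has_derivative frechet_derivative f (at (w + of_real s * d))) (at (w + of_real s * d))"
    using assms frechet_derivative_works by blast
  have "linear (frechet_derivative f (at (w + of_real s * d)))"
    using assms by (simp add: linear_frechet_derivative)
  then have "frechet_derivative f (at (w + of_real s * d)) (of_real h * d)
      = frechet_derivative f (at (w + of_real s * d)) d * h" for h
    by (metis linear_scale mult.commute real_scaleR_def scaleR_conv_of_real)
  with has_derivative_compose[OF 1 2] show ?thesis
    by (simp add: has_field_derivative_def mult_commute_abs)
qed

text \<open>The mean value theorem is applied twice, in direction \<open>d\<close> to the increment
  along \<open>e\<close>, then in direction \<open>e\<close> to the derivative along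
  \<open>d\<close>. The second difference is symmetric in \<open>d\<close> and \<open>e\<close>, so
  exchanging them expresses it through the other mixed derivative.\<close>

lemma second_difference:
  fixes f :: "complex \<Rightarrow> real" and d e :: complex
  assumes f: "\<And>w. w \<in> ball z r \<Longrightarrow> f differentiable (at w)"
    and g: "\<And>w. w \<in> ball z r \<Longrightarrow> (\<lambda>w. frechet_derivative f (at w) d) differentiable (at w)"
    and h: "0 < h" "h < r / 2" and de: "norm d = 1" "norm e = 1"
  shows "\<exists>w. norm (w - z) \<le> 2 * h \<and>
    f (z + of_real h * d + of_real h * e) - f (z + of_real h * d) - f (z + of_real h * e) + f z
      = h\<^sup>2 * frechet_derivative (\<lambda>w. frechet_derivative f (at w) d) (at w) e"
proof -
  have in_ball: "z + of_real s * d + of_real t * e \<in> ball z r" if "0 \<le> s" "s \<le> h" "0 \<le> t" "t \<le> h" for s t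
  proof -
    have "norm (of_real s * d + of_real t * e) \<le> s + t"
      using norm_triangle_ineq[of "of_real s * d" "of_real t * e"] de that by (simp add: norm_mult)
    moreover have "dist z (z + of_real s * d + of_real t * e) = norm (of_real s * d + of_real t * e)"
      by (metis add.assoc add_diff_cancel_left' dist_norm norm_minus_commute)
    ultimately show ?thesis
      using h that by (simp del: dist_norm)
  qed
  let ?fd = "\<lambda>w. frechet_derivative f (at w) d"
  have D: "((\<lambda>s. f (z + of_real h * e + of_real s * d) - f (z + of_real s * d)) has_real_derivative
      ?fd (z + of_real h * e + of_real s * d) - ?fd (z + of_real s * d)) (at s)"
    if "0 \<le> s" "s \<le> h" for s
    using in_ball[of s h] in_ball[of s 0] that h
    by (intro DERIV_diff has_real_derivative_line f) (simp_all add: algebra_simps)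
  obtain s where s: "0 < s" "s < h"
    and s_eq: "f (z + of_real h * e + of_real h * d) - f (z + of_real h * d)
      - (f (z + of_real h * e + of_real 0 * d) - f (z + of_real 0 * d))
      = (h - 0) * (?fd (z + of_real h * e + of_real s * d) - ?fd (z + of_real s * d))"
    using MVT2[OF h(1), of "\<lambda>s. f (z + of_real h * e + of_real s * d) - f (z + of_real s * d)", OF D] by blast
  have D2: "((\<lambda>t. ?fd (z + of_real s * d + of_real t * e)) has_real_derivative
      frechet_derivative ?fd (at (z + of_real s * d + of_real t * e)) e) (at t)"
    if "0 \<le> t" "t \<le> h" for t
    using in_ball[of s t] that s by (intro has_real_derivative_line g) simp_all
  obtain t where t: "0 < t" "t < h"
    and t_eq: "?fd (z + of_real s * d + of_real h * e) - ?fd (z + of_real s * d + of_real 0 * e)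
      = (h - 0) * frechet_derivative ?fd (at (z + of_real s * d + of_real t * e)) e"
    using MVT2[OF h(1), of "\<lambda>t. ?fd (z + of_real s * d + of_real t * e)", OF D2] by blast
  let ?w = "z + of_real s * d + of_real t * e"
  have "norm (?w - z) \<le> s + t"
    using norm_triangle_ineq[of "of_real s * d" "of_real t * e"] de s t by (simp add: norm_mult add.assoc)
  then have "norm (?w - z) \<le> 2 * h"
    using s t by linarith
  moreover have "?fd (z + of_real h * e + of_real s * d) - ?fd (z + of_real s * d)
      = h * frechet_derivative ?fd (at ?w) e"
    using t_eq by (simp add: algebra_simps)
  then have "f (z + of_real h * d + of_real h * e) - f (z + of_real h * d) - f (z + of_real h * e) + f z
      = h * (h * frechet_derivative ?fd (at ?w) e)"
    using s_eq by (simp add: algebra_simps)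
  ultimately show ?thesis
    by (intro exI[of _ ?w]) (simp add: power2_eq_square)
qed

lemma pdx_pdy_commute_real:
  fixes f :: "complex \<Rightarrow> real"
  assumes "open S" "z \<in> S" "Ck_on 2 S f"
  shows "pdx (pdy f) z = pdy (pdx f) z"
proof -
  have C: "\<forall>z\<in>S. f differentiable (at z)" "\<forall>z\<in>S. pdx f differentiable (at z)"
    "\<forall>z\<in>S. pdy f differentiable (at z)" "continuous_on S (pdy (pdx f))" "continuous_on S (pdx (pdy f))"
    using assms(3) by (simp_all add: numeral_2_eq_2)
  obtain r where r: "r > 0" "ball z r \<subseteq> S"
    using assms openE by blast
  have cont: "isCont (pdy (pdx f)) z" "isCont (pdx (pdy f)) z"
    using C(4,5) assms(1,2) continuous_on_eq_continuous_at by blast+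
  have "\<bar>pdx (pdy f) z - pdy (pdx f) z\<bar> \<le> e" if "e > 0" for e
  proof -
    obtain d1 where d1: "d1 > 0" "\<And>w. norm (w - z) < d1 \<Longrightarrow> \<bar>pdy (pdx f) w - pdy (pdx f) z\<bar> < e / 2"
      using cont(1) \<open>e > 0\<close> unfolding continuous_at_eps_delta dist_norm
      by (metis half_gt_zero real_norm_def)
    obtain d2 where d2: "d2 > 0" "\<And>w. norm (w - z) < d2 \<Longrightarrow> \<bar>pdx (pdy f) w - pdx (pdy f) z\<bar> < e / 2"
      using cont(2) \<open>e > 0\<close> unfolding continuous_at_eps_delta dist_norm
      by (metis half_gt_zero real_norm_def)
    \<comment> \<open>The mean value points lie within \<open>2 * h\<close> of \<open>z\<close>; a
      quarter of the minimum puts them inside both continuity neighbourhoods.\<close>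
    define h where "h = Min {r, d1, d2} / 4"
    have h: "h > 0" "h < r / 2" "2 * h < d1" "2 * h < d2"
      using r d1 d2 by (auto simp: h_def min_def)
    let ?D = "f (z + of_real h + of_real h * \<i>) - f (z + of_real h) - f (z + of_real h * \<i>) + f z"
    have d: "f differentiable (at w)" "(\<lambda>w. frechet_derivative f (at w) 1) differentiable (at w)"
      "(\<lambda>w. frechet_derivative f (at w) \<i>) differentiable (at w)" if "w \<in> ball z r" for w
      using C that r(2) unfolding pdx_def pdy_def by blast+
    obtain w1 where w1: "norm (w1 - z) \<le> 2 * h" "?D = h\<^sup>2 * pdy (pdx f) w1"
      using second_difference[OF d(1,2) h(1,2), where e=\<i>] unfolding pdx_def pdy_def by auto
    obtain w2 where w2: "norm (w2 - z) \<le> 2 * h" "?D = h\<^sup>2 * pdx (pdy f) w2"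
      using second_difference[OF d(1,3) h(1,2), where e=1] unfolding pdx_def pdy_def
      by (auto simp: algebra_simps)
    have "pdy (pdx f) w1 = pdx (pdy f) w2"
      using w1 w2 h by simp
    then show ?thesis
      using d1(2)[of w1] d2(2)[of w2] w1 w2 h by linarith
  qed
  then show ?thesis
    by (metis abs_le_zero_iff eq_iff_diff_eq_0 field_le_epsilon add.left_neutral)
qed

lemma pdx_pdy_commute:
  fixes f :: "complex \<Rightarrow> 'a::real_inner"
  assumes "open S" "z \<in> S" "Ck_on 2 S f"
  shows "pdx (pdy f) z = pdy (pdx f) z"
proof -
  have d: "\<forall>z\<in>S. f differentiable (at z)" "\<forall>z\<in>S. pdx f differentiable (at z)"
    "\<forall>z\<in>S. pdy f differentiable (at z)"
    using assms(3) by (simp_all add: numeral_2_eq_2)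
  have "pdx (pdy f) z \<bullet> v = pdy (pdx f) z \<bullet> v" for v
  proof -
    have L: "bounded_linear (\<lambda>x. x \<bullet> v)"
      by (rule bounded_linear_inner_left)
    have "pdx (pdy (\<lambda>z. f z \<bullet> v)) z = pdy (pdx (\<lambda>z. f z \<bullet> v)) z"
      using pdx_pdy_commute_real[OF assms(1,2) Ck_on_bounded_linear[OF L assms(1,3)]] .
    moreover have "pdx (pdy (\<lambda>z. f z \<bullet> v)) z = pdx (\<lambda>z. pdy f z \<bullet> v) z"
      using pd_bounded_linear(3)[OF L] d by (intro pdx_cong[OF assms(1,2)]) auto
    moreover have "pdy (pdx (\<lambda>z. f z \<bullet> v)) z = pdy (\<lambda>z. pdx f z \<bullet> v) z"
      using pd_bounded_linear(2)[OF L] d by (intro pdy_cong[OF assms(1,2)]) auto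
    ultimately show ?thesis
      using pd_bounded_linear(2)[OF L, of "pdy f" z] pd_bounded_linear(3)[OF L, of "pdx f" z] d assms(2)
      by simp
  qed
  then show ?thesis
    using vector_eq_rdot by blast
qed

section \<open>Null sets, dominated convergence and Stokes' theorem\<close>

lemma continuous_on_compact_integrable:
  fixes f :: "'a::euclidean_space \<Rightarrow> 'b::euclidean_space"
  assumes "compact S" "continuous_on S f"
  shows "f integrable_on S"
  using borel_integrable_compact[OF assms] set_borel_integral_eq_integral(1)[of S f]
  by (simp add: set_integrable_def indicator_scaleR_eq_if if_distrib cong: if_cong)

lemma dominated_convergence_ae:
  fixes f :: "nat \<Rightarrow> 'n::euclidean_space \<Rightarrow> real"
  assumes N: "negligible N" and f: "\<And>k. f k integrable_on S" and h: "h integrable_on S"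
    and le: "\<And>k x. x \<in> S - N \<Longrightarrow> \<bar>f k x\<bar> \<le> h x"
    and conv: "\<And>x. x \<in> S - N \<Longrightarrow> (\<lambda>k. f k x) \<longlonglongrightarrow> g x"
  shows "g integrable_on S" "(\<lambda>k. integral S (f k)) \<longlonglongrightarrow> integral S g"
proof -
  let ?r = "\<lambda>u x. if x \<in> N then 0 else u x :: real"
  have "?r (f k) integrable_on S" for k
    by (rule integrable_spike[OF f N]) auto
  moreover have "?r h integrable_on S"
    by (rule integrable_spike[OF h N]) auto
  moreover have "norm (?r (f k) x) \<le> ?r h x" if "x \<in> S" for k x
    using le that by auto
  moreover have "(\<lambda>k. ?r (f k) x) \<longlonglongrightarrow> ?r g x" if "x \<in> S" for x
    using conv that by auto
  ultimately have *: "?r g integrable_on S" "(\<lambda>k. integral S (?r (f k))) \<longlonglongrightarrow> integral S (?r g)"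
    using dominated_convergence[of "\<lambda>k. ?r (f k)" S "?r h" "?r g"] by blast+
  show "g integrable_on S"
    by (rule integrable_spike[OF *(1) N]) auto
  have "integral S (?r (f k)) = integral S (f k)" for k
    by (rule integral_spike[OF N]) auto
  moreover have "integral S (?r g) = integral S g"
    by (rule integral_spike[OF N]) auto
  ultimately show "(\<lambda>k. integral S (f k)) \<longlonglongrightarrow> integral S g"
    using *(2) by simp
qed

text \<open>Domination is asked only of the difference quotients at \<open>t0\<close>, off a null
  set that may depend on \<open>t0\<close>. For the area this set consists of the points where F +
  t0 W is not immersed, and it moves with \<open>t0\<close>.\<close>

lemma has_real_derivative_integral:
  fixes f :: "real \<Rightarrow> 'n::euclidean_space \<Rightarrow> real"
  assumes N: "negligible N" and S: "S \<in> lmeasurable" and "\<epsilon> > 0"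
    and int: "\<And>t. \<bar>t - t0\<bar> < \<epsilon> \<Longrightarrow> f t integrable_on S"
    and deriv: "\<And>z. z \<in> S - N \<Longrightarrow> ((\<lambda>t. f t z) has_real_derivative f' z) (at t0)"
    and lip: "\<And>t z. \<bar>t - t0\<bar> < \<epsilon> \<Longrightarrow> z \<in> S - N \<Longrightarrow> \<bar>f t z - f t0 z\<bar> \<le> C * \<bar>t - t0\<bar>"
  shows "f' integrable_on S"
    and "((\<lambda>t. integral S (f t)) has_real_derivative integral S f') (at t0)"
proof -
  have conv: "f' integrable_on S \<and>
      (\<lambda>k. (integral S (f (X k)) - integral S (f t0)) / (X k - t0)) \<longlonglongrightarrow> integral S f'"
    if X: "X \<longlonglongrightarrow> t0" "\<And>k. X k \<noteq> t0" "\<And>k. \<bar>X k - t0\<bar> < \<epsilon>" for X :: "nat \<Rightarrow> real"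
  proof -
    have i: "f (X k) integrable_on S" "f t0 integrable_on S" for k
      using int X(3) \<open>\<epsilon> > 0\<close> by simp_all
    have q: "(\<lambda>z. (f (X k) z - f t0 z) / (X k - t0)) integrable_on S" for k
      using i by (intro integrable_on_divide integrable_diff)
    have le: "\<bar>(f (X k) z - f t0 z) / (X k - t0)\<bar> \<le> C" if "z \<in> S - N" for k z
      using lip[OF X(3) that] X(2) by (simp add: abs_divide divide_simps)
    have lim: "(\<lambda>k. (f (X k) z - f t0 z) / (X k - t0)) \<longlonglongrightarrow> f' z" if "z \<in> S - N" for z
      using deriv[OF that] X unfolding has_field_derivative_iff tendsto_at_iff_sequentially
      by (auto simp: o_def)
    have "integral S (\<lambda>z. (f (X k) z - f t0 z) / (X k - t0))
        = (integral S (f (X k)) - integral S (f t0)) / (X k - t0)" for k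
      using i X(2) by (simp add: integral_diff[OF i])
    then show ?thesis
      using dominated_convergence_ae[OF N q integrable_on_const[OF S] le lim]
      by (simp only: conj_absorb simp_thms)
  qed
  \<comment> \<open>Integrability of \<open>f'\<close> needs one admissible sequence; the shift by 2
    keeps its terms strictly within \<open>\<epsilon>\<close> of \<open>t0\<close>.\<close>
  have "(\<lambda>k. t0 + \<epsilon> / real (k + 2)) \<longlonglongrightarrow> t0 + 0"
    by (intro tendsto_add tendsto_const LIMSEQ_ignore_initial_segment[OF lim_const_over_n])
  moreover have "\<bar>t0 + \<epsilon> / real (k + 2) - t0\<bar> < \<epsilon>" for k
    using \<open>\<epsilon> > 0\<close> by (simp add: divide_less_eq mult_less_cancel_left1)
  ultimately show "f' integrable_on S"
    using conv[of "\<lambda>k. t0 + \<epsilon> / real (k + 2)"] \<open>\<epsilon> > 0\<close> by simp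
  show "((\<lambda>t. integral S (f t)) has_real_derivative integral S f') (at t0)"
    unfolding has_field_derivative_iff tendsto_at_iff_sequentially
  proof (intro allI impI)
    fix X :: "nat \<Rightarrow> real"
    assume X: "\<forall>i. X i \<in> UNIV - {t0}" "X \<longlonglongrightarrow> t0"
    obtain n where n: "\<And>k. k \<ge> n \<Longrightarrow> \<bar>X k - t0\<bar> < \<epsilon>"
      using X(2) \<open>\<epsilon> > 0\<close> unfolding LIMSEQ_def dist_real_def by blast
    have "(\<lambda>k. (integral S (f (X (k + n))) - integral S (f t0)) / (X (k + n) - t0)) \<longlonglongrightarrow> integral S f'"
      using conv[of "\<lambda>k. X (k + n)"] X n LIMSEQ_ignore_initial_segment[OF X(2)] by auto
    then show "((\<lambda>t. (integral S (f t) - integral S (f t0)) / (t - t0)) \<circ> X) \<longlonglongrightarrow> integral S f'"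
      unfolding o_def by (rule LIMSEQ_offset)
  qed
qed

text \<open>Pair \<open>h\<close> with the coordinate orthogonal to \<open>e\<close>. The resulting
  map sends \<open>S\<close> into the imaginary axis, which is null, and its derivative is injective
  on \<open>S\<close>: a vector killed by the second coordinate is a real multiple of
  \<open>e\<close>, on which the derivative of \<open>h\<close> does not vanish. No implicit
  function theorem is involved, so differentiability at the points of \<open>S\<close> is
  enough.\<close>

lemma negligible_regular_zero_set:
  fixes h :: "complex \<Rightarrow> real"
  assumes "norm e = 1"
    and h: "\<And>z. z \<in> S \<Longrightarrow> h differentiable (at z) \<and> h z = 0 \<and> frechet_derivative h (at z) e \<noteq> 0"
  shows "negligible S"
proof -
  let ?f' = "\<lambda>z v. Complex (frechet_derivative h (at z) v) (Im (v * cnj e))"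
  have d: "((\<lambda>z. Complex (h z) (Im (z * cnj e))) has_derivative ?f' z) (at z within S)" if "z \<in> S" for z
  proof -
    have "(h has_derivative frechet_derivative h (at z)) (at z within S)"
      using h[OF that] frechet_derivative_works has_derivative_at_withinI by blast
    then show ?thesis
      unfolding Complex_eq by (auto intro!: derivative_eq_intros)
  qed
  have inj: "inj (?f' z)" if "z \<in> S" for z
  proof -
    have lin: "linear (frechet_derivative h (at z))"
      using h[OF that] by (simp add: linear_frechet_derivative)
    have "v = 0" if v: "?f' z v = 0" for v
    proof -
      have "Im (v * cnj e) = 0" "frechet_derivative h (at z) v = 0"
        using v by (auto simp: complex_eq_iff)
      moreover have "v = (v * cnj e) * e"
        using assms(1) complex_norm_square[of e] by (simp add: mult.assoc mult.commute[of "cnj e"])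
      moreover have "v * cnj e = of_real (Re (v * cnj e))"
        using \<open>Im (v * cnj e) = 0\<close> by (simp add: complex_eq_iff)
      ultimately have "v = Re (v * cnj e) *\<^sub>R e"
        by (simp only: scaleR_conv_of_real)
      then obtain s where s: "v = s *\<^sub>R e"
        by blast
      then have "s * frechet_derivative h (at z) e = 0"
        using linear_scale[OF lin, of s e] \<open>frechet_derivative h (at z) v = 0\<close> by simp
      then show ?thesis
        using h[OF \<open>z \<in> S\<close>] s by simp
    qed
    moreover have "linear (?f' z)"
      using has_derivative_linear[OF d[OF that]] .
    ultimately show ?thesis
      using linear_injective_0 by blast
  qed
  have "negligible {z::complex. z \<bullet> 1 = 0}"
    by (rule negligible_standard_hyperplane) (simp add: Basis_complex_def)
  then have "negligible {z \<in> S. Complex (h z) (Im (z * cnj e)) \<in> {z. z \<bullet> 1 = 0}}"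
    using negligible_differentiable_vimage[of "{z::complex. z \<bullet> 1 = 0}" S ?f' "\<lambda>z. Complex (h z) (Im (z * cnj e))"]
      inj d by blast
  moreover have "h z = 0" if "z \<in> S" for z
    using h[OF that] by simp
  then have "{z \<in> S. Complex (h z) (Im (z * cnj e)) \<in> {z. z \<bullet> 1 = 0}} = S"
    by (auto simp: inner_complex_def)
  ultimately show ?thesis by simp
qed

section \<open>Stokes' theorem by translation of the domain\<close>

lemma has_integral_translation:
  fixes g :: "'a::euclidean_space \<Rightarrow> real"
  assumes "bounded S" "\<And>z. z \<notin> S \<Longrightarrow> g z = 0" "(g has_integral I) UNIV"
  shows "((\<lambda>z. g (v + z)) has_integral I) UNIV"
proof -
  obtain a where a: "S \<subseteq> cbox (-a) a"
    using assms(1) bounded_subset_cbox_symmetric by blast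
  have "(g has_integral I) (cbox ((-a - v) + v) ((a - v) + v))"
  proof -
    have "(\<lambda>x. if x \<in> cbox (-a) a then g x else 0) = g"
      using assms(2) a by (auto simp: fun_eq_iff simp del: mem_box)
    then have "(g has_integral I) (cbox (-a) a)"
      using assms(3) has_integral_restrict_UNIV[of "cbox (-a) a" g I] by simp
    then show ?thesis by simp
  qed
  then have "((\<lambda>z. g (v + z)) has_integral I) (cbox (-a - v) (a - v))"
    unfolding has_integral_shift_cbox_iff[symmetric] by (simp add: o_def)
  then show ?thesis
  proof (rule has_integral_on_superset)
    fix x assume "x \<notin> cbox (-a - v) (a - v)"
    then have "v + x \<notin> cbox (-a) a"
      by (auto simp: mem_box inner_diff_left inner_add_left algebra_simps)
    then show "g (v + x) = 0"
      using a assms(2) by blast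
  qed simp
qed

text \<open>The extension of $h$ by zero is Lipschitz, so its translation difference quotients, which have
  integral zero, converge boundedly. At a boundary point they may only fail to converge where
  the directional derivative does not vanish, and such points form a null set.\<close>

lemma integral_directional_derivative_eq_0:
  fixes h :: "complex \<Rightarrow> real"
  assumes "compact \<Omega>" "open U" "\<Omega> \<subseteq> U" "Ck_on 1 U h" "\<And>z. z \<in> frontier \<Omega> \<Longrightarrow> h z = 0" "norm e = 1"
  shows "integral \<Omega> (\<lambda>z. frechet_derivative h (at z) e) = 0"
proof -
  have d: "h differentiable (at z)" if "z \<in> U" for z
    using assms(4) that by simp
  have cont: "continuous_on U h" "continuous_on U (pdx h)" "continuous_on U (pdy h)"
    using assms(4) Ck_on_SucD[of 0 U h] by simp_all
  \<comment> \<open>The compact \<open>r\<close>-neighbourhood of \<open>\<Omega>\<close> gives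
    bounds on the derivatives over convex balls and contains the support of every difference
    quotient with step at most \<open>r\<close>.\<close>
  obtain r where r: "r > 0" "(\<Union>x\<in>\<Omega>. cball x r) \<subseteq> U"
    using compact_subset_open_imp_cball_epsilon_subset assms by metis
  let ?K = "\<Union>x\<in>\<Omega>. cball x r"
  have K: "compact ?K"
    using assms(1) compact_minkowski_sum_cball by blast
  have "bounded (pdx h ` ?K)" "bounded (pdy h ` ?K)"
    using cont(2,3) K r(2) by (meson compact_continuous_image compact_imp_bounded continuous_on_subset)+
  then obtain C1 C2 where C: "\<forall>z\<in>?K. \<bar>pdx h z\<bar> \<le> C1" "\<forall>z\<in>?K. \<bar>pdy h z\<bar> \<le> C2"
    unfolding bounded_iff by auto
  define B where "B = max 0 (C1 + C2)"
  have "B \<ge> 0" by (simp add: B_def)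
  have lip: "\<bar>h x - h y\<bar> \<le> B * norm (x - y)" if "z \<in> \<Omega>" "x \<in> cball z r" "y \<in> cball z r" for x y z
  proof -
    have "norm (h x - h y) \<le> B * norm (x - y)"
    proof (rule differentiable_bound[OF convex_cball])
      fix w assume w: "w \<in> cball z r"
      then have "w \<in> ?K"
        using that by blast
      then have "w \<in> U"
        using r(2) by blast
      then show "(h has_derivative (\<lambda>v. Re v *\<^sub>R pdx h w + Im v *\<^sub>R pdy h w)) (at w within cball z r)"
        using has_derivative_pd[OF d] has_derivative_at_withinI by blast
      show "onorm (\<lambda>v. Re v *\<^sub>R pdx h w + Im v *\<^sub>R pdy h w) \<le> B"
      proof (rule onorm_le)
        fix v
        have "\<bar>Re v * pdx h w + Im v * pdy h w\<bar> \<le> \<bar>Re v\<bar> * \<bar>pdx h w\<bar> + \<bar>Im v\<bar> * \<bar>pdy h w\<bar>"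
          by (metis abs_mult abs_triangle_ineq)
        also have "\<dots> \<le> norm v * C1 + norm v * C2"
          using C \<open>w \<in> ?K\<close> abs_Re_le_cmod abs_Im_le_cmod by (intro add_mono mult_mono) auto
        also have "\<dots> \<le> B * norm v"
          unfolding B_def by (metis distrib_left max.cobounded2 mult.commute mult_right_mono norm_ge_zero)
        finally show "norm (Re v *\<^sub>R pdx h w + Im v *\<^sub>R pdy h w) \<le> B * norm v" by simp
      qed
    qed (use that in auto)
    then show ?thesis by simp
  qed
  define g where "g = (\<lambda>z. if z \<in> \<Omega> then h z else 0)"
  \<comment> \<open>A segment leaving \<open>\<Omega>\<close> crosses the frontier, where
    \<open>h\<close> vanishes, so the Lipschitz estimate up to the crossing point bounds
    \<open>h x\<close>.\<close>
  have cross: "\<bar>h x\<bar> \<le> B * norm (x - y)" if "x \<in> \<Omega>" "y \<notin> \<Omega>" "norm (x - y) \<le> r" for x y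
  proof -
    have "x \<in> closed_segment x y \<inter> \<Omega>" "y \<in> closed_segment x y - \<Omega>"
      using that by simp_all
    then have "closed_segment x y \<inter> frontier \<Omega> \<noteq> {}"
      by (intro connected_Int_frontier) auto
    then obtain p where p: "p \<in> closed_segment x y" "p \<in> frontier \<Omega>"
      by blast
    then have "norm (x - p) \<le> norm (x - y)"
      by (metis dist_norm dist_in_closed_segment(1) norm_minus_commute)
    moreover from this have "\<bar>h x - h p\<bar> \<le> B * norm (x - p)"
      using that r by (intro lip) (auto simp: dist_norm)
    ultimately show ?thesis
      using assms(5)[OF p(2)] \<open>B \<ge> 0\<close> by (smt (verit) mult_left_mono)
  qed
  have glip: "\<bar>g (v + z) - g z\<bar> \<le> B * norm v" if "norm v \<le> r" for v z
  proof (cases "z \<in> \<Omega>")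
    case True
    then show ?thesis
      using lip[OF True, of "v + z" z] cross[OF True, of "v + z"] that r \<open>B \<ge> 0\<close>
      by (auto simp: g_def dist_norm)
  next
    case False
    then show ?thesis
      using cross[of "v + z" z] that \<open>B \<ge> 0\<close> by (auto simp: g_def)
  qed
  define D where "D = (\<lambda>z. frechet_derivative h (at z) e)"
  let ?N = "{z \<in> frontier \<Omega>. D z \<noteq> 0}"
  have N: "negligible ?N"
  proof (rule negligible_regular_zero_set[OF \<open>norm e = 1\<close>])
    fix z assume z: "z \<in> ?N"
    then have "z \<in> U"
      using assms(1,3) frontier_subset_compact by blast
    then show "h differentiable (at z) \<and> h z = 0 \<and> frechet_derivative h (at z) e \<noteq> 0"
      using d assms(5) z by (auto simp: D_def)
  qed
  have "g integrable_on UNIV"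
    unfolding g_def integrable_restrict_UNIV
    using cont(1) assms(1,3) continuous_on_compact_integrable continuous_on_subset by blast
  then obtain I where I: "(g has_integral I) UNIV"
    by blast
  define X where "X = (\<lambda>k. r / real (k + 2))"
  have X: "X k > 0" "X k \<le> r" for k
    using r by (auto simp: X_def field_simps)
  have X0: "X \<longlonglongrightarrow> 0"
    unfolding X_def by (intro LIMSEQ_ignore_initial_segment[OF lim_const_over_n])
  define q where "q = (\<lambda>k z. (g (X k *\<^sub>R e + z) - g z) / X k)"
  have q_int: "(q k has_integral 0) UNIV" for k
  proof -
    have "((\<lambda>z. g (X k *\<^sub>R e + z)) has_integral I) UNIV"
      using has_integral_translation[OF compact_imp_bounded[OF assms(1)] _ I] by (simp add: g_def)
    from has_integral_divide[OF has_integral_diff[OF this I], of "X k"] show ?thesis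
      by (simp add: q_def)
  qed
  have q_bound: "\<bar>q k z\<bar> \<le> (if z \<in> ?K then B else 0)" for k z
  proof (cases "z \<in> ?K")
    case True
    have "\<bar>g (X k *\<^sub>R e + z) - g z\<bar> \<le> B * X k"
      using glip[of "X k *\<^sub>R e" z] X[of k] \<open>norm e = 1\<close> by (simp add: abs_of_pos)
    then show ?thesis
      using True X[of k] by (simp add: q_def abs_divide divide_simps)
  next
    case False
    have "z \<notin> \<Omega>"
      using False r by (auto intro!: bexI[of _ z])
    moreover have "z \<in> cball (X k *\<^sub>R e + z) r"
      using X[of k] \<open>norm e = 1\<close> by (simp add: dist_norm)
    then have "X k *\<^sub>R e + z \<notin> \<Omega>"
      using False by blast
    ultimately show ?thesis
      using False by (simp add: q_def g_def)
  qed
  have line: "(\<lambda>k. (h (X k *\<^sub>R e + z) - h z) / X k) \<longlonglongrightarrow> D z" if "z \<in> U" for z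
  proof -
    have "((\<lambda>s. h (z + of_real s * e)) has_real_derivative D z) (at 0)"
      using has_real_derivative_line[of h z 0 e] d[OF that] by (simp add: D_def)
    then have "\<forall>Y. (\<forall>i. Y i \<in> UNIV - {0}) \<longrightarrow> Y \<longlonglongrightarrow> 0 \<longrightarrow>
        ((\<lambda>s. (h (z + of_real s * e) - h z) / s) \<circ> Y) \<longlonglongrightarrow> D z"
      unfolding has_field_derivative_iff tendsto_at_iff_sequentially by simp
    moreover have "X k \<noteq> 0" for k
      using X(1)[of k] by simp
    ultimately show ?thesis
      using X0 by (auto simp: o_def scaleR_conv_of_real add.commute)
  qed
  have shift: "(\<lambda>k. X k *\<^sub>R e + z) \<longlonglongrightarrow> z" for z
    using tendsto_add[OF tendsto_scaleR[OF X0 tendsto_const[of e]] tendsto_const[of z]] by simp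
  have q_lim: "(\<lambda>k. q k z) \<longlonglongrightarrow> (if z \<in> \<Omega> then D z else 0)" if "z \<notin> ?N" for z
  proof (cases "z \<in> interior \<Omega>")
    case True
    then have "z \<in> \<Omega>" "z \<in> U"
      using interior_subset assms(3) by blast+
    have "\<forall>\<^sub>F k in sequentially. X k *\<^sub>R e + z \<in> interior \<Omega>"
      using topological_tendstoD[OF shift open_interior True] .
    then have "\<forall>\<^sub>F k in sequentially. (h (X k *\<^sub>R e + z) - h z) / X k = q k z"
      by eventually_elim (use interior_subset \<open>z \<in> \<Omega>\<close> in \<open>auto simp: q_def g_def\<close>)
    then show ?thesis
      using line[OF \<open>z \<in> U\<close>] \<open>z \<in> \<Omega>\<close> by (simp add: tendsto_cong)
  next
    case False
    show ?thesis
    proof (cases "z \<in> \<Omega>")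
      case True
      then have fr: "z \<in> frontier \<Omega>"
        using False assms(1) by (simp add: frontier_def compact_imp_closed)
      then have "D z = 0" "h z = 0" "z \<in> U"
        using that assms(3,5) True by auto
      \<comment> \<open>Depending on whether the shifted point lies in \<open>\<Omega>\<close>,
        \<open>q k z\<close> is either the difference quotient of \<open>h\<close> or 0. Both tend
        to 0 because \<open>D z = 0\<close>.\<close>
      have "(\<lambda>k. q k z) \<longlonglongrightarrow> 0"
      proof (rule Lim_null_comparison)
        show "\<forall>\<^sub>F k in sequentially. norm (q k z) \<le> \<bar>(h (X k *\<^sub>R e + z) - h z) / X k\<bar>"
          using \<open>h z = 0\<close> True by (auto simp: q_def g_def)
        show "(\<lambda>k. \<bar>(h (X k *\<^sub>R e + z) - h z) / X k\<bar>) \<longlonglongrightarrow> 0"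
          using tendsto_rabs[OF line[OF \<open>z \<in> U\<close>]] \<open>D z = 0\<close> by simp
      qed
      then show ?thesis
        using \<open>D z = 0\<close> by simp
    next
      case False
      have "\<forall>\<^sub>F k in sequentially. X k *\<^sub>R e + z \<in> - \<Omega>"
        using topological_tendstoD[OF shift, of "- \<Omega>" z] False compact_imp_closed[OF assms(1)]
        by (simp add: open_Compl)
      then have "\<forall>\<^sub>F k in sequentially. 0 = q k z"
        by eventually_elim (use False in \<open>auto simp: q_def g_def\<close>)
      then show ?thesis
        using False tendsto_const[of "0::real"] by (simp add: tendsto_cong)
    qed
  qed
  have "(\<lambda>k. integral UNIV (q k)) \<longlonglongrightarrow> integral UNIV (\<lambda>z. if z \<in> \<Omega> then D z else 0)"
  proof (rule dominated_convergence_ae(2)[OF N])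
    show "q k integrable_on UNIV" for k
      using q_int by blast
    show "(\<lambda>z. if z \<in> ?K then B else 0) integrable_on UNIV"
      unfolding integrable_restrict_UNIV using K by (intro integrable_on_const lmeasurable_compact)
  qed (use q_bound q_lim in auto)
  moreover have "integral UNIV (q k) = 0" for k
    using q_int by blast
  ultimately show ?thesis
    by (simp add: D_def integral_restrict_UNIV LIMSEQ_const_iff)
qed

text \<open>The integrand is the divergence expression d/dx B(W, Z_y) - d/dy B(W, Z_x), as the mixed
  second derivatives of \<open>Z\<close> cancel. Vanishing of \<open>W\<close> on the frontier makes
  both products vanish there.\<close>

lemma integral_jacobian_eq_0:
  fixes W :: "complex \<Rightarrow> 'a::real_inner" and Z :: "complex \<Rightarrow> 'b::real_inner"
    and B :: "'a \<Rightarrow> 'b \<Rightarrow> real"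
  assumes B: "bounded_bilinear B" and "compact \<Omega>" "open U" "\<Omega> \<subseteq> U" "smooth_on U W" "smooth_on U Z"
    and W0: "\<And>z. z \<in> frontier \<Omega> \<Longrightarrow> W z = 0"
  shows "integral \<Omega> (\<lambda>z. B (pdx W z) (pdy Z z) - B (pdy W z) (pdx Z z)) = 0"
proof -
  note W = smooth_onD[OF assms(5)] and Z = smooth_onD[OF assms(6)]
  note Zx = smooth_onD[OF Z(3)] and Zy = smooth_onD[OF Z(4)]
  have Ck: "Ck_on 1 U (\<lambda>z. B (W z) (pdy Z z))" "Ck_on 1 U (\<lambda>z. B (W z) (pdx Z z))"
    using assms(5) Z(3,4) by (auto intro!: Ck_on_bilinear[OF B \<open>open U\<close>] simp only: smooth_on_def)
  have zero: "integral \<Omega> (pdx (\<lambda>z. B (W z) (pdy Z z))) = 0" "integral \<Omega> (pdy (\<lambda>z. B (W z) (pdx Z z))) = 0"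
    using integral_directional_derivative_eq_0[OF assms(2-4) Ck(1), of 1]
      integral_directional_derivative_eq_0[OF assms(2-4) Ck(2), of \<i>] W0
    by (simp_all add: pdx_def[abs_def] pdy_def[abs_def] bounded_bilinear.zero_left[OF B])
  have "continuous_on U (pdx (\<lambda>z. B (W z) (pdy Z z)))" "continuous_on U (pdy (\<lambda>z. B (W z) (pdx Z z)))"
    using Ck by simp_all
  then have int: "pdx (\<lambda>z. B (W z) (pdy Z z)) integrable_on \<Omega>" "pdy (\<lambda>z. B (W z) (pdx Z z)) integrable_on \<Omega>"
    using assms(2,4) continuous_on_compact_integrable continuous_on_subset by blast+
  have "integral \<Omega> (\<lambda>z. B (pdx W z) (pdy Z z) - B (pdy W z) (pdx Z z))
      = integral \<Omega> (\<lambda>z. pdx (\<lambda>z. B (W z) (pdy Z z)) z - pdy (\<lambda>z. B (W z) (pdx Z z)) z)"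
  proof (rule integral_cong)
    fix z assume "z \<in> \<Omega>"
    then have z: "z \<in> U"
      using assms(4) by blast
    have "pdx (pdy Z) z = pdy (pdx Z) z"
      using pdx_pdy_commute[OF \<open>open U\<close> z, of Z] assms(6) unfolding smooth_on_def by blast
    then show "B (pdx W z) (pdy Z z) - B (pdy W z) (pdx Z z)
        = pdx (\<lambda>z. B (W z) (pdy Z z)) z - pdy (\<lambda>z. B (W z) (pdx Z z)) z"
      using pd_bilinear(2)[OF B W(2)[OF z] Zy(2)[OF z]] pd_bilinear(3)[OF B W(2)[OF z] Zx(2)[OF z]]
      by simp
  qed
  also have "\<dots> = 0"
    using zero int by (simp add: integral_diff)
  finally show ?thesis .
qed

section \<open>Quadratic paths in an inner product space and the area element\<close>

text \<open>\<open>f'\<close> is known to be differentiable only at 0, so L'Hopital is applied once,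
  which leaves the symmetric difference quotient of \<open>f'\<close> at 0. This recovers the second
  derivative of the area from values of the area alone.\<close>

lemma second_difference_tendsto:
  fixes f f' :: "real \<Rightarrow> real"
  assumes f: "\<forall>\<^sub>F t in nhds 0. (f has_real_derivative f' t) (at t)"
    and f': "(f' has_real_derivative d) (at 0)"
  shows "((\<lambda>t. (f t + f (- t) - 2 * f 0) / t\<^sup>2) \<longlongrightarrow> d) (at_right 0)"
proof -
  obtain \<epsilon> where \<epsilon>: "\<epsilon> > 0" "\<And>t. \<bar>t\<bar> < \<epsilon> \<Longrightarrow> (f has_real_derivative f' t) (at t)"
    using f unfolding eventually_nhds_metric by (auto simp: dist_real_def)
  have D: "((\<lambda>t. f t + f (- t) - 2 * f 0) has_real_derivative f' t - f' (- t)) (at t)" if "\<bar>t\<bar> < \<epsilon>" for t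
  proof -
    have "(f has_real_derivative f' t) (at t)" "(f has_real_derivative f' (- t)) (at (- t))"
      using \<epsilon>(2) that by auto
    then show ?thesis
      using DERIV_mirror[of f "f' (- t)" t] by (auto intro!: derivative_eq_intros)
  qed
  have ev: "\<forall>\<^sub>F t in at_right 0. t < \<epsilon> \<and> (0::real) < t"
    using \<epsilon>(1) by (auto simp: eventually_at_right[of 0 \<epsilon>])
  show ?thesis
  proof (rule lhopital_right_0[where f' = "\<lambda>t. f' t - f' (- t)" and g' = "\<lambda>t. 2 * t"])
    have "isCont (\<lambda>t. f t + f (- t) - 2 * f 0) 0"
      using D[of 0] \<epsilon>(1) DERIV_isCont by auto
    then show "((\<lambda>t. f t + f (- t) - 2 * f 0) \<longlongrightarrow> 0) (at_right 0)"
      unfolding isCont_def using filterlim_at_split by force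
    show "((\<lambda>t. t\<^sup>2 :: real) \<longlongrightarrow> 0) (at_right 0)"
      by real_asymp
    show "\<forall>\<^sub>F t::real in at_right 0. t\<^sup>2 \<noteq> 0" "\<forall>\<^sub>F t::real in at_right 0. 2 * t \<noteq> 0"
      by (rule eventually_mono[OF ev]; simp)+
    show "\<forall>\<^sub>F t in at_right 0. ((\<lambda>t. f t + f (- t) - 2 * f 0) has_real_derivative f' t - f' (- t)) (at t)"
      using ev by eventually_elim (use D in auto)
    show "\<forall>\<^sub>F t::real in at_right 0. (power2 has_real_derivative 2 * t) (at t)"
      by (rule always_eventually) (auto intro!: derivative_eq_intros)
    have "((\<lambda>t. (f' t - f' (- t)) ) has_real_derivative d + d) (at 0)"
      using f' DERIV_mirror[of f' d 0] by (auto intro!: derivative_eq_intros)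
    then have "((\<lambda>t. (f' t - f' (- t)) / t) \<longlongrightarrow> d + d) (at 0)"
      unfolding has_field_derivative_iff by simp
    then have "((\<lambda>t. (f' t - f' (- t)) / t / 2) \<longlongrightarrow> (d + d) / 2) (at_right 0)"
      by (intro tendsto_divide tendsto_const) (auto simp: filterlim_at_split)
    then show "((\<lambda>t. (f' t - f' (- t)) / (2 * t)) \<longlongrightarrow> d) (at_right 0)"
      by (simp add: field_simps)
  qed
qed

text \<open>Pointwise model of a variation: for fixed z the 2-vector (F + tW)_x wedge (F + tW)_y is
  quadratic in t, and the area element is its norm.\<close>

locale quadratic_path =
  fixes v0 v1 v2 :: "'a::real_inner"
begin

definition V :: "real \<Rightarrow> 'a" where "V t = v0 + t *\<^sub>R v1 + t\<^sup>2 *\<^sub>R v2"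

definition V' :: "real \<Rightarrow> 'a" where "V' t = v1 + (2 * t) *\<^sub>R v2"

text \<open>This is the t-derivative of \<open>norm (V t)\<close> where
  \<open>V t \<noteq> 0\<close>; at zeros of \<open>V t\<close> division by zero gives the value
  0.\<close>

definition speed :: "real \<Rightarrow> real" where "speed t = V t \<bullet> V' t / norm (V t)"

lemma V_deriv: "(V has_vector_derivative V' t) (at t)"
  unfolding V_def[abs_def] V'_def
  by (auto intro!: derivative_eq_intros simp: has_vector_derivative_def scaleR_add_right mult.commute)

lemma V'_deriv: "(V' has_vector_derivative 2 *\<^sub>R v2) (at t)"
  unfolding V'_def[abs_def]
  by (auto intro!: derivative_eq_intros simp: has_vector_derivative_def mult.commute)

lemma inner_deriv:
  assumes "(f has_vector_derivative f') (at t)" "(g has_vector_derivative g') (at t)"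
  shows "((\<lambda>t. f t \<bullet> g t) has_real_derivative f t \<bullet> g' + f' \<bullet> g t) (at t)"
  using bounded_bilinear.has_vector_derivative[OF bounded_bilinear_inner assms]
  by (simp add: has_real_derivative_iff_has_vector_derivative)

lemma norm_V_deriv:
  assumes "V t \<noteq> 0"
  shows "((\<lambda>t. norm (V t)) has_real_derivative speed t) (at t)"
proof -
  have "V t \<bullet> V t > 0"
    using assms by simp
  then have "((\<lambda>t. norm (V t)) has_real_derivative
      (inverse (norm (V t)) / 2) * (V t \<bullet> V' t + V' t \<bullet> V t)) (at t)"
    using DERIV_chain2[OF DERIV_real_sqrt inner_deriv[OF V_deriv V_deriv]]
    unfolding norm_eq_sqrt_inner by blast
  moreover have "(inverse (norm (V t)) / 2) * (V t \<bullet> V' t + V' t \<bullet> V t) = speed t"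
    unfolding speed_def inner_commute[of "V' t" "V t"] by (simp add: field_simps)
  ultimately show ?thesis
    by (simp only:)
qed

lemma speed_deriv:
  assumes "v0 \<noteq> 0"
  shows "(speed has_real_derivative
    ((v1 \<bullet> v1 + 2 * (v0 \<bullet> v2)) / norm v0 - (v0 \<bullet> v1)\<^sup>2 / norm v0 ^ 3)) (at 0)"
proof -
  have 0: "V 0 = v0" "V' 0 = v1"
    by (simp_all add: V_def V'_def)
  have n: "((\<lambda>t. norm (V t)) has_real_derivative speed 0) (at 0)"
    using norm_V_deriv 0 assms by simp
  have "(speed has_real_derivative
     ((V 0 \<bullet> 2 *\<^sub>R v2 + V' 0 \<bullet> V' 0) * norm (V 0) - (V 0 \<bullet> V' 0) * speed 0) / (norm (V 0) * norm (V 0))) (at 0)"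
    unfolding speed_def[abs_def]
    by (intro DERIV_divide inner_deriv V_deriv V'_deriv n[unfolded speed_def]) (simp add: 0 assms)
  moreover have "((v0 \<bullet> 2 *\<^sub>R v2 + v1 \<bullet> v1) * norm v0 - (v0 \<bullet> v1) * ((v0 \<bullet> v1) / norm v0)) / (norm v0 * norm v0)
      = (v1 \<bullet> v1 + 2 * (v0 \<bullet> v2)) / norm v0 - (v0 \<bullet> v1)\<^sup>2 / norm v0 ^ 3"
    using assms by (simp add: diff_divide_distrib add_divide_distrib power2_eq_square power3_eq_cube algebra_simps)
  ultimately show ?thesis
    by (simp only: 0 speed_def)
qed

lemma norm_V_lipschitz:
  assumes "norm v1 \<le> M" "norm v2 \<le> M" "\<bar>s\<bar> \<le> 1" "\<bar>t\<bar> \<le> 1"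
  shows "\<bar>norm (V t) - norm (V s)\<bar> \<le> 3 * M * \<bar>t - s\<bar>"
proof -
  have "V t - V s = (t - s) *\<^sub>R (v1 + (t + s) *\<^sub>R v2)"
    by (simp add: V_def power2_eq_square algebra_simps)
  then have 1: "\<bar>norm (V t) - norm (V s)\<bar> \<le> norm (v1 + (t + s) *\<^sub>R v2) * \<bar>t - s\<bar>"
    using norm_triangle_ineq3[of "V t" "V s"] by (simp add: mult.commute)
  have "norm (v1 + (t + s) *\<^sub>R v2) \<le> norm v1 + \<bar>t + s\<bar> * norm v2"
    by (metis norm_scaleR norm_triangle_ineq)
  also have "\<dots> \<le> M + 2 * M"
    using assms by (intro add_mono mult_mono) auto
  finally have "norm (v1 + (t + s) *\<^sub>R v2) \<le> 3 * M"
    by simp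
  then show ?thesis
    using 1 mult_right_mono[OF _ abs_ge_zero] order_trans by blast
qed

text \<open>The hypothesis $|v_1|^2 \le M^2 |v_0|$ is what makes the next two bounds uniform near the
  zeros of $v_0$.\<close>

lemma norm_V_second_difference:
  assumes "(norm v1)\<^sup>2 \<le> M\<^sup>2 * norm v0" "norm v2 \<le> M"
  shows "\<bar>norm (V t) + norm (V (- t)) - 2 * norm v0\<bar> \<le> (M\<^sup>2 + 2 * M) * t\<^sup>2"
proof -
  let ?p = "norm (v0 + t *\<^sub>R v1)" and ?m = "norm (v0 - t *\<^sub>R v1)"
  have "M \<ge> 0"
    using assms(2) norm_ge_zero order_trans by blast
  \<comment> \<open>The parallelogram law removes the terms of first order in t. The claim then
    follows by completing the square, once the hypothesis has turned the square of
    \<open>norm v1\<close> into a multiple of \<open>norm v0\<close>.\<close>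
  have "?p\<^sup>2 + ?m\<^sup>2 = 2 * (norm v0)\<^sup>2 + 2 * (t\<^sup>2 * (norm v1)\<^sup>2)"
    unfolding power2_norm_eq_inner
    by (simp add: inner_add_left inner_add_right inner_diff_left inner_diff_right
        algebra_simps power2_eq_square inner_commute)
  moreover have "(?p + ?m)\<^sup>2 \<le> 2 * (?p\<^sup>2 + ?m\<^sup>2)"
    using zero_le_power2[of "?p - ?m"] by (simp add: power2_eq_square algebra_simps)
  moreover have "t\<^sup>2 * (norm v1)\<^sup>2 \<le> t\<^sup>2 * (M\<^sup>2 * norm v0)"
    using assms(1) by (intro mult_left_mono) auto
  moreover have "X \<le> 4 * a + 4 * c" if "Y = 2 * a + 2 * b" "X \<le> 2 * Y" "b \<le> c" for X Y a b c :: real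
    using that by linarith
  ultimately have "(?p + ?m)\<^sup>2 \<le> 4 * (norm v0)\<^sup>2 + 4 * (t\<^sup>2 * (M\<^sup>2 * norm v0))"
    by blast
  also have "\<dots> \<le> (2 * norm v0 + t\<^sup>2 * M\<^sup>2)\<^sup>2"
    using zero_le_power2[of "t\<^sup>2 * M\<^sup>2"] by (simp add: power2_eq_square algebra_simps)
  finally have "?p + ?m \<le> 2 * norm v0 + t\<^sup>2 * M\<^sup>2"
    by (rule power2_le_imp_le) simp
  moreover have "t\<^sup>2 * norm v2 \<le> t\<^sup>2 * M"
    using assms(2) by (intro mult_left_mono) auto
  moreover have "norm (V t) \<le> ?p + t\<^sup>2 * norm v2" "norm (V (- t)) \<le> ?m + t\<^sup>2 * norm v2"
    using norm_triangle_ineq[of "v0 + t *\<^sub>R v1" "t\<^sup>2 *\<^sub>R v2"]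
      norm_triangle_ineq[of "v0 - t *\<^sub>R v1" "t\<^sup>2 *\<^sub>R v2"] by (simp_all add: V_def)
  moreover have "2 * norm v0 - 2 * (t\<^sup>2 * norm v2) \<le> norm (V t) + norm (V (- t))"
  proof -
    have "V t + V (- t) = 2 *\<^sub>R v0 - (- ((2 * t\<^sup>2) *\<^sub>R v2))"
      by (simp add: V_def scaleR_2 algebra_simps flip: scaleR_add_left mult_2)
    then have "norm (2 *\<^sub>R v0) - norm ((2 * t\<^sup>2) *\<^sub>R v2) \<le> norm (V t + V (- t))"
      by (metis norm_minus_cancel norm_triangle_ineq2)
    then show ?thesis
      using norm_triangle_ineq[of "V t" "V (- t)"] by simp
  qed
  moreover have "(M\<^sup>2 + 2 * M) * t\<^sup>2 = t\<^sup>2 * M\<^sup>2 + 2 * (t\<^sup>2 * M)" "0 \<le> t\<^sup>2 * M\<^sup>2"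
    by (simp_all add: algebra_simps)
  ultimately show ?thesis
    unfolding abs_le_iff by linarith
qed

lemma norm_sgn_diff:
  fixes v w :: 'a
  assumes "v \<noteq> 0"
  shows "norm (sgn w - sgn v) \<le> 2 * norm (w - v) / norm v"
proof (cases "w = 0")
  case True
  then show ?thesis
    using assms by (simp add: norm_sgn)
next
  case False
  have "sgn w - sgn v = (w - v) /\<^sub>R norm v + ((norm v - norm w) / norm v) *\<^sub>R sgn w"
    using assms False by (simp add: sgn_div_norm algebra_simps diff_divide_distrib divide_inverse)
  then have "norm (sgn w - sgn v) \<le> norm (w - v) / norm v + \<bar>norm v - norm w\<bar> / norm v"
    using norm_triangle_ineq[of "(w - v) /\<^sub>R norm v" "((norm v - norm w) / norm v) *\<^sub>R sgn w"] False
    by (simp add: norm_sgn abs_divide divide_inverse_commute [of "norm (w - v)"])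
  also have "\<bar>norm v - norm w\<bar> / norm v \<le> norm (w - v) / norm v"
    by (metis divide_right_mono norm_ge_zero norm_minus_commute norm_triangle_ineq3)
  finally show ?thesis by simp
qed

lemma speed_lipschitz_at_0:
  assumes "norm v1 \<le> M * sqrt (norm v0)" "norm v2 \<le> M" "v0 \<noteq> 0"
  shows "\<bar>speed t - speed 0\<bar> \<le> (4 * M\<^sup>2 + 4 * M) * \<bar>t\<bar>"
proof -
  define a where "a = sqrt (norm v0)"
  have a: "a > 0" "norm v0 = a * a"
    using assms(3) by (simp_all add: a_def)
  have "M \<ge> 0"
    using assms(2) norm_ge_zero order_trans by blast
  have speed_eq: "speed s = sgn (V s) \<bullet> V' s" for s
    by (simp add: speed_def sgn_div_norm divide_inverse)
  have v1: "norm v1 \<le> M * a"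
    using assms(1) by (simp add: a_def)
  have sgn_le: "\<bar>sgn w \<bullet> u\<bar> \<le> norm u" for w u :: 'a
    using Cauchy_Schwarz_ineq2[of "sgn w" u] by (simp add: norm_sgn split: if_splits)
  have tv2: "norm ((2 * t) *\<^sub>R v2) \<le> 2 * \<bar>t\<bar> * M"
    using assms(2) by (simp add: abs_mult mult_left_mono)
  show ?thesis
  \<comment> \<open>Two regimes, with a^2 = |v0|. For small t the direction of \<open>V t\<close>
    turns by at most 4 M |t| / a, and the factor a in |v1| <= M a compensates the denominator. For
    |t| > a the bound becomes |v1| <= M |t|, so both speeds are themselves of order |t|.\<close>
  proof (cases "\<bar>t\<bar> \<le> a")
    case True
    have "norm (V t - v0) \<le> norm (t *\<^sub>R v1) + norm (t\<^sup>2 *\<^sub>R v2)"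
      using norm_triangle_ineq[of "t *\<^sub>R v1" "t\<^sup>2 *\<^sub>R v2"] by (simp add: V_def add.assoc)
    also have "\<dots> \<le> \<bar>t\<bar> * (M * a) + \<bar>t\<bar> * (a * M)"
    proof (rule add_mono)
      show "norm (t *\<^sub>R v1) \<le> \<bar>t\<bar> * (M * a)"
        using v1 by (simp add: mult_left_mono)
      have "t\<^sup>2 * norm v2 = \<bar>t\<bar> * (\<bar>t\<bar> * norm v2)"
        by (simp add: power2_eq_square)
      also have "\<dots> \<le> \<bar>t\<bar> * (a * M)"
        using True assms(2) a by (intro mult_left_mono mult_mono) auto
      finally show "norm (t\<^sup>2 *\<^sub>R v2) \<le> \<bar>t\<bar> * (a * M)" by simp
    qed
    finally have "norm (V t - v0) \<le> 2 * \<bar>t\<bar> * M * a"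
      by (simp add: mult_ac)
    then have "2 * norm (V t - v0) / norm v0 \<le> 4 * \<bar>t\<bar> * M / a"
      using a by (simp add: field_simps)
    with norm_sgn_diff[OF assms(3), of "V t"] have sd: "norm (sgn (V t) - sgn v0) \<le> 4 * \<bar>t\<bar> * M / a"
      by linarith
    have "\<bar>(sgn (V t) - sgn v0) \<bullet> v1\<bar> \<le> norm (sgn (V t) - sgn v0) * norm v1"
      by (rule Cauchy_Schwarz_ineq2)
    also have "\<dots> \<le> 4 * \<bar>t\<bar> * M / a * (M * a)"
      using sd v1 a \<open>M \<ge> 0\<close> by (intro mult_mono) auto
    also have "\<dots> = 4 * M\<^sup>2 * \<bar>t\<bar>"
      using a by (simp add: power2_eq_square)
    finally have 1: "\<bar>(sgn (V t) - sgn v0) \<bullet> v1\<bar> \<le> 4 * M\<^sup>2 * \<bar>t\<bar>" .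
    have "speed t - speed 0 = (sgn (V t) - sgn v0) \<bullet> v1 + sgn (V t) \<bullet> ((2 * t) *\<^sub>R v2)"
      unfolding speed_eq by (simp add: V'_def V_def inner_diff_left inner_add_right)
    then have "\<bar>speed t - speed 0\<bar> \<le> 4 * M\<^sup>2 * \<bar>t\<bar> + 2 * \<bar>t\<bar> * M"
      using 1 sgn_le[of "V t" "(2 * t) *\<^sub>R v2"] tv2 by linarith
    moreover have "0 \<le> M * \<bar>t\<bar>"
      using \<open>M \<ge> 0\<close> by simp
    ultimately show ?thesis
      by (simp add: algebra_simps)
  next
    case False
    have "norm v1 \<le> M * \<bar>t\<bar>"
      using v1 False \<open>M \<ge> 0\<close> mult_left_mono[of a "\<bar>t\<bar>" M] by linarith
    moreover have "\<bar>speed t\<bar> \<le> norm v1 + norm ((2 * t) *\<^sub>R v2)"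
      using sgn_le[of "V t" "V' t"] norm_triangle_ineq[of v1 "(2 * t) *\<^sub>R v2"]
      by (simp add: speed_eq V'_def)
    moreover have "\<bar>speed 0\<bar> \<le> norm v1"
      using sgn_le[of v0 v1] by (simp add: speed_eq V'_def V_def)
    ultimately have "\<bar>speed t - speed 0\<bar> \<le> 4 * M * \<bar>t\<bar>"
      using tv2 by (simp only: norm_scaleR mult.assoc mult.commute[of M])
    moreover have "0 \<le> 4 * M\<^sup>2 * \<bar>t\<bar>"
      by simp
    ultimately show ?thesis
      unfolding distrib_right by linarith
  qed
qed

end

text \<open>The exterior product as an antisymmetric matrix. Each pair of indices occurs twice in
  the matrix inner product, and the factor 1 / sqrt 2 compensates this, so that norms are areas of
  parallelograms.\<close>

definition wedge :: "real ^ 'n \<Rightarrow> real ^ 'n \<Rightarrow> real ^ 'n ^ 'n" where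
  "wedge X Y = (\<chi> i j. (X $ i * Y $ j - X $ j * Y $ i) / sqrt 2)"

lemma bounded_bilinear_wedge: "bounded_bilinear (wedge :: real ^ 'n \<Rightarrow> _)"
  unfolding bilinear_conv_bounded_bilinear [symmetric] bilinear_def
  by (auto intro!: linearI simp: wedge_def vec_eq_iff algebra_simps diff_divide_distrib add_divide_distrib)

text \<open>The Binet-Cauchy identity.\<close>

lemma inner_wedge:
  fixes X Y X' Y' :: "real ^ 'n"
  shows "wedge X Y \<bullet> wedge X' Y' = (X \<bullet> X') * (Y \<bullet> Y') - (X \<bullet> Y') * (Y \<bullet> X')"
proof -
  have entry: "(x * y' - x' * y) / sqrt 2 * ((u * v' - u' * v) / sqrt 2)
      = ((x * u) * (y' * v') + (y * v) * (x' * u') - (x * v) * (y' * u') - (y * u) * (x' * v')) / 2"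
    for x y x' y' u v u' v' :: real
    unfolding times_divide_times_eq by (simp add: algebra_simps)
  have prod: "(\<Sum>i\<in>UNIV. \<Sum>j\<in>UNIV. (a $ i * b $ i) * (c $ j * d $ j)) = (a \<bullet> b) * (c \<bullet> d)"
    for a b c d :: "real ^ 'n"
    by (simp add: inner_vec_def sum_product)
  have "wedge X Y \<bullet> wedge X' Y'
      = (\<Sum>i\<in>UNIV. \<Sum>j\<in>UNIV. (X $ i * Y $ j - X $ j * Y $ i) / sqrt 2 * ((X' $ i * Y' $ j - X' $ j * Y' $ i) / sqrt 2))"
    by (simp only: wedge_def inner_vec_def vec_lambda_beta inner_real_def)
  also have "\<dots> = ((X \<bullet> X') * (Y \<bullet> Y') + (Y \<bullet> Y') * (X \<bullet> X') - (X \<bullet> Y') * (Y \<bullet> X') - (Y \<bullet> X') * (X \<bullet> Y')) / 2"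
    unfolding entry sum_divide_distrib [symmetric] sum_subtractf sum.distrib prod ..
  finally show ?thesis
    by simp
qed

text \<open>The right-hand side is the integrand of \<open>area_on\<close>, so the area becomes an
  integral of norms of quadratic paths.\<close>

lemma norm_wedge: "norm (wedge X Y) = sqrt ((X \<bullet> X) * (Y \<bullet> Y) - (X \<bullet> Y) * (X \<bullet> Y))"
  by (simp add: norm_eq_sqrt_inner inner_wedge inner_commute)

lemma norm_wedge_le: "norm (wedge X Y) \<le> norm X * norm Y"
proof -
  have "norm (wedge X Y) \<le> sqrt ((norm X * norm Y)\<^sup>2)"
    unfolding norm_wedge by (intro real_sqrt_le_mono) (simp add: power_mult_distrib power2_norm_eq_inner)
  then show ?thesis by simp
qed

lemma wedge_add_scaleR:
  "wedge (X + t *\<^sub>R X') (Y + t *\<^sub>R Y')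
    = wedge X Y + t *\<^sub>R (wedge X Y' + wedge X' Y) + t\<^sup>2 *\<^sub>R wedge X' Y'"
  by (simp add: wedge_def vec_eq_iff field_simps power2_eq_square)

lemma pd_add_scaleR:
  assumes "F differentiable (at z)" "W differentiable (at z)"
  shows "pdx (\<lambda>z. F z + s *\<^sub>R W z) z = pdx F z + s *\<^sub>R pdx W z"
    and "pdy (\<lambda>z. F z + s *\<^sub>R W z) z = pdy F z + s *\<^sub>R pdy W z"
proof -
  note * = pd_bounded_linear[OF bounded_linear_scaleR_right[of s] assms(2)]
  show "pdx (\<lambda>z. F z + s *\<^sub>R W z) z = pdx F z + s *\<^sub>R pdx W z"
    "pdy (\<lambda>z. F z + s *\<^sub>R W z) z = pdy F z + s *\<^sub>R pdy W z"
    using pd_add[OF assms(1) *(1)] *(2,3) by simp_all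
qed

section \<open>First and second variation of area\<close>

locale area_variation =
  fixes F W :: "complex \<Rightarrow> real ^ 'n" and \<Omega> U :: "complex set"
  assumes F: "smooth_on UNIV F"
    and conformal: "\<And>z. pdx F z \<bullet> pdy F z = 0" "\<And>z. norm (pdx F z) = norm (pdy F z)"
    and \<Omega>: "compact \<Omega>" and U: "open U" "\<Omega> \<subseteq> U" and W: "smooth_on U W"
begin

definition v0 :: "complex \<Rightarrow> real ^ 'n ^ 'n" where "v0 z = wedge (pdx F z) (pdy F z)"
definition v1 :: "complex \<Rightarrow> real ^ 'n ^ 'n" where
  "v1 z = wedge (pdx F z) (pdy W z) + wedge (pdx W z) (pdy F z)"
definition v2 :: "complex \<Rightarrow> real ^ 'n ^ 'n" where "v2 z = wedge (pdx W z) (pdy W z)"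

abbreviation V :: "real \<Rightarrow> complex \<Rightarrow> real ^ 'n ^ 'n" where
  "V t z \<equiv> quadratic_path.V (v0 z) (v1 z) (v2 z) t"
abbreviation speed :: "real \<Rightarrow> complex \<Rightarrow> real" where
  "speed t z \<equiv> quadratic_path.speed (v0 z) (v1 z) (v2 z) t"

lemmas V_def = quadratic_path.V_def

lemma V_eq: "V t z = wedge (pdx F z + t *\<^sub>R pdx W z) (pdy F z + t *\<^sub>R pdy W z)"
  by (simp add: V_def v0_def v1_def v2_def wedge_add_scaleR)

lemma area_eq: "area_on \<Omega> (\<lambda>z. F z + t *\<^sub>R W z) = integral \<Omega> (\<lambda>z. norm (V t z))"
  unfolding area_on_def
proof (rule integral_cong)
  fix z assume "z \<in> \<Omega>"
  then have "F differentiable (at z)" "W differentiable (at z)"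
    using smooth_onD(2)[OF F] smooth_onD(2)[OF W] U by auto
  from pd_add_scaleR[OF this, of t]
  show "sqrt ((pdx (\<lambda>z. F z + t *\<^sub>R W z) z \<bullet> pdx (\<lambda>z. F z + t *\<^sub>R W z) z)
      * (pdy (\<lambda>z. F z + t *\<^sub>R W z) z \<bullet> pdy (\<lambda>z. F z + t *\<^sub>R W z) z)
      - (pdx (\<lambda>z. F z + t *\<^sub>R W z) z \<bullet> pdy (\<lambda>z. F z + t *\<^sub>R W z) z)
      * (pdx (\<lambda>z. F z + t *\<^sub>R W z) z \<bullet> pdy (\<lambda>z. F z + t *\<^sub>R W z) z)) = norm (V t z)"
    by (simp only: V_eq norm_wedge)
qed

lemma continuous_pd:
  "continuous_on \<Omega> (pdx F)" "continuous_on \<Omega> (pdy F)" "continuous_on \<Omega> (pdx W)" "continuous_on \<Omega> (pdy W)"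
  using smooth_onD(1)[OF smooth_onD(3)[OF F]] smooth_onD(1)[OF smooth_onD(4)[OF F]]
    smooth_onD(1)[OF smooth_onD(3)[OF W]] smooth_onD(1)[OF smooth_onD(4)[OF W]] U
  by (auto intro: continuous_on_subset)

lemma norm_V_integrable: "(\<lambda>z. norm (V t z)) integrable_on \<Omega>"
  unfolding V_eq
  by (intro continuous_on_compact_integrable[OF \<Omega>] continuous_intros continuous_pd
      bounded_bilinear.continuous_on[OF bounded_bilinear_wedge])

lemma norm_v0: "norm (v0 z) = (norm (pdx F z))\<^sup>2"
proof -
  have "pdx F z \<bullet> pdx F z = (norm (pdx F z))\<^sup>2" "pdy F z \<bullet> pdy F z = (norm (pdx F z))\<^sup>2"
    by (simp_all only: dot_square_norm conformal(2))
  then show ?thesis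
    by (simp only: v0_def norm_wedge conformal(1) mult_zero_left diff_0_right real_sqrt_abs2 abs_power2)
qed

lemma v0_eq_0_iff: "v0 z = 0 \<longleftrightarrow> pdx F z = 0"
proof -
  have "v0 z = 0 \<longleftrightarrow> norm (v0 z) = 0"
    by simp
  also have "\<dots> \<longleftrightarrow> (norm (pdx F z))\<^sup>2 = 0"
    unfolding norm_v0 ..
  also have "\<dots> \<longleftrightarrow> pdx F z = 0"
    by (simp only: power_eq_0_iff norm_eq_zero) simp
  finally show ?thesis .
qed

text \<open>Each summand of \<open>v1\<close> contains one factor \<open>pdx F\<close> or
  \<open>pdy F\<close>, and by conformality both have norm \<open>sqrt (norm (v0 z))\<close>. The
  other factors are bounded on the compact \<open>\<Omega>\<close>.\<close>

lemma bounds: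
  obtains M where "\<And>z. z \<in> \<Omega> \<Longrightarrow> norm (v1 z) \<le> M * sqrt (norm (v0 z))"
    "\<And>z. z \<in> \<Omega> \<Longrightarrow> norm (v1 z) \<le> M" "\<And>z. z \<in> \<Omega> \<Longrightarrow> norm (v2 z) \<le> M"
proof -
  have bdd: "\<exists>c. \<forall>z\<in>\<Omega>. norm (f z) \<le> c" if "continuous_on \<Omega> f" for f :: "complex \<Rightarrow> real ^ 'n"
    using compact_imp_bounded[OF compact_continuous_image[OF that \<Omega>]] by (auto simp: bounded_iff)
  obtain c1 where c1: "\<forall>z\<in>\<Omega>. norm (pdx F z) \<le> c1"
    using bdd[OF continuous_pd(1)] by blast
  obtain c2 where c2: "\<forall>z\<in>\<Omega>. norm (pdx W z) \<le> c2"
    using bdd[OF continuous_pd(3)] by blast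
  obtain c3 where c3: "\<forall>z\<in>\<Omega>. norm (pdy W z) \<le> c3"
    using bdd[OF continuous_pd(4)] by blast
  define C where "C = max 0 (max c1 (max c2 c3))"
  have C: "C \<ge> 0" "norm (pdx F z) \<le> C" "norm (pdx W z) \<le> C" "norm (pdy W z) \<le> C" if "z \<in> \<Omega>" for z
    using c1 c2 c3 that by (auto simp: C_def le_max_iff_disj)
  have le: "norm (v1 z) \<le> 2 * C * norm (pdx F z)" "norm (v2 z) \<le> C * C" if "z \<in> \<Omega>" for z
  proof -
    have "norm (v1 z) \<le> norm (pdx F z) * norm (pdy W z) + norm (pdx W z) * norm (pdx F z)"
      using norm_triangle_ineq[of "wedge (pdx F z) (pdy W z)" "wedge (pdx W z) (pdy F z)"]
        norm_wedge_le[of "pdx F z" "pdy W z"] norm_wedge_le[of "pdx W z" "pdy F z"] conformal(2)[of z]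
      by (simp add: v1_def)
    also have "\<dots> \<le> norm (pdx F z) * C + C * norm (pdx F z)"
      using C[OF that] by (intro add_mono mult_mono) auto
    finally show "norm (v1 z) \<le> 2 * C * norm (pdx F z)"
      by (simp add: mult_ac)
    show "norm (v2 z) \<le> C * C"
      using norm_wedge_le[of "pdx W z" "pdy W z"] C[OF that] mult_mono[of "norm (pdx W z)" C "norm (pdy W z)" C]
      by (simp add: v2_def)
  qed
  have "2 * C * norm (pdx F z) \<le> (2 * C + 2 * C * C) * norm (pdx F z)"
    "2 * C * norm (pdx F z) \<le> 2 * C + 2 * C * C" "C * C \<le> 2 * C + 2 * C * C" if "z \<in> \<Omega>" for z
    using C[OF that] mult_left_mono[of "norm (pdx F z)" C "2 * C"]
    by (auto simp: mult_right_mono algebra_simps)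
  moreover have "sqrt (norm (v0 z)) = norm (pdx F z)" for z
    by (simp add: norm_v0)
  ultimately show thesis
    using le by (intro that[of "2 * C + 2 * C * C"]) (metis order_trans)+
qed

text \<open>Differentiation under the integral sign is used twice: for the norm at every small t,
  where the null set is the degenerate set at that t, and for the speed at t = 0, where
  \<open>speed_lipschitz_at_0\<close> dominates uniformly up to the branch points.\<close>

lemma area_twice_differentiable:
  assumes "\<epsilon> > 0" and neg: "\<And>t. \<bar>t\<bar> < \<epsilon> \<Longrightarrow> negligible {z \<in> \<Omega>. V t z = 0}"
  shows "\<exists>a' d. (\<forall>\<^sub>F t in nhds 0.
      ((\<lambda>t. area_on \<Omega> (\<lambda>z. F z + t *\<^sub>R W z)) has_real_derivative a' t) (at t)) \<and>
    (a' has_real_derivative d) (at 0)"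
proof -
  obtain M where M: "\<And>z. z \<in> \<Omega> \<Longrightarrow> norm (v1 z) \<le> M * sqrt (norm (v0 z))"
    "\<And>z. z \<in> \<Omega> \<Longrightarrow> norm (v1 z) \<le> M" "\<And>z. z \<in> \<Omega> \<Longrightarrow> norm (v2 z) \<le> M"
    using bounds by metis
  define \<delta> where "\<delta> = min \<epsilon> 1"
  have \<delta>: "\<delta> > 0" "\<delta> \<le> \<epsilon>" "\<delta> \<le> 1"
    using assms(1) by (auto simp: \<delta>_def)
  have meas: "\<Omega> \<in> lmeasurable"
    using \<Omega> by (rule lmeasurable_compact)
  have first: "speed t integrable_on \<Omega>"
    "((\<lambda>t. integral \<Omega> (\<lambda>z. norm (V t z))) has_real_derivative integral \<Omega> (speed t)) (at t)"
    if "\<bar>t\<bar> < \<delta>" for t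
  proof -
    have d: "((\<lambda>t. norm (V t z)) has_real_derivative speed t z) (at t)"
      if "z \<in> \<Omega> - {z \<in> \<Omega>. V t z = 0}" for z
      using quadratic_path.norm_V_deriv that by blast
    have lip: "\<bar>norm (V s z) - norm (V t z)\<bar> \<le> 3 * M * \<bar>s - t\<bar>"
      if "\<bar>s - t\<bar> < \<delta> - \<bar>t\<bar>" "z \<in> \<Omega> - {z \<in> \<Omega>. V t z = 0}" for s z
      using that \<open>\<bar>t\<bar> < \<delta>\<close> \<delta> M by (intro quadratic_path.norm_V_lipschitz) auto
    have *: "negligible {z \<in> \<Omega>. V t z = 0}" "\<delta> - \<bar>t\<bar> > 0"
      using neg that \<delta> by auto
    show "speed t integrable_on \<Omega>"
      "((\<lambda>t. integral \<Omega> (\<lambda>z. norm (V t z))) has_real_derivative integral \<Omega> (speed t)) (at t)"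
      using has_real_derivative_integral[OF *(1) meas *(2), of t "\<lambda>t z. norm (V t z)", OF norm_V_integrable d lip]
      by blast+
  qed
  have V0: "V 0 z = v0 z" for z
    by (simp add: V_def)
  define D where "D z = (v1 z \<bullet> v1 z + 2 * (v0 z \<bullet> v2 z)) / norm (v0 z) - (v0 z \<bullet> v1 z)\<^sup>2 / norm (v0 z) ^ 3" for z
  have "((\<lambda>t. integral \<Omega> (speed t)) has_real_derivative integral \<Omega> D) (at 0)"
  proof (rule has_real_derivative_integral(2)[OF _ meas \<delta>(1)])
    show "negligible {z \<in> \<Omega>. V 0 z = 0}"
      using neg assms(1) by simp
    show "((\<lambda>t. speed t z) has_real_derivative D z) (at 0)" if "z \<in> \<Omega> - {z \<in> \<Omega>. V 0 z = 0}" for z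
      unfolding D_def using that by (intro quadratic_path.speed_deriv) (auto simp: V0)
    show "\<bar>speed t z - speed 0 z\<bar> \<le> (4 * M\<^sup>2 + 4 * M) * \<bar>t - 0\<bar>"
      if "z \<in> \<Omega> - {z \<in> \<Omega>. V 0 z = 0}" for t z
      using quadratic_path.speed_lipschitz_at_0[of "v1 z" M "v0 z" "v2 z" t] that M by (auto simp: V0)
    show "speed t integrable_on \<Omega>" if "\<bar>t - 0\<bar> < \<delta>" for t
      using first(1) that by simp
  qed
  moreover have "\<forall>\<^sub>F t in nhds 0. ((\<lambda>t. integral \<Omega> (\<lambda>z. norm (V t z))) has_real_derivative integral \<Omega> (speed t)) (at t)"
    unfolding eventually_nhds_metric dist_real_def using \<delta>(1) first(2) by auto
  ultimately show ?thesis
    unfolding area_eq by (intro exI conjI)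
qed

text \<open>The integrand of the overview in real form: the numerator is |phi . omega|^2, and
  |phi|^2 = 2 |F_x|^2 absorbs the factor 2.\<close>

definition second_variation :: "complex \<Rightarrow> real" where
  "second_variation z = pdx W z \<bullet> pdx W z + pdy W z \<bullet> pdy W z
     - ((pdx F z \<bullet> pdx W z - pdy F z \<bullet> pdy W z)\<^sup>2 + (pdx F z \<bullet> pdy W z + pdy F z \<bullet> pdx W z)\<^sup>2)
       / (norm (pdx F z))\<^sup>2"

lemma speed_deriv_at_0:
  assumes "pdx F z \<noteq> 0"
  shows "((\<lambda>t. speed t z) has_real_derivative second_variation z) (at 0)"
proof -
  define e where "e = (norm (pdx F z))\<^sup>2"
  have e: "e \<noteq> 0" "pdx F z \<bullet> pdx F z = e" "pdy F z \<bullet> pdy F z = e" "pdx F z \<bullet> pdy F z = 0"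
    "pdy F z \<bullet> pdx F z = 0" "norm (v0 z) = e"
  proof -
    show "e \<noteq> 0" "norm (v0 z) = e"
      using assms by (simp_all add: e_def norm_v0)
    show "pdx F z \<bullet> pdx F z = e" "pdy F z \<bullet> pdy F z = e"
      by (simp_all only: e_def dot_square_norm conformal(2))
    show "pdx F z \<bullet> pdy F z = 0" "pdy F z \<bullet> pdx F z = 0"
      using conformal(1)[of z] by (simp_all add: inner_commute)
  qed
  have "(v1 z \<bullet> v1 z + 2 * (v0 z \<bullet> v2 z)) / norm (v0 z) - (v0 z \<bullet> v1 z)\<^sup>2 / norm (v0 z) ^ 3
      = second_variation z"
    unfolding second_variation_def e(6) e_def[symmetric]
    unfolding v0_def v1_def v2_def inner_add_left inner_add_right inner_wedge
    using e
    by (simp add: inner_commute[of "pdx W z" "pdx F z"] inner_commute[of "pdy W z" "pdx F z"]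
        inner_commute[of "pdx W z" "pdy F z"] inner_commute[of "pdy W z" "pdy F z"]
        inner_commute[of "pdy W z" "pdx W z"] field_simps power2_eq_square power3_eq_cube)
  then show ?thesis
    using quadratic_path.speed_deriv[of "v0 z" "v1 z" "v2 z"] e by fastforce
qed

text \<open>Existence of the derivatives is assumed, so it suffices to follow the second differences
  of the area along \<open>t k\<close>. They are dominated by
  \<open>norm_V_second_difference\<close> and converge pointwise off the branch points.\<close>

lemma area_second_derivative:
  assumes neg: "negligible {z. pdx F z = 0}"
    and a: "\<forall>\<^sub>F t in nhds 0. ((\<lambda>t. area_on \<Omega> (\<lambda>z. F z + t *\<^sub>R W z)) has_real_derivative a' t) (at t)"
    and d: "(a' has_real_derivative d) (at 0)"
  shows "(second_variation has_integral d) \<Omega>"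
proof -
  obtain M where M: "\<And>z. z \<in> \<Omega> \<Longrightarrow> norm (v1 z) \<le> M * sqrt (norm (v0 z))"
    "\<And>z. z \<in> \<Omega> \<Longrightarrow> norm (v2 z) \<le> M"
    using bounds by metis
  define t where "t k = 1 / real (Suc k)" for k
  have t: "t k > 0" for k
    by (simp add: t_def)
  have t0: "filterlim t (at_right 0) sequentially"
    unfolding filterlim_at t_def[abs_def] using LIMSEQ_inverse_real_of_nat
    by (auto simp: inverse_eq_divide intro!: always_eventually)
  define f where "f k z = (norm (V (t k) z) + norm (V (- t k) z) - 2 * norm (V 0 z)) / (t k)\<^sup>2" for k z
  have int: "f k integrable_on \<Omega>" for k
    unfolding f_def by (intro integrable_on_divide integrable_diff integrable_add norm_V_integrable
        integrable_on_mult_right)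
  have bound: "\<bar>f k z\<bar> \<le> M\<^sup>2 + 2 * M" if "z \<in> \<Omega> - {z. pdx F z = 0}" for k z
  proof -
    have "(norm (v1 z))\<^sup>2 \<le> (M * sqrt (norm (v0 z)))\<^sup>2"
      using M(1) that by (intro power_mono) auto
    then have "(norm (v1 z))\<^sup>2 \<le> M\<^sup>2 * norm (v0 z)"
      by (simp add: power_mult_distrib)
    then have "\<bar>norm (V (t k) z) + norm (V (- t k) z) - 2 * norm (v0 z)\<bar> \<le> (M\<^sup>2 + 2 * M) * (t k)\<^sup>2"
      using M(2) that by (intro quadratic_path.norm_V_second_difference) auto
    then show ?thesis
      using t[of k] by (simp add: f_def V_def abs_divide divide_le_eq)
  qed
  have lim: "(\<lambda>k. f k z) \<longlonglongrightarrow> second_variation z" if "z \<in> \<Omega> - {z. pdx F z = 0}" for z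
  proof -
    have nz: "pdx F z \<noteq> 0"
      using that by simp
    have "isCont (\<lambda>t. V t z) 0"
      using quadratic_path.V_deriv has_vector_derivative_continuous by blast
    moreover have "V 0 z \<noteq> 0"
      using nz v0_eq_0_iff by (simp add: V_def)
    ultimately have "\<forall>\<^sub>F s in nhds 0. V s z \<noteq> 0"
      by (simp add: isCont_def tendsto_imp_eventually_ne eventually_nhds_conv_at)
    then have "\<forall>\<^sub>F s in nhds 0. ((\<lambda>t. norm (V t z)) has_real_derivative speed s z) (at s)"
      by eventually_elim (rule quadratic_path.norm_V_deriv)
    from second_difference_tendsto[OF this speed_deriv_at_0[OF nz]]
    show ?thesis
      unfolding f_def using t0 by (rule filterlim_compose)
  qed
  have "\<Omega> \<in> lmeasurable"
    using \<Omega> by (rule lmeasurable_compact)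
  note conv = dominated_convergence_ae[OF neg int integrable_on_const[OF this] bound lim]
  have "integral \<Omega> (f k) = (area_on \<Omega> (\<lambda>z. F z + t k *\<^sub>R W z) + area_on \<Omega> (\<lambda>z. F z + (- t k) *\<^sub>R W z)
      - 2 * area_on \<Omega> (\<lambda>z. F z + 0 *\<^sub>R W z)) / (t k)\<^sup>2" for k
    unfolding area_eq f_def
    by (simp add: integral_diff integral_add integrable_add norm_V_integrable integrable_on_mult_right
        del: scaleR_zero_left)
  then have "(\<lambda>k. integral \<Omega> (f k)) \<longlonglongrightarrow> d"
    using filterlim_compose[OF second_difference_tendsto[OF a d] t0] by simp
  with conv show ?thesis
    using LIMSEQ_unique by (metis has_integral_integral)
qed

end

section \<open>Calibrated immersions are stable\<close>

lemma smooth_on_const: "open S \<Longrightarrow> smooth_on S (\<lambda>_. c)"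
  by (simp add: smooth_on_def Ck_on_const)

lemma smooth_on_add: "open S \<Longrightarrow> smooth_on S f \<Longrightarrow> smooth_on S g \<Longrightarrow> smooth_on S (\<lambda>z. f z + g z)"
  by (simp add: smooth_on_def Ck_on_add)

lemma smooth_on_bilinear:
  "bounded_bilinear B \<Longrightarrow> open S \<Longrightarrow> smooth_on S f \<Longrightarrow> smooth_on S g \<Longrightarrow> smooth_on S (\<lambda>z. B (f z) (g z))"
  by (simp add: smooth_on_def Ck_on_bilinear)

lemma smooth_on_bounded_linear:
  "bounded_linear L \<Longrightarrow> open S \<Longrightarrow> smooth_on S f \<Longrightarrow> smooth_on S (\<lambda>z. L (f z))"
  by (simp add: smooth_on_def Ck_on_bounded_linear)

section \<open>Iterated x-derivatives, the Leibniz rule and zeros of finite order\<close>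

lemma smooth_on_pdx_funpow: "smooth_on S f \<Longrightarrow> smooth_on S ((pdx ^^ k) f)"
  by (induction k) (auto intro: smooth_onD(3))

lemma pdx_funpow_add:
  assumes "open S" "smooth_on S f" "smooth_on S g" "z \<in> S"
  shows "(pdx ^^ k) (\<lambda>z. f z + g z) z = (pdx ^^ k) f z + (pdx ^^ k) g z"
  using assms(4)
proof (induction k arbitrary: z)
  case (Suc k)
  have "pdx ((pdx ^^ k) (\<lambda>z. f z + g z)) z = pdx (\<lambda>z. (pdx ^^ k) f z + (pdx ^^ k) g z) z"
    using Suc by (intro pdx_cong[OF assms(1)]) auto
  also have "\<dots> = pdx ((pdx ^^ k) f) z + pdx ((pdx ^^ k) g) z"
    using pd_add(1)[OF smooth_onD(2)[OF smooth_on_pdx_funpow[OF assms(2)] Suc.prems]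
        smooth_onD(2)[OF smooth_on_pdx_funpow[OF assms(3)] Suc.prems]] .
  finally show ?case by simp
qed simp

lemma pdx_funpow_bounded_linear:
  assumes "bounded_linear L" "open S" "smooth_on S f" "z \<in> S"
  shows "(pdx ^^ k) (\<lambda>z. L (f z)) z = L ((pdx ^^ k) f z)"
  using assms(4)
proof (induction k arbitrary: z)
  case (Suc k)
  have "pdx ((pdx ^^ k) (\<lambda>z. L (f z))) z = pdx (\<lambda>z. L ((pdx ^^ k) f z)) z"
    using Suc by (intro pdx_cong[OF assms(2)]) auto
  also have "\<dots> = L (pdx ((pdx ^^ k) f) z)"
    using pd_bounded_linear(2)[OF assms(1) smooth_onD(2)[OF smooth_on_pdx_funpow[OF assms(3)] Suc.prems]] .
  finally show ?case by simp
qed simp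

lemma pdx_sum:
  assumes "finite I" "\<And>i. i \<in> I \<Longrightarrow> f i differentiable (at z)"
  shows "pdx (\<lambda>z. \<Sum>i\<in>I. f i z) z = (\<Sum>i\<in>I. pdx (f i) z)"
  using assms
proof (induction I rule: finite_induct)
  case empty
  then show ?case by (simp add: pdx_def)
next
  case (insert i I)
  then show ?case
    using pd_add(1)[of "f i" z "\<lambda>z. \<Sum>i\<in>I. f i z"] by (simp add: differentiable_sum)
qed

text \<open>Pascal's rule, for the inductive step of the Leibniz formula.\<close>

lemma binomial_sum_Suc:
  fixes T :: "nat \<Rightarrow> nat \<Rightarrow> real"
  shows "(\<Sum>k\<le>n. real (n choose k) * (T k (Suc (n - k)) + T (Suc k) (n - k)))
    = (\<Sum>k\<le>Suc n. real (Suc n choose k) * T k (Suc n - k))"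
proof -
  have "(\<Sum>k\<le>Suc n. real (Suc n choose k) * T k (Suc n - k))
      = T 0 (Suc n) + (\<Sum>k\<le>n. real (n choose Suc k) * T (Suc k) (n - k))
        + (\<Sum>k\<le>n. real (n choose k) * T (Suc k) (n - k))"
    by (simp add: sum.atMost_Suc_shift sum.distrib distrib_right del: sum.atMost_Suc)
  also have "T 0 (Suc n) + (\<Sum>k\<le>n. real (n choose Suc k) * T (Suc k) (n - k))
      = (\<Sum>k\<le>Suc n. real (n choose k) * T k (Suc n - k))"
    by (simp add: sum.atMost_Suc_shift del: sum.atMost_Suc)
  also have "\<dots> = (\<Sum>k\<le>n. real (n choose k) * T k (Suc (n - k)))"
    by (simp add: Suc_diff_le)
  finally show ?thesis
    by (simp add: sum.distrib distrib_left)
qed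

lemma pdx_funpow_inner:
  fixes f g :: "complex \<Rightarrow> 'a::real_inner"
  assumes S: "open S" and f: "smooth_on S f" and g: "smooth_on S g" and "z \<in> S"
  shows "(pdx ^^ n) (\<lambda>z. f z \<bullet> g z) z
    = (\<Sum>k\<le>n. real (n choose k) * ((pdx ^^ k) f z \<bullet> (pdx ^^ (n - k)) g z))"
  using \<open>z \<in> S\<close>
proof (induction n arbitrary: z)
  case (Suc n)
  let ?T = "\<lambda>k j w. (pdx ^^ k) f w \<bullet> (pdx ^^ j) g w"
  have d: "(pdx ^^ k) f differentiable (at z)" "(pdx ^^ k) g differentiable (at z)" for k
    using smooth_onD(2)[OF smooth_on_pdx_funpow] f g Suc.prems by blast+
  have dT: "?T k j differentiable (at z)" for k j
    using pd_bilinear(1)[OF bounded_bilinear_inner d] .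
  have pT: "pdx (?T k j) z = ?T k (Suc j) z + ?T (Suc k) j z" for k j
    using pd_bilinear(2)[OF bounded_bilinear_inner d] by simp
  have "(pdx ^^ Suc n) (\<lambda>z. f z \<bullet> g z) z = pdx ((pdx ^^ n) (\<lambda>z. f z \<bullet> g z)) z"
    by simp
  also have "\<dots> = pdx (\<lambda>w. \<Sum>k\<le>n. real (n choose k) * ?T k (n - k) w) z"
    by (rule pdx_cong[OF S Suc.prems Suc.IH])
  also have "\<dots> = (\<Sum>k\<le>n. pdx (\<lambda>w. real (n choose k) * ?T k (n - k) w) z)"
    using dT by (intro pdx_sum) auto
  also have "\<dots> = (\<Sum>k\<le>n. real (n choose k) * (?T k (Suc (n - k)) z + ?T (Suc k) (n - k) z))"
    using pd_bounded_linear(2)[OF bounded_linear_mult_right dT] by (intro sum.cong) (simp_all only: pT)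
  also have "\<dots> = (\<Sum>k\<le>Suc n. real (Suc n choose k) * ?T k (Suc n - k) z)"
    by (rule binomial_sum_Suc)
  finally show ?case .
qed simp

text \<open>In the Leibniz sum of order 2m every term but the middle one contains a derivative of
  order below m. Flatness of the squared norm of \<open>f\<close> thus forces flatness of
  \<open>f\<close> itself.\<close>

lemma pdx_funpow_inner_self:
  fixes f :: "complex \<Rightarrow> 'a::real_inner"
  assumes "open S" "smooth_on S f" "z \<in> S" "\<And>k. k < m \<Longrightarrow> (pdx ^^ k) f z = 0"
  shows "(pdx ^^ (2 * m)) (\<lambda>z. f z \<bullet> f z) z = real (2 * m choose m) * (norm ((pdx ^^ m) f z))\<^sup>2"
proof -
  have "(pdx ^^ k) f z \<bullet> (pdx ^^ (2 * m - k)) f z = 0" if "k \<le> 2 * m" "k \<noteq> m" for k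
  proof -
    have "k < m \<or> 2 * m - k < m"
      using that by linarith
    then show ?thesis
      using assms(4) by auto
  qed
  then have "(\<Sum>k\<le>2 * m. real (2 * m choose k) * ((pdx ^^ k) f z \<bullet> (pdx ^^ (2 * m - k)) f z))
      = (\<Sum>k\<in>{m}. real (2 * m choose k) * ((pdx ^^ k) f z \<bullet> (pdx ^^ (2 * m - k)) f z))"
    by (intro sum.mono_neutral_right) auto
  also have "\<dots> = real (2 * m choose m) * (norm ((pdx ^^ m) f z))\<^sup>2"
    by (simp add: power2_norm_eq_inner mult_2)
  finally show ?thesis
    unfolding pdx_funpow_inner[OF assms(1,2,2,3)] .
qed

text \<open>Induction on the order: zeros at which \<open>pdx f\<close> also vanishes are covered by
  the induction hypothesis for \<open>pdx f\<close>, and the remaining ones form a regular zero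
  set.\<close>

lemma negligible_zero_set_finite_order:
  fixes f :: "complex \<Rightarrow> real"
  assumes "open S" "smooth_on S f" "\<And>z. z \<in> S \<Longrightarrow> (pdx ^^ m) f z \<noteq> 0"
  shows "negligible {z \<in> S. f z = 0}"
  using assms(2,3)
proof (induction m arbitrary: f)
  case 0
  then have "{z \<in> S. f z = 0} = {}"
    by auto
  then show ?case by (simp only: negligible_empty)
next
  case (Suc m)
  have "negligible {z \<in> S. pdx f z = 0}"
    using Suc.prems by (intro Suc.IH smooth_onD(3)) (simp_all add: funpow_swap1)
  moreover have "negligible {z \<in> S. f z = 0 \<and> pdx f z \<noteq> 0}"
    using smooth_onD(2)[OF Suc.prems(1)]
    by (intro negligible_regular_zero_set[of 1 _ f]) (auto simp: pdx_def)
  ultimately have "negligible ({z \<in> S. pdx f z = 0} \<union> {z \<in> S. f z = 0 \<and> pdx f z \<noteq> 0})"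
    by (rule negligible_Un)
  then show ?case
    by (rule negligible_subset) auto
qed

section \<open>The entire curve \<open>\<phi>\<close>, branch points and their order\<close>

locale minimal_immersion =
  fixes F :: "complex \<Rightarrow> real ^ 'n"
  assumes F: "branched_minimal_immersion F"
begin

lemma smooth: "smooth_on UNIV F"
  and harmonic: "pdx (pdx F) z + pdy (pdy F) z = 0"
  and conformal: "pdx F z \<bullet> pdy F z = 0" "norm (pdx F z) = norm (pdy F z)"
  and not_constant: "\<not> (\<exists>c. \<forall>z. F z = c)"
  using F unfolding branched_minimal_immersion_def by auto

lemmas F_diff = smooth_onD(2)[OF smooth, OF UNIV_I]
  and Fx_smooth = smooth_onD(3)[OF smooth]
  and Fy_smooth = smooth_onD(4)[OF smooth]
  and Fx_diff = smooth_onD(2)[OF smooth_onD(3)[OF smooth], OF UNIV_I]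
  and Fy_diff = smooth_onD(2)[OF smooth_onD(4)[OF smooth], OF UNIV_I]

text \<open>Twice the components of $\partial F / \partial z$.\<close>

definition \<phi> :: "'n \<Rightarrow> complex \<Rightarrow> complex" where
  "\<phi> j z = of_real (pdx F z $ j) - \<i> * of_real (pdy F z $ j)"

text \<open>The Cauchy-Riemann equations for \<open>\<phi>\<close>: one is harmonicity of
  \<open>F\<close>, the other is symmetry of its second derivatives.\<close>

lemma \<phi>_has_field_derivative:
  "(\<phi> j has_field_derivative
     (of_real (pdx (pdx F) z $ j) - \<i> * of_real (pdx (pdy F) z $ j))) (at z)"
proof -
  have L: "bounded_linear (\<lambda>v::real ^ 'n. complex_of_real (v $ j))"
    by (intro bounded_linear_compose[OF bounded_linear_of_real] bounded_linear_vec_nth)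
  have yy: "pdy (pdy F) z = - pdx (pdx F) z"
    using harmonic[of z] by (simp add: add_eq_0_iff)
  have xy: "pdy (pdx F) z = pdx (pdy F) z"
    using pdx_pdy_commute[OF open_UNIV UNIV_I, of F z] smooth unfolding smooth_on_def by auto
  have "((\<lambda>z. of_real (pdx F z $ j) - \<i> * of_real (pdy F z $ j)) has_derivative
      (\<lambda>h. of_real ((Re h *\<^sub>R pdx (pdx F) z + Im h *\<^sub>R pdy (pdx F) z) $ j)
        - \<i> * of_real ((Re h *\<^sub>R pdx (pdy F) z + Im h *\<^sub>R pdy (pdy F) z) $ j))) (at z)"
    using bounded_linear.has_derivative[OF L has_derivative_pd[OF Fx_diff]]
      bounded_linear.has_derivative[OF L has_derivative_pd[OF Fy_diff]]
    by (intro has_derivative_diff has_derivative_mult_right)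
  moreover have "of_real ((Re h *\<^sub>R pdx (pdx F) z + Im h *\<^sub>R pdy (pdx F) z) $ j)
        - \<i> * of_real ((Re h *\<^sub>R pdx (pdy F) z + Im h *\<^sub>R pdy (pdy F) z) $ j)
      = (of_real (pdx (pdx F) z $ j) - \<i> * of_real (pdx (pdy F) z $ j)) * h" for h
    unfolding xy yy by (simp add: complex_eq_iff algebra_simps)
  ultimately show ?thesis
    unfolding has_field_derivative_def \<phi>_def[abs_def] by (simp only:)
qed

lemma holomorphic_\<phi>: "\<phi> j holomorphic_on S"
  using \<phi>_has_field_derivative by (meson holomorphic_on_def field_differentiable_def field_differentiable_at_within)

lemma higher_deriv_\<phi>:
  "(deriv ^^ k) (\<phi> j) z = of_real ((pdx ^^ k) (pdx F) z $ j) - \<i> * of_real ((pdx ^^ k) (pdy F) z $ j)"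
proof -
  have L: "bounded_linear (\<lambda>v::real ^ 'n. complex_of_real (v $ j))"
    "bounded_linear (\<lambda>v::real ^ 'n. - \<i> * complex_of_real (v $ j))"
    by (intro bounded_linear_compose[OF bounded_linear_of_real]
        bounded_linear_compose[OF bounded_linear_mult_right] bounded_linear_vec_nth)+
  have "(deriv ^^ k) (\<phi> j) = (pdx ^^ k) (\<phi> j)"
  proof (induction k)
    case (Suc k)
    have "(deriv ^^ k) (\<phi> j) holomorphic_on UNIV"
      by (intro holomorphic_higher_deriv holomorphic_\<phi>) simp
    then have "pdx ((deriv ^^ k) (\<phi> j)) z = deriv ((deriv ^^ k) (\<phi> j)) z" for z
      using has_derivative_complex(1) holomorphic_derivI[OF _ open_UNIV UNIV_I] by blast
    then have "pdx ((deriv ^^ k) (\<phi> j)) = deriv ((deriv ^^ k) (\<phi> j))"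
      by (rule ext)
    then show ?case
      using Suc by (simp only: funpow.simps o_apply)
  qed simp
  moreover have "(pdx ^^ k) (\<phi> j) z
      = (pdx ^^ k) (\<lambda>z. of_real (pdx F z $ j) + - \<i> * of_real (pdy F z $ j)) z"
    by (simp add: \<phi>_def[abs_def])
  ultimately show ?thesis
    using pdx_funpow_add[OF open_UNIV smooth_on_bounded_linear[OF L(1) open_UNIV Fx_smooth]
        smooth_on_bounded_linear[OF L(2) open_UNIV Fy_smooth] UNIV_I, of k z]
      pdx_funpow_bounded_linear[OF L(1) open_UNIV Fx_smooth UNIV_I, of k z]
      pdx_funpow_bounded_linear[OF L(2) open_UNIV Fy_smooth UNIV_I, of k z]
    by simp
qed

lemma \<phi>_not_identically_0: "\<exists>j z. \<phi> j z \<noteq> 0"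
proof (rule ccontr)
  assume "\<not> (\<exists>j z. \<phi> j z \<noteq> 0)"
  then have "pdx F z = 0" "pdy F z = 0" for z
    by (simp_all add: \<phi>_def vec_eq_iff complex_eq_iff)
  then have "(F has_derivative (\<lambda>h. 0)) (at z)" for z
    using has_derivative_pd[OF F_diff, of z] by simp
  then show False
    using has_derivative_zero_constant[of UNIV F] not_constant by auto
qed

text \<open>A branch point is a common zero of all \<open>\<phi> j\<close>, and an entire function
  that is not identically zero has only countably many zeros.\<close>

lemma negligible_branch_points: "negligible {z. pdx F z = 0}"
proof -
  obtain j z where "\<phi> j z \<noteq> 0"
    using \<phi>_not_identically_0 by blast
  have "countable {z \<in> UNIV. \<phi> j z = 0}"
  proof (cases "\<phi> j constant_on UNIV")
    case True
    then have "{z \<in> UNIV. \<phi> j z = 0} = {}"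
      using \<open>\<phi> j z \<noteq> 0\<close> unfolding constant_on_def by force
    then show ?thesis
      by (simp only: countable_empty)
  next
    case False
    then show ?thesis
      using holomorphic_\<phi> by (intro holomorphic_countable_zeros) auto
  qed
  moreover have "{z. pdx F z = 0} \<subseteq> {z \<in> UNIV. \<phi> j z = 0}"
  proof
    fix z assume "z \<in> {z. pdx F z = 0}"
    then have "pdx F z = 0" "pdy F z = 0"
      using conformal(2)[of z] by simp_all
    then show "z \<in> {z \<in> UNIV. \<phi> j z = 0}"
      by (simp add: \<phi>_def)
  qed
  ultimately have "countable {z. pdx F z = 0}"
    using countable_subset by blast
  then show ?thesis
    using negligible_countable_Union[of "(\<lambda>z. {z}) ` {z. pdx F z = 0}"] by force
qed

text \<open>If all x-derivatives of |F_x|^2 = |F_y|^2 vanished at \<open>p\<close>, then by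
  induction so would those of \<open>pdx F\<close> and \<open>pdy F\<close>. Along holomorphic
  functions x-derivatives are complex derivatives, so the identity theorem would give phi = 0
  everywhere and \<open>F\<close> would be constant.\<close>

lemma finite_order:
  "\<exists>m. (pdx ^^ m) (\<lambda>z. pdx F z \<bullet> pdx F z) p \<noteq> 0"
proof (rule ccontr)
  assume flat: "\<not> (\<exists>m. (pdx ^^ m) (\<lambda>z. pdx F z \<bullet> pdx F z) p \<noteq> 0)"
  have "pdx F z \<bullet> pdx F z = pdy F z \<bullet> pdy F z" for z
    by (simp only: dot_square_norm conformal(2))
  then have flat_y: "(pdx ^^ m) (\<lambda>z. pdy F z \<bullet> pdy F z) p = 0" for m
    using flat by simp
  have "(pdx ^^ m) (pdx F) p = 0 \<and> (pdx ^^ m) (pdy F) p = 0" for m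
  proof (induction m rule: less_induct)
    case (less m)
    have "real (2 * m choose m) \<noteq> 0"
      by simp
    then show ?case
      using pdx_funpow_inner_self[OF open_UNIV Fx_smooth UNIV_I, of m p]
        pdx_funpow_inner_self[OF open_UNIV Fy_smooth UNIV_I, of m p] less flat flat_y
      by simp
  qed
  then have "(deriv ^^ m) (\<phi> j) p = 0" for m j
    by (simp add: higher_deriv_\<phi>)
  then have "\<phi> j z = 0" for j z
    using holomorphic_fun_eq_0_on_connected[OF holomorphic_\<phi> open_UNIV connected_UNIV] by blast
  then show False
    using \<phi>_not_identically_0 by blast
qed

end

text \<open>\<open>K x \<bullet> y\<close> plays the role of the Kaehler form. The conditions on
  \<open>K\<close> are imposed on all of R^n because a variation need not stay in the affine
  subspace containing \<open>F\<close>.\<close>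

locale calibrated_immersion = minimal_immersion F for F :: "complex \<Rightarrow> real ^ 'n" +
  fixes K :: "real ^ 'n \<Rightarrow> real ^ 'n"
  assumes K: "linear K" "\<And>x y. K x \<bullet> y = - (x \<bullet> K y)" "\<And>x. norm (K x) \<le> norm x"
    "\<And>z. K (pdx F z) = pdy F z"
begin

lemma bounded_bilinear_K: "bounded_bilinear (\<lambda>x y. K x \<bullet> y)"
  unfolding bilinear_conv_bounded_bilinear [symmetric] bilinear_def
  by (auto intro!: linearI simp: inner_add_left inner_add_right linear_add[OF K(1)] linear_scale[OF K(1)])

text \<open>Wirtinger's inequality: \<open>K x\<close> is orthogonal to \<open>x\<close>, so the
  component of \<open>y\<close> along \<open>x\<close> may be subtracted before Cauchy-Schwarz. The
  product of |x| with the length of the remainder is the area of the parallelogram.\<close>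

lemma calibration: "K x \<bullet> y \<le> norm (wedge x y)"
proof (cases "x = 0")
  case True
  then show ?thesis
    using linear_0[OF K(1)] by simp
next
  case False
  define c where "c = (x \<bullet> y) / (x \<bullet> x)"
  have "K x \<bullet> x = 0"
    using K(2)[of x x] by (simp add: inner_commute)
  then have "K x \<bullet> y = K x \<bullet> (y - c *\<^sub>R x)"
    by (simp add: inner_diff_right)
  also have "\<dots> \<le> norm (K x) * norm (y - c *\<^sub>R x)"
    by (rule norm_cauchy_schwarz)
  also have "\<dots> \<le> norm x * norm (y - c *\<^sub>R x)"
    using K(3) by (simp add: mult_right_mono)
  also have "\<dots> = sqrt ((x \<bullet> x) * ((y - c *\<^sub>R x) \<bullet> (y - c *\<^sub>R x)))"
    by (simp add: norm_eq_sqrt_inner real_sqrt_mult)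
  also have "(x \<bullet> x) * ((y - c *\<^sub>R x) \<bullet> (y - c *\<^sub>R x)) = (x \<bullet> x) * (y \<bullet> y) - (x \<bullet> y) * (x \<bullet> y)"
    using False by (simp add: c_def inner_diff_left inner_diff_right inner_commute[of y x] field_simps)
  finally show ?thesis
    by (simp only: norm_wedge)
qed

lemma wedge_eq_0_imp: "wedge x y = 0 \<Longrightarrow> K x \<bullet> y = 0"
  using calibration[of x y] calibration[of x "- y"]
  by (simp add: bounded_bilinear.minus_right[OF bounded_bilinear_wedge])

lemma K_pd: "K (pdx F z) \<bullet> pdy F z = pdx F z \<bullet> pdx F z"
  by (simp only: K(4) dot_square_norm conformal(2))

text \<open>Degenerate points of F + tW are zeros of the Kaehler form \<open>D t\<close>, a smooth
  scalar function that is polynomial in t and equals |F_x|^2 at t = 0. By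
  \<open>finite_order\<close> some x-derivative of it is nonzero at each point, which persists for
  nearby points and small t; compactness makes the range of t uniform.\<close>

lemma negligible_degenerate:
  assumes "compact \<Omega>" "open U" "\<Omega> \<subseteq> U" "smooth_on U W"
  shows "\<exists>\<epsilon>>0. \<forall>t. \<bar>t\<bar> < \<epsilon> \<longrightarrow>
    negligible {z \<in> \<Omega>. wedge (pdx F z + t *\<^sub>R pdx W z) (pdy F z + t *\<^sub>R pdy W z) = 0}"
proof -
  define D0 where "D0 = (\<lambda>z. K (pdx F z) \<bullet> pdy F z)"
  define D1 where "D1 = (\<lambda>z. K (pdx F z) \<bullet> pdy W z + K (pdx W z) \<bullet> pdy F z)"
  define D2 where "D2 = (\<lambda>z. K (pdx W z) \<bullet> pdy W z)"
  define D where "D t = (\<lambda>z. D0 z + (t * D1 z + t\<^sup>2 * D2 z))" for t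
  have D_eq: "K (pdx F z + t *\<^sub>R pdx W z) \<bullet> (pdy F z + t *\<^sub>R pdy W z) = D t z" for t z
    by (simp add: D_def D0_def D1_def D2_def linear_add[OF K(1)] linear_scale[OF K(1)]
        inner_add_left inner_add_right power2_eq_square algebra_simps)
  have pdF: "smooth_on U (pdx F)" "smooth_on U (pdy F)"
    using Fx_smooth Fy_smooth smooth_on_subset by blast+
  have sm: "smooth_on U D0" "smooth_on U D1" "smooth_on U D2"
    unfolding D0_def D1_def D2_def using pdF smooth_onD(3,4)[OF assms(4)] assms(2)
    by (auto intro!: smooth_on_add smooth_on_bilinear[OF bounded_bilinear_K])
  have sm_t: "smooth_on U (\<lambda>z. t * D1 z)" "smooth_on U (\<lambda>z. t\<^sup>2 * D2 z)" for t
    using sm assms(2) by (auto intro!: smooth_on_bounded_linear[OF bounded_linear_mult_right])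
  have sm_D: "smooth_on U (D t)" for t
    unfolding D_def using sm sm_t assms(2) by (intro smooth_on_add)
  have D_order: "(pdx ^^ m) (D t) z = (pdx ^^ m) D0 z + (t * (pdx ^^ m) D1 z + t\<^sup>2 * (pdx ^^ m) D2 z)"
    if "z \<in> U" for m t z
    unfolding D_def
    using pdx_funpow_add[OF assms(2) sm(1) smooth_on_add[OF assms(2) sm_t(1)[of t] sm_t(2)[of t]] that, of m]
      pdx_funpow_add[OF assms(2) sm_t(1)[of t] sm_t(2)[of t] that, of m]
      pdx_funpow_bounded_linear[OF bounded_linear_mult_right assms(2) sm(2) that, of m t]
      pdx_funpow_bounded_linear[OF bounded_linear_mult_right assms(2) sm(3) that, of m "t\<^sup>2"]
    by simp
  define good where "good p N \<epsilon> \<longleftrightarrow> open N \<and> p \<in> N \<and> 0 < \<epsilon> \<and>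
    (\<forall>t. \<bar>t\<bar> < \<epsilon> \<longrightarrow> negligible {z \<in> N. D t z = 0})" for p N \<epsilon>
  have "\<exists>N \<epsilon>. good p N \<epsilon>" if "p \<in> \<Omega>" for p
  proof -
    have "p \<in> U"
      using that assms(3) by blast
    obtain m where m: "(pdx ^^ m) D0 p \<noteq> 0"
      using finite_order[of p] by (auto simp: D0_def K_pd)
    have cont: "isCont ((pdx ^^ m) f) p" if "smooth_on U f" for f :: "complex \<Rightarrow> real"
      using smooth_onD(1)[OF smooth_on_pdx_funpow[OF that]] \<open>p \<in> U\<close> assms(2)
        continuous_on_eq_continuous_at by blast
    \<comment> \<open>Joint continuity in (z, t) supplies one neighbourhood of \<open>p\<close> and
      one range of t with the same order m.\<close>
    have "((\<lambda>x. (pdx ^^ m) D0 (fst x) + (snd x * (pdx ^^ m) D1 (fst x) + (snd x)\<^sup>2 * (pdx ^^ m) D2 (fst x)))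
        \<longlongrightarrow> (pdx ^^ m) D0 p + (0 * (pdx ^^ m) D1 p + 0\<^sup>2 * (pdx ^^ m) D2 p)) (nhds p \<times>\<^sub>F nhds 0)"
      using cont[OF sm(1)] cont[OF sm(2)] cont[OF sm(3)]
      by (intro tendsto_intros filterlim_compose[OF _ filterlim_fst] filterlim_snd)
        (auto simp: isCont_def tendsto_at_iff_tendsto_nhds)
    then have "\<forall>\<^sub>F x in nhds p \<times>\<^sub>F nhds (0::real).
        (pdx ^^ m) D0 (fst x) + (snd x * (pdx ^^ m) D1 (fst x) + (snd x)\<^sup>2 * (pdx ^^ m) D2 (fst x)) \<noteq> 0"
      by (rule tendsto_imp_eventually_ne) (use m in simp)
    then obtain P Q where P: "\<forall>\<^sub>F z in nhds p. P z" and Q: "\<forall>\<^sub>F t in nhds (0::real). Q t"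
      and PQ: "\<And>z t. P z \<Longrightarrow> Q t \<Longrightarrow>
        (pdx ^^ m) D0 z + (t * (pdx ^^ m) D1 z + t\<^sup>2 * (pdx ^^ m) D2 z) \<noteq> 0"
      unfolding eventually_prod_filter by auto
    obtain N where N: "open N" "p \<in> N" "\<And>z. z \<in> N \<Longrightarrow> P z"
      using P unfolding eventually_nhds by blast
    obtain \<epsilon> where \<epsilon>: "\<epsilon> > 0" "\<And>t. \<bar>t\<bar> < \<epsilon> \<Longrightarrow> Q t"
      using Q unfolding eventually_nhds_metric dist_real_def by auto
    have "negligible {z \<in> N \<inter> U. D t z = 0}" if "\<bar>t\<bar> < \<epsilon>" for t
    proof (rule negligible_zero_set_finite_order)
      show "open (N \<inter> U)"
        using N assms(2) by blast
      show "smooth_on (N \<inter> U) (D t)"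
        using sm_D smooth_on_subset by blast
      show "(pdx ^^ m) (D t) z \<noteq> 0" if "z \<in> N \<inter> U" for z
        using that N(3) \<epsilon>(2)[OF \<open>\<bar>t\<bar> < \<epsilon>\<close>] PQ D_order by auto
    qed
    then show ?thesis
      using N \<epsilon>(1) \<open>p \<in> U\<close> assms(2)
      by (intro exI[of _ "N \<inter> U"] exI[of _ \<epsilon>]) (simp add: good_def open_Int)
  qed
  then obtain N \<epsilon> where "\<And>p. p \<in> \<Omega> \<Longrightarrow> good p (N p) (\<epsilon> p)"
    by metis
  then have N: "\<And>p. p \<in> \<Omega> \<Longrightarrow> open (N p)" "\<And>p. p \<in> \<Omega> \<Longrightarrow> p \<in> N p"
    and \<epsilon>: "\<And>p. p \<in> \<Omega> \<Longrightarrow> \<epsilon> p > 0"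
      "\<And>p t. p \<in> \<Omega> \<Longrightarrow> \<bar>t\<bar> < \<epsilon> p \<Longrightarrow> negligible {z \<in> N p. D t z = 0}"
    by (simp_all add: good_def)
  obtain P where P: "P \<subseteq> \<Omega>" "finite P" "\<Omega> \<subseteq> (\<Union>p\<in>P. N p)"
  proof (rule compactE_image[OF assms(1)])
    show "\<Omega> \<subseteq> (\<Union>p\<in>\<Omega>. N p)"
      using N(2) by blast
  qed (use N(1) in auto)
  \<comment> \<open>Inserting 1 keeps the minimum meaningful when \<open>\<Omega>\<close>, and with
    it \<open>P\<close>, is empty.\<close>
  define e where "e = Min (insert 1 (\<epsilon> ` P))"
  have e: "e > 0"
    using P \<epsilon>(1) by (auto simp: e_def)
  have "negligible {z \<in> \<Omega>. wedge (pdx F z + t *\<^sub>R pdx W z) (pdy F z + t *\<^sub>R pdy W z) = 0}"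
    if t: "\<bar>t\<bar> < e" for t
  proof (rule negligible_subset)
    have "\<bar>t\<bar> < \<epsilon> p" if "p \<in> P" for p
      using t that P(2) Min_le[of "insert 1 (\<epsilon> ` P)" "\<epsilon> p"] by (auto simp: e_def)
    then show "negligible (\<Union>p\<in>P. {z \<in> N p. D t z = 0})"
      using P \<epsilon>(2) by (intro negligible_Union) auto
    show "{z \<in> \<Omega>. wedge (pdx F z + t *\<^sub>R pdx W z) (pdy F z + t *\<^sub>R pdy W z) = 0}
        \<subseteq> (\<Union>p\<in>P. {z \<in> N p. D t z = 0})"
    proof
      fix z assume z: "z \<in> {z \<in> \<Omega>. wedge (pdx F z + t *\<^sub>R pdx W z) (pdy F z + t *\<^sub>R pdy W z) = 0}"
      then have "D t z = 0"
        using wedge_eq_0_imp D_eq by fastforce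
      then show "z \<in> (\<Union>p\<in>P. {z \<in> N p. D t z = 0})"
        using z P(3) by auto
    qed
  qed
  with e show ?thesis by blast
qed

text \<open>The area element dominates the Kaehler form of F + tW, with equality at t = 0. The
  coefficients of t and t^2 in that form are Jacobians involving \<open>W\<close>, so they integrate
  to zero.\<close>

lemma area_minimizing:
  assumes "compact \<Omega>" "open U" "\<Omega> \<subseteq> U" "smooth_on U W" "\<forall>z\<in>frontier \<Omega>. W z = 0"
  shows "area_on \<Omega> F \<le> area_on \<Omega> (\<lambda>z. F z + t *\<^sub>R W z)"
proof -
  interpret area_variation F W \<Omega> U
    using assms smooth conformal by unfold_locales auto
  define D1 where "D1 = (\<lambda>z. K (pdx W z) \<bullet> pdy F z - K (pdy W z) \<bullet> pdx F z)"
  \<comment> \<open>By skewness of \<open>K\<close> this is twice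
    \<open>K (pdx W z) \<bullet> pdy W z\<close>, written as a Jacobian so that Stokes applies;
    hence the coefficient \<open>t\<^sup>2 / 2\<close> below.\<close>
  define D2 where "D2 = (\<lambda>z. K (pdx W z) \<bullet> pdy W z - K (pdy W z) \<bullet> pdx W z)"
  have "integral \<Omega> D1 = 0" "integral \<Omega> D2 = 0"
    unfolding D1_def D2_def using assms smooth smooth_on_subset
    by (intro integral_jacobian_eq_0[OF bounded_bilinear_K assms(1-4)]; blast)+
  moreover have contK: "continuous_on \<Omega> (\<lambda>z. K (f z) \<bullet> g z)"
    if "continuous_on \<Omega> f" "continuous_on \<Omega> g" for f g :: "complex \<Rightarrow> real ^ 'n"
    using bounded_bilinear.continuous_on[OF bounded_bilinear_K that] .
  then have int: "D1 integrable_on \<Omega>" "D2 integrable_on \<Omega>"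
    unfolding D1_def D2_def
    by (intro continuous_on_compact_integrable assms(1) continuous_on_diff continuous_pd; blast intro: continuous_pd)+
  ultimately have "((\<lambda>z. norm (V 0 z) + (t * D1 z + t\<^sup>2 / 2 * D2 z)) has_integral
      integral \<Omega> (\<lambda>z. norm (V 0 z)) + (t * 0 + t\<^sup>2 / 2 * 0)) \<Omega>"
    using norm_V_integrable by (intro has_integral_add has_integral_mult_right) (auto simp: has_integral_integral[symmetric] has_integral_iff)
  moreover have "norm (V 0 z) + (t * D1 z + t\<^sup>2 / 2 * D2 z) \<le> norm (V t z)" for z
  proof -
    have "norm (V 0 z) = K (pdx F z) \<bullet> pdy F z"
      by (simp add: V_def norm_v0 K_pd dot_square_norm)
    moreover have "K (pdy W z) \<bullet> pdx F z = - (K (pdx F z) \<bullet> pdy W z)"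
      "K (pdy W z) \<bullet> pdx W z = - (K (pdx W z) \<bullet> pdy W z)"
      using K(2) by (metis inner_commute)+
    ultimately have "norm (V 0 z) + (t * D1 z + t\<^sup>2 / 2 * D2 z)
        = K (pdx F z + t *\<^sub>R pdx W z) \<bullet> (pdy F z + t *\<^sub>R pdy W z)"
      by (simp add: D1_def D2_def linear_add[OF K(1)] linear_scale[OF K(1)]
        inner_add_left inner_add_right power2_eq_square algebra_simps)
    also have "\<dots> \<le> norm (V t z)"
      unfolding V_eq by (rule calibration)
    finally show ?thesis .
  qed
  ultimately have "integral \<Omega> (\<lambda>z. norm (V 0 z)) + (t * 0 + t\<^sup>2 / 2 * 0) \<le> integral \<Omega> (\<lambda>z. norm (V t z))"
    using has_integral_le[OF _ integrable_integral[OF norm_V_integrable[of t]]] by blast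
  then show ?thesis
    using area_eq[of 0] area_eq[of t] by simp
qed

lemma stable: "stable F"
  unfolding stable_def stable_on_def
proof (intro allI impI; elim conjE)
  fix \<Omega> U and W :: "complex \<Rightarrow> real ^ 'n"
  assume *: "smooth_compact_domain \<Omega>" "open U" "\<Omega> \<subseteq> U" "smooth_on U W" "\<forall>z\<in>frontier \<Omega>. W z = 0"
  then have "compact \<Omega>"
    by (simp add: smooth_compact_domain_def)
  interpret area_variation F W \<Omega> U
    using * \<open>compact \<Omega>\<close> smooth conformal by unfold_locales auto
  obtain a' d where a: "\<forall>\<^sub>F t in nhds 0. ((\<lambda>t. area_on \<Omega> (\<lambda>z. F z + t *\<^sub>R W z)) has_real_derivative a' t) (at t)"
    and d: "(a' has_real_derivative d) (at 0)"
    using negligible_degenerate[OF \<open>compact \<Omega>\<close> *(2-4)] area_twice_differentiable unfolding V_eq by blast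
  have "d \<ge> 0"
  proof (rule tendsto_lowerbound[OF second_difference_tendsto[OF a d]])
    show "\<forall>\<^sub>F t in at_right 0. 0 \<le> (area_on \<Omega> (\<lambda>z. F z + t *\<^sub>R W z) + area_on \<Omega> (\<lambda>z. F z + (- t) *\<^sub>R W z)
        - 2 * area_on \<Omega> (\<lambda>z. F z + 0 *\<^sub>R W z)) / t\<^sup>2"
    proof (rule always_eventually, rule allI)
      fix t
      show "0 \<le> (area_on \<Omega> (\<lambda>z. F z + t *\<^sub>R W z) + area_on \<Omega> (\<lambda>z. F z + (- t) *\<^sub>R W z)
        - 2 * area_on \<Omega> (\<lambda>z. F z + 0 *\<^sub>R W z)) / t\<^sup>2"
        using area_minimizing[OF \<open>compact \<Omega>\<close> *(2-5), of t] area_minimizing[OF \<open>compact \<Omega>\<close> *(2-5), of "- t"]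
        by simp
    qed
  qed simp
  with a d show "\<exists>a' d. (\<forall>\<^sub>F t in nhds 0.
      ((\<lambda>s. area_on \<Omega> (\<lambda>z. F z + s *\<^sub>R W z)) has_real_derivative a' t) (at t)) \<and>
      (a' has_real_derivative d) (at 0) \<and> d \<ge> 0"
    by blast
qed

end

section \<open>Isotropic immersions are holomorphic\<close>

lemma orthogonal_projection:
  fixes V :: "'a::euclidean_space set"
  assumes "subspace V"
  obtains P where "linear P" "\<And>x. P x \<in> V" "\<And>v. v \<in> V \<Longrightarrow> P v = v" "\<And>x y. P x \<bullet> y = x \<bullet> P y"
proof -
  obtain B where B: "B \<subseteq> V" "pairwise orthogonal B" "\<And>x. x \<in> B \<Longrightarrow> norm x = 1"
    "independent B" "span B = V"
    using orthonormal_basis_subspace[OF assms] by metis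
  have "finite B"
    using B(4) independent_imp_finite by blast
  define P where "P x = (\<Sum>b\<in>B. (b \<bullet> x) *\<^sub>R b)" for x
  have lin: "linear P"
    unfolding P_def by (auto intro!: linearI simp: inner_add_right scaleR_add_left sum.distrib scaleR_sum_right)
  have basis: "P b = b" if "b \<in> B" for b
  proof -
    have "(c \<bullet> b) *\<^sub>R c = (if c = b then b else 0)" if "c \<in> B" for c
      using B(2,3) that \<open>b \<in> B\<close> by (auto simp: pairwise_def orthogonal_def norm_eq_1)
    then show ?thesis
      using \<open>finite B\<close> that by (simp add: P_def)
  qed
  show thesis
  proof
    show "P x \<in> V" for x
      unfolding P_def using B(1) assms by (intro subspace_sum subspace_scale) auto
    show "P v = v" if "v \<in> V" for v
    proof -
      have "v \<in> span B"
        using that B(5) by simp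
      then show ?thesis
        using linear_eq_on_span[OF lin linear_id, of B v] basis by simp
    qed
    show "P x \<bullet> y = x \<bullet> P y" for x y
      by (simp add: P_def inner_sum_left inner_sum_right inner_commute mult.commute)
  qed (rule lin)
qed

context minimal_immersion
begin

lemma pd_linear:
  assumes "linear L"
  shows "(\<lambda>z. L (F z)) differentiable (at z)" "pdx (\<lambda>z. L (F z)) z = L (pdx F z)" "pdy (\<lambda>z. L (F z)) z = L (pdy F z)"
proof -
  have "bounded_linear L"
    using assms linear_conv_bounded_linear by blast
  note * = pd_bounded_linear[OF this F_diff]
  show "(\<lambda>z. L (F z)) differentiable (at z)" "pdx (\<lambda>z. L (F z)) z = L (pdx F z)" "pdy (\<lambda>z. L (F z)) z = L (pdy F z)"
    by (rule *)+
qed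

text \<open>\<open>J\<close> is controlled only on \<open>V\<close>. Composing it with the
  orthogonal projection onto \<open>V\<close> gives a skew contraction of the whole space that
  agrees with \<open>J\<close> on the derivatives of \<open>F\<close>, which lie in
  \<open>V\<close>.\<close>

lemma calibration_of_holomorphic:
  assumes "holomorphic_up_to_rigid_motion F"
  shows "\<exists>K. calibrated_immersion F K"
proof -
  obtain b V J where *: "subspace V \<and> even (dim V) \<and> (\<forall>z. F z \<in> (\<lambda>w. b + w) ` V) \<and>
      linear J \<and> J ` V \<subseteq> V \<and> (\<forall>v\<in>V. J (J v) = - v) \<and> (\<forall>v\<in>V. \<forall>w\<in>V. J v \<bullet> J w = v \<bullet> w) \<and>
      (\<forall>z v. frechet_derivative F (at z) (\<i> * v) = J (frechet_derivative F (at z) v))"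
    using assms unfolding holomorphic_up_to_rigid_motion_def by (elim exE) (rule that)
  then have V: "subspace V" "\<And>z. F z \<in> (\<lambda>w. b + w) ` V" and J: "linear J" "J ` V \<subseteq> V"
    "\<And>v. v \<in> V \<Longrightarrow> J (J v) = - v" "\<And>v w. v \<in> V \<Longrightarrow> w \<in> V \<Longrightarrow> J v \<bullet> J w = v \<bullet> w"
    "\<And>z v. frechet_derivative F (at z) (\<i> * v) = J (frechet_derivative F (at z) v)"
    by simp_all
  obtain P where P: "linear P" "\<And>x. P x \<in> V" "\<And>v. v \<in> V \<Longrightarrow> P v = v" "\<And>x y. P x \<bullet> y = x \<bullet> P y"
    using orthogonal_projection[OF V(1)] by blast
  have F_eq: "F z = P (F z) + (b - P b)" for z
  proof -
    obtain v where "v \<in> V" "F z = b + v"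
      using V(2) by blast
    then show ?thesis
      using P(3) by (simp add: linear_add[OF P(1)])
  qed
  have Px: "P (pdx F z) = pdx F z" for z
  proof -
    have "pdx F z = pdx (\<lambda>z. P (F z) + (b - P b)) z"
      using F_eq by (intro pdx_cong[OF open_UNIV]) auto
    also have "\<dots> = pdx (\<lambda>z. P (F z)) z"
      using pd_add(1)[OF pd_linear(1)[OF P(1)], of "\<lambda>_. b - P b" z] by (simp add: pdx_def[of "\<lambda>_. b - P b"])
    finally show ?thesis
      using pd_linear(2)[OF P(1)] by simp
  qed
  define K where "K x = J (P x)" for x
  have KV: "K x \<in> V" for x
    using J(2) P(2) by (auto simp: K_def)
  have K_K: "K x \<bullet> K y = P x \<bullet> P y" for x y
    by (simp add: K_def J(4) P(2))
  have "calibrated_immersion F K"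
  proof (intro calibrated_immersion.intro calibrated_immersion_axioms.intro)
    show "minimal_immersion F"
      by (rule minimal_immersion_axioms)
    show "linear K"
      unfolding K_def[abs_def] using linear_compose[OF P(1) J(1)] by (simp add: o_def)
    show "K x \<bullet> y = - (x \<bullet> K y)" for x y
    proof -
      have "K x \<bullet> y = P (K x) \<bullet> y"
        using P(3) KV by simp
      also have "\<dots> = K x \<bullet> P y"
        by (rule P(4))
      also have "\<dots> = J (K x) \<bullet> J (P y)"
        using J(4) KV P(2) by simp
      also have "\<dots> = - (P x \<bullet> K y)"
        using J(3) P(2) by (simp add: K_def)
      also have "\<dots> = - (x \<bullet> K y)"
        using P(3,4) KV by simp
      finally show ?thesis .
    qed
    show "norm (K x) \<le> norm x" for x
    proof -
      have "(norm (K x))\<^sup>2 = P x \<bullet> P x"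
        by (simp add: power2_norm_eq_inner K_K)
      also have "\<dots> = x \<bullet> P x"
        using P(2,3,4) by simp
      also have "\<dots> \<le> norm x * norm (P x)"
        by (rule norm_cauchy_schwarz)
      also have "norm (P x) = norm (K x)"
        by (simp add: norm_eq_sqrt_inner K_K)
      finally have "norm (K x) * norm (K x) \<le> norm x * norm (K x)"
        by (simp add: power2_eq_square)
      then show ?thesis
        by (cases "norm (K x) = 0") (auto simp: mult_le_cancel_right)
    qed
    show "K (pdx F z) = pdy F z" for z
      using J(5)[of z 1] by (simp add: K_def Px) (simp add: pdx_def pdy_def)
  qed
  then show ?thesis
    by blast
qed

end

text \<open>For v nonzero, \<open>v\<close> and \<open>J v\<close> are orthogonal and span a
  J-invariant plane. As \<open>J\<close> is skew on \<open>V\<close>, the orthogonal complement of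
  this plane in \<open>V\<close> is again invariant, and its dimension is smaller by 2.\<close>

lemma even_dim_of_complex_structure:
  fixes J :: "'a::euclidean_space \<Rightarrow> 'a"
  assumes "subspace V" "J ` V \<subseteq> V" "\<And>v. v \<in> V \<Longrightarrow> J (J v) = - v"
    "\<And>v w. v \<in> V \<Longrightarrow> w \<in> V \<Longrightarrow> J v \<bullet> J w = v \<bullet> w"
  shows "even (dim V)"
  using assms
proof (induction "dim V" arbitrary: V rule: less_induct)
  case less
  show ?case
  proof (cases "V \<subseteq> {0}")
    case True
    then have "dim V = 0"
      using dim_eq_0 by blast
    then show ?thesis by (simp only: even_zero)
  next
    case False
    then obtain v where v: "v \<in> V" "v \<noteq> 0"
      by blast
    have Jv: "J v \<in> V"
      using v less.prems(2) by blast
    have anti: "J x \<bullet> y = - (x \<bullet> J y)" if "x \<in> V" "y \<in> V" for x y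
      using less.prems(4)[of "J x" y] less.prems(2,3) that by (auto simp: image_subset_iff)
    have orth: "v \<bullet> J v = 0"
      using anti[OF v(1) v(1)] by (simp add: inner_commute)
    have nz: "J v \<noteq> 0" "v \<noteq> J v"
      using less.prems(4)[OF v(1) v(1)] v orth by auto
    let ?A = "span {v, J v}"
    have "independent {v, J v}"
      using orth nz v by (intro pairwise_orthogonal_independent) (auto simp: pairwise_def orthogonal_def inner_commute)
    then have dimA: "dim ?A = 2"
      using nz by (simp add: dim_eq_card_independent)
    define C where "C = {y \<in> V. \<forall>x\<in>?A. orthogonal x y}"
    have "?A \<subseteq> V"
      using v Jv less.prems(1) by (simp add: span_minimal)
    then have dimC: "dim C + 2 = dim V"
      using dim_subspace_orthogonal_to_vectors[OF subspace_span less.prems(1), of "{v, J v}"] dimA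
      by (simp add: C_def)
    have C_iff: "y \<in> C \<longleftrightarrow> y \<in> V \<and> v \<bullet> y = 0 \<and> J v \<bullet> y = 0" for y
    proof
      assume "y \<in> C"
      then show "y \<in> V \<and> v \<bullet> y = 0 \<and> J v \<bullet> y = 0"
        using span_base[of _ "{v, J v}"] by (auto simp: C_def orthogonal_def)
    next
      assume y: "y \<in> V \<and> v \<bullet> y = 0 \<and> J v \<bullet> y = 0"
      have "orthogonal x y" if "x \<in> ?A" for x
      proof -
        have "orthogonal y x"
          by (rule orthogonal_to_span[OF that]) (use y in \<open>auto simp: orthogonal_def inner_commute[of y]\<close>)
        then show ?thesis
          by (simp add: orthogonal_commute)
      qed
      then show "y \<in> C"
        using y by (simp add: C_def)
    qed
    have "even (dim C)"
    proof (rule less.hyps)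
      show "dim C < dim V"
        using dimC by simp
      show "subspace C"
        using less.prems(1) by (auto simp: subspace_def C_iff inner_add_right)
      show "J ` C \<subseteq> C"
      proof
        fix x assume "x \<in> J ` C"
        then obtain y where y: "y \<in> C" "x = J y"
          by blast
        then have "y \<in> V" "v \<bullet> y = 0" "J v \<bullet> y = 0"
          using C_iff by blast+
        then show "x \<in> C"
          using y anti[OF v(1), of y] less.prems(2) less.prems(4)[OF v(1), of y]
          unfolding C_iff by auto
      qed
    qed (use less.prems C_iff in auto)
    then show ?thesis
      using dimC by presburger
  qed
qed

context minimal_immersion
begin

text \<open>The pairs $(F_x, F_y)$ and $(F_y, -F_x)$ span the graph of the complex structure.\<close>

lemma holomorphic_of_isotropic:
  assumes iso: "\<And>z w. pdx F z \<bullet> pdx F w = pdy F z \<bullet> pdy F w" "\<And>z w. pdx F z \<bullet> pdy F w = - (pdy F z \<bullet> pdx F w)"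
  shows "holomorphic_up_to_rigid_motion F"
proof -
  define G0 where "G0 = range (\<lambda>z. (pdx F z, pdy F z)) \<union> range (\<lambda>z. (pdy F z, - pdx F z))"
  define G where "G = span G0"
  have base: "fst p \<bullet> fst q = snd p \<bullet> snd q" if "p \<in> G0" "q \<in> G0" for p q
    using that iso unfolding G0_def by auto
  have sub: "subspace {p. fst p \<bullet> fst q = snd p \<bullet> snd q}" for q :: "(real ^ 'n) \<times> (real ^ 'n)"
    by (auto simp: subspace_def inner_add_left)
  have half: "fst p \<bullet> fst q = snd p \<bullet> snd q" if "p \<in> G" "q \<in> G0" for p q
    using span_minimal[OF _ sub[of q], of G0] base that unfolding G_def by blast
  have "G0 \<subseteq> {p. fst p \<bullet> fst q = snd p \<bullet> snd q}" if "q \<in> G" for q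
  proof
    fix p assume "p \<in> G0"
    then show "p \<in> {p. fst p \<bullet> fst q = snd p \<bullet> snd q}"
      using half[OF that, of p] by (simp add: inner_commute[of "fst p"] inner_commute[of "snd p"])
  qed
  then have isometric: "fst p \<bullet> fst q = snd p \<bullet> snd q" if "p \<in> G" "q \<in> G" for p q
    using span_minimal[OF _ sub[of q], of G0] that unfolding G_def by blast
  have "subspace {p. (snd p, - fst p) \<in> G}"
  proof -
    have "linear (\<lambda>p::(real ^ 'n) \<times> (real ^ 'n). (snd p, - fst p))"
      by (rule linearI) auto
    from linear_subspace_vimage[OF this subspace_span[of G0]] show ?thesis
      by (simp add: G_def vimage_def)
  qed
  moreover have "G0 \<subseteq> {p. (snd p, - fst p) \<in> G}"
  proof -
    have "(pdy F z, - pdx F z) \<in> G" for z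
      unfolding G_def G0_def by (intro span_base) auto
    moreover have "- (pdx F z, pdy F z) \<in> G" for z
      unfolding G_def G0_def by (intro span_neg span_base) auto
    ultimately show ?thesis
      by (auto simp: G0_def)
  qed
  ultimately have rot: "(snd p, - fst p) \<in> G" if "p \<in> G" for p
    using span_minimal[of G0 "{p. (snd p, - fst p) \<in> G}"] that unfolding G_def by blast
  \<comment> \<open>Both projections have equal inner products on \<open>G\<close>, so a pair with
    first component 0 vanishes: \<open>G\<close> is the graph of an isometry.\<close>
  have "inj_on fst G"
  proof (rule inj_onI)
    fix p q assume pq: "p \<in> G" "q \<in> G" "fst p = fst q"
    then have "p - q \<in> G"
      unfolding G_def by (intro span_diff)
    then have "snd (p - q) \<bullet> snd (p - q) = 0"
      using isometric[of "p - q" "p - q"] pq(3) by simp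
    then show "p = q"
      using pq(3) by (simp add: prod_eq_iff)
  qed
  then obtain g where g: "linear g" "\<And>p. p \<in> G \<Longrightarrow> g (fst p) = p"
    using linear_exists_left_inverse_on[of fst G] linear_fst subspace_span[of G0] unfolding G_def by blast
  define J where "J x = snd (g x)" for x
  define V where "V = fst ` G"
  have "linear J"
    unfolding J_def[abs_def] using linear_compose[OF g(1) linear_snd] by (simp add: o_def)
  have J: "J (fst p) = snd p" if "p \<in> G" for p
    using g(2)[OF that] by (simp add: J_def)
  have V: "subspace V"
    unfolding V_def G_def by (intro linear_subspace_image linear_fst subspace_span)
  have JV: "J ` V \<subseteq> V"
  proof
    fix x assume "x \<in> J ` V"
    then obtain p where "p \<in> G" "x = snd p"
      using J by (auto simp: V_def)
    then show "x \<in> V"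
      using imageI[OF rot, of p fst] by (simp add: V_def)
  qed
  have JJ: "J (J v) = - v" if v: "v \<in> V" for v
  proof -
    obtain p where p: "p \<in> G" "v = fst p"
      using v by (auto simp: V_def)
    then show ?thesis
      using J[OF p(1)] J[OF rot[OF p(1)]] by simp
  qed
  have J_iso: "J v \<bullet> J w = v \<bullet> w" if "v \<in> V" "w \<in> V" for v w
    using that J isometric by (auto simp: V_def)
  have "(pdx F z, pdy F z) \<in> G" "(pdy F z, - pdx F z) \<in> G" for z
    unfolding G_def G0_def by (intro span_base; auto)+
  note Fx = J[OF this(1), simplified] and Fy = J[OF this(2), simplified] and FV = this[THEN imageI[of _ G fst], folded V_def, simplified]
  obtain P where P: "linear P" "\<And>x. P x \<in> V" "\<And>v. v \<in> V \<Longrightarrow> P v = v" "\<And>x y. P x \<bullet> y = x \<bullet> P y"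
    using orthogonal_projection[OF V] by blast
  \<comment> \<open>The component of \<open>F\<close> orthogonal to \<open>V\<close> has zero
    derivative; its constant value is the translation vector.\<close>
  let ?D = "\<lambda>z. F z + - P (F z)"
  have "(?D has_derivative (\<lambda>h. 0)) (at z)" for z
  proof -
    have L: "linear (\<lambda>x. - P x)"
      using linear_compose_neg[OF P(1)] .
    have "?D differentiable (at z)"
      by (intro differentiable_add F_diff pd_linear(1)[OF L])
    moreover have "pdx ?D z = 0" "pdy ?D z = 0"
      using pd_add[OF F_diff pd_linear(1)[OF L]] pd_linear(2,3)[OF L] FV P(3) by simp_all
    ultimately show ?thesis
      using has_derivative_pd[of ?D z] by simp
  qed
  then obtain c where c: "?D z = c" for z
    using has_derivative_zero_constant[of UNIV ?D] by auto
  have "F z \<in> (\<lambda>w. c + w) ` V" for z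
    using c[of z] P(2) by (intro image_eqI[of _ _ "P (F z)"]) (auto simp: algebra_simps)
  moreover have "frechet_derivative F (at z) (\<i> * v) = J (frechet_derivative F (at z) v)" for z v
    unfolding frechet_derivative_pd[OF F_diff]
    by (simp add: linear_add[OF \<open>linear J\<close>] linear_scale[OF \<open>linear J\<close>] Fx Fy)
  ultimately show ?thesis
    unfolding holomorphic_up_to_rigid_motion_def
    using V even_dim_of_complex_structure[OF V JV JJ J_iso] \<open>linear J\<close> JV JJ J_iso
    by (intro exI[of _ c] exI[of _ V] exI[of _ J]) blast
qed

end

section \<open>Stable immersions are isotropic\<close>

lemma smooth_on_holomorphic: "open S \<Longrightarrow> f holomorphic_on S \<Longrightarrow> smooth_on S f"
  by (simp add: smooth_on_def Ck_on_holomorphic)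

lemma smooth_on_vec:
  fixes f :: "'n::finite \<Rightarrow> complex \<Rightarrow> real"
  shows "open S \<Longrightarrow> (\<And>j. smooth_on S (f j)) \<Longrightarrow> smooth_on S (\<lambda>z. \<chi> j. f j z)"
  by (auto simp: smooth_on_def intro!: Ck_on_vec)

lemma pd_vec_nth:
  assumes "f differentiable (at z)"
  shows "pdx f z $ j = pdx (\<lambda>z. f z $ j) z" "pdy f z $ j = pdy (\<lambda>z. f z $ j) z"
  using pd_bounded_linear(2,3)[OF bounded_linear_vec_nth assms] by simp_all

lemma smooth_compact_domain_cball:
  assumes "R > 0"
  shows "smooth_compact_domain (cball w R)"
  unfolding smooth_compact_domain_def
proof (intro conjI ballI)
  fix p assume "p \<in> frontier (cball w R)"
  then have p: "p \<noteq> w"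
    using assms by auto
  \<comment> \<open>The gradient of this defining function vanishes only at the centre, so the
    neighbourhood used is the complement of \<open>w\<close>.\<close>
  let ?\<rho> = "\<lambda>z. (z - w) \<bullet> (z - w) - R\<^sup>2"
  have d: "(?\<rho> has_derivative (\<lambda>h. 2 * ((z - w) \<bullet> h))) (at z)" for z
    by (auto intro!: derivative_eq_intros simp: inner_commute)
  have "smooth_on UNIV (\<lambda>z. (z - w) \<bullet> (z - w) + - R\<^sup>2)"
    by (intro smooth_on_add smooth_on_bilinear[OF bounded_bilinear_inner] smooth_on_const
        smooth_on_holomorphic holomorphic_intros open_UNIV)
  then have "smooth_on (- {w}) ?\<rho>"
    using smooth_on_subset[of UNIV ?\<rho> "- {w}"] by simp
  moreover have "pdx ?\<rho> z \<noteq> 0 \<or> pdy ?\<rho> z \<noteq> 0" if "z \<in> - {w}" for z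
    using pdx_eq[OF d] pdy_eq[OF d] that by (auto simp: inner_complex_def complex_eq_iff)
  moreover have "cball w R \<inter> - {w} = {z \<in> - {w}. ?\<rho> z \<le> 0}"
  proof -
    have "z \<in> cball w R \<longleftrightarrow> ?\<rho> z \<le> 0" for z
    proof -
      have "z \<in> cball w R \<longleftrightarrow> norm (z - w) \<le> R"
        by (simp only: mem_cball dist_norm norm_minus_commute)
      then show ?thesis
        using assms by (simp only: norm_le_square) simp
    qed
    then show ?thesis
      by blast
  qed
  ultimately show "\<exists>U (\<rho>::complex \<Rightarrow> real). open U \<and> p \<in> U \<and> smooth_on U \<rho> \<and>
      (\<forall>z\<in>U. pdx \<rho> z \<noteq> 0 \<or> pdy \<rho> z \<noteq> 0) \<and> cball w R \<inter> U = {z \<in> U. \<rho> z \<le> 0}"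
    using p by (intro exI[of _ "- {w}"] exI[of _ ?\<rho>]) auto
qed simp

text \<open>The left-hand side is the squared Hermitian distance from \<open>b\<close> to the
  complex line through \<open>p\<close>, and \<open>l * p\<close> is one point of that line.\<close>

lemma complement_norm_le:
  fixes b p :: "'n::finite \<Rightarrow> complex"
  assumes "(\<Sum>j\<in>UNIV. (cmod (p j))\<^sup>2) \<noteq> 0"
  shows "(\<Sum>j\<in>UNIV. (cmod (b j))\<^sup>2) - (cmod (\<Sum>j\<in>UNIV. p j * cnj (b j)))\<^sup>2 / (\<Sum>j\<in>UNIV. (cmod (p j))\<^sup>2)
    \<le> (\<Sum>j\<in>UNIV. (cmod (b j - l * p j))\<^sup>2)"
proof -
  define S where "S = (\<Sum>j\<in>UNIV. p j * cnj (b j))"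
  define Q where "Q = (\<Sum>j\<in>UNIV. (cmod (p j))\<^sup>2)"
  have "Q \<ge> 0"
    unfolding Q_def by (intro sum_nonneg) simp
  then have "Q > 0"
    using assms by (simp add: Q_def)
  have "(cmod (x - l * y))\<^sup>2 = (cmod x)\<^sup>2 - 2 * Re (l * (y * cnj x)) + (cmod l)\<^sup>2 * (cmod y)\<^sup>2" for x y
    unfolding cmod_power2 by (simp add: power2_eq_square algebra_simps)
  then have "(\<Sum>j\<in>UNIV. (cmod (b j - l * p j))\<^sup>2)
      = (\<Sum>j\<in>UNIV. (cmod (b j))\<^sup>2) - 2 * Re (l * S) + (cmod l)\<^sup>2 * Q"
    by (simp only: sum.distrib sum_subtractf S_def Q_def sum_distrib_left Re_sum)
  moreover have "2 * Re (l * S) \<le> (cmod S)\<^sup>2 / Q + (cmod l)\<^sup>2 * Q"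
  proof -
    have "Re (l * S) \<le> cmod l * cmod S"
      using complex_Re_le_cmod[of "l * S"] by (simp add: norm_mult)
    moreover have "2 * (cmod l * cmod S) * Q \<le> (cmod S)\<^sup>2 + (cmod l * Q)\<^sup>2"
      using zero_le_power2[of "cmod l * Q - cmod S"] by (simp add: power2_eq_square algebra_simps)
    then have "2 * (cmod l * cmod S) \<le> ((cmod S)\<^sup>2 + (cmod l * Q)\<^sup>2) / Q"
      using \<open>Q > 0\<close> by (simp add: pos_le_divide_eq)
    moreover have "((cmod S)\<^sup>2 + (cmod l * Q)\<^sup>2) / Q = (cmod S)\<^sup>2 / Q + (cmod l)\<^sup>2 * Q"
      using \<open>Q > 0\<close> by (simp add: add_divide_distrib power2_eq_square)
    ultimately show ?thesis by linarith
  qed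
  ultimately show ?thesis
    unfolding S_def[symmetric] Q_def[symmetric] by linarith
qed

section \<open>Isotropy of \<open>\<phi>\<close> and the second variation in complex form\<close>

context minimal_immersion
begin

lemma \<phi>_deriv: "(\<phi> j has_field_derivative deriv (\<phi> j) z) (at z)"
  using \<phi>_has_field_derivative DERIV_imp_deriv by metis

lemma sum_\<phi>_square: "(\<Sum>j\<in>UNIV. \<phi> j z * \<phi> j z) = 0"
proof -
  have "Re (\<Sum>j\<in>UNIV. \<phi> j z * \<phi> j z) = pdx F z \<bullet> pdx F z - pdy F z \<bullet> pdy F z"
    by (simp add: \<phi>_def inner_vec_def sum_subtractf)
  moreover have "Im (\<Sum>j\<in>UNIV. \<phi> j z * \<phi> j z) = - 2 * (pdx F z \<bullet> pdy F z)"
    by (simp add: \<phi>_def inner_vec_def sum_distrib_left algebra_simps flip: sum_negf)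
  moreover have "pdx F z \<bullet> pdx F z = pdy F z \<bullet> pdy F z"
    by (simp only: dot_square_norm conformal(2))
  ultimately show ?thesis
    using conformal(1)[of z] by (simp add: complex_eq_iff)
qed

lemma sum_\<phi>_deriv: "(\<Sum>j\<in>UNIV. \<phi> j z * deriv (\<phi> j) z) = 0"
proof -
  have "((\<lambda>z. \<Sum>j\<in>UNIV. \<phi> j z * \<phi> j z) has_field_derivative
      (\<Sum>j\<in>UNIV. \<phi> j z * deriv (\<phi> j) z + deriv (\<phi> j) z * \<phi> j z)) (at z)"
    by (intro DERIV_sum DERIV_mult' \<phi>_deriv)
  moreover have "((\<lambda>z. \<Sum>j\<in>UNIV. \<phi> j z * \<phi> j z) has_field_derivative 0) (at z)"
    by (simp add: sum_\<phi>_square)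
  ultimately have "(\<Sum>j\<in>UNIV. \<phi> j z * deriv (\<phi> j) z + deriv (\<phi> j) z * \<phi> j z) = 0"
    by (rule DERIV_unique)
  moreover have "(\<Sum>j\<in>UNIV. \<phi> j z * deriv (\<phi> j) z + deriv (\<phi> j) z * \<phi> j z) = 2 * (\<Sum>j\<in>UNIV. \<phi> j z * deriv (\<phi> j) z)"
    by (simp add: sum_distrib_left mult.commute)
  ultimately show ?thesis
    by simp
qed

lemma sum_cmod_\<phi>: "(\<Sum>j\<in>UNIV. (cmod (\<phi> j z))\<^sup>2) = 2 * (norm (pdx F z))\<^sup>2"
proof -
  have "(\<Sum>j\<in>UNIV. (cmod (\<phi> j z))\<^sup>2) = pdx F z \<bullet> pdx F z + pdy F z \<bullet> pdy F z"
    unfolding cmod_power2 by (simp add: \<phi>_def inner_vec_def sum.distrib power2_eq_square)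
  then show ?thesis
    by (simp only: dot_square_norm conformal(2) mult_2)
qed

text \<open>For \<open>P = pdx W z\<close> and \<open>Q = pdy W z\<close> the left-hand side is the
  numerator in \<open>second_variation\<close>.\<close>

lemma contraction_\<phi>:
  "(pdx F z \<bullet> P - pdy F z \<bullet> Q)\<^sup>2 + (pdx F z \<bullet> Q + pdy F z \<bullet> P)\<^sup>2
    = (cmod (\<Sum>j\<in>UNIV. \<phi> j z * Complex (P $ j) (- (Q $ j))))\<^sup>2"
proof -
  have "Re (\<Sum>j\<in>UNIV. \<phi> j z * Complex (P $ j) (- (Q $ j))) = pdx F z \<bullet> P - pdy F z \<bullet> Q"
    by (simp add: \<phi>_def inner_vec_def sum_subtractf)
  moreover have "Im (\<Sum>j\<in>UNIV. \<phi> j z * Complex (P $ j) (- (Q $ j))) = - (pdx F z \<bullet> Q + pdy F z \<bullet> P)"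
    by (simp add: \<phi>_def inner_vec_def sum_subtractf sum_negf)
  ultimately show ?thesis
    by (simp only: cmod_power2 power2_minus)
qed

end

text \<open>The complex variation field $s = \eta (\phi(w) - \eta \phi) / (z - w)$ with
  $\eta = 1 - |z - w|^2 / R^2$. Its $\bar\partial$-derivative is a constant of size $R^{-2}$
  modulo $\phi$, whereas $\phi \cdot \partial s = - \phi(z) \cdot \phi(w) / (z - w)^2$ for every $R$.\<close>

locale test_field = minimal_immersion F for F :: "complex \<Rightarrow> real ^ 'n" +
  fixes w :: complex and R :: real
  assumes R: "R > 0"
begin

definition r :: complex where "r = of_real (1 / R\<^sup>2)"

definition q :: "'n \<Rightarrow> complex \<Rightarrow> complex" where
  "q j z = (if z = w then - deriv (\<phi> j) w else (\<phi> j w - \<phi> j z) / (z - w))"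

definition \<eta> :: "complex \<Rightarrow> complex" where "\<eta> z = 1 - r * ((z - w) * cnj (z - w))"

text \<open>Since 1 - eta = r |z - w|^2, the bracket is the smooth extension across \<open>w\<close>
  of (phi(w) - eta phi) / (z - w).\<close>

definition s :: "'n \<Rightarrow> complex \<Rightarrow> complex" where
  "s j z = \<eta> z * (q j z + r * cnj (z - w) * \<phi> j z)"

text \<open>The Wirtinger derivative of \<open>s\<close> in z, as the product rule gives it. In the
  conjugate derivative \<open>dbar_s\<close> the quotient \<open>q\<close> has been eliminated
  through \<open>q_eq\<close>.\<close>

definition ds :: "'n \<Rightarrow> complex \<Rightarrow> complex" where
  "ds j z = - r * cnj (z - w) * (q j z + r * cnj (z - w) * \<phi> j z)
    + \<eta> z * (deriv (q j) z + r * cnj (z - w) * deriv (\<phi> j) z)"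

definition dbar_s :: "'n \<Rightarrow> complex \<Rightarrow> complex" where
  "dbar_s j z = r * (2 * \<eta> z * \<phi> j z - \<phi> j w)"

lemma q_eq: "(z - w) * q j z = \<phi> j w - \<phi> j z"
  by (simp add: q_def)

lemma holomorphic_q: "q j holomorphic_on UNIV"
proof (rule pole_theorem_open_0[where a = w])
  show "(\<lambda>z. \<phi> j w - \<phi> j z) holomorphic_on UNIV"
    by (intro holomorphic_intros holomorphic_\<phi>)
  have "((\<lambda>z. \<phi> j w - \<phi> j z) has_field_derivative - deriv (\<phi> j) w) (at w)"
    using DERIV_diff[OF DERIV_const \<phi>_deriv] by simp
  then show "q j w = deriv (\<lambda>z. \<phi> j w - \<phi> j z) w"
    using DERIV_imp_deriv by (fastforce simp: q_def)
qed (simp_all add: q_eq)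

lemma q_deriv: "(q j has_field_derivative deriv (q j) z) (at z)"
  using holomorphic_derivI[OF holomorphic_q open_UNIV UNIV_I] .

lemma deriv_q_eq: "q j z + (z - w) * deriv (q j) z = - deriv (\<phi> j) z"
proof -
  have "((\<lambda>z. (z - w) * q j z) has_field_derivative (z - w) * deriv (q j) z + 1 * q j z) (at z)"
    by (intro DERIV_mult' q_deriv) (auto intro!: derivative_eq_intros)
  moreover have "((\<lambda>z. (z - w) * q j z) has_field_derivative - deriv (\<phi> j) z) (at z)"
    unfolding q_eq using DERIV_diff[OF DERIV_const \<phi>_deriv] by simp
  ultimately have "(z - w) * deriv (q j) z + 1 * q j z = - deriv (\<phi> j) z"
    by (rule DERIV_unique)
  then show ?thesis
    by (simp add: add.commute)
qed

lemma s_has_derivative: "(s j has_derivative (\<lambda>h. ds j z * h + dbar_s j z * cnj h)) (at z)"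
proof -
  have cnj: "((\<lambda>z. cnj (z - w)) has_derivative cnj) (at z)"
    using bounded_linear.has_derivative[OF bounded_linear_cnj has_derivative_diff[OF has_derivative_ident has_derivative_const]]
    by simp
  have id: "((\<lambda>z. z - w) has_derivative (\<lambda>h. h)) (at z)"
    using has_derivative_diff[OF has_derivative_ident has_derivative_const] by simp
  have *: "(q j has_derivative (*) (deriv (q j) z)) (at z)" "(\<phi> j has_derivative (*) (deriv (\<phi> j) z)) (at z)"
    using q_deriv \<phi>_deriv by (simp_all add: has_field_derivative_def)
  have "(s j has_derivative (\<lambda>h. \<eta> z * (deriv (q j) z * h + (r * cnj (z - w) * (deriv (\<phi> j) z * h) + r * cnj h * \<phi> j z))
      + (0 - r * ((z - w) * cnj h + h * cnj (z - w))) * (q j z + r * cnj (z - w) * \<phi> j z))) (at z)"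
    unfolding s_def[abs_def] \<eta>_def[abs_def]
    by (intro has_derivative_mult has_derivative_add has_derivative_diff has_derivative_const
        has_derivative_mult_right * cnj id)
  moreover have "\<eta> z * (deriv (q j) z * h + (r * cnj (z - w) * (deriv (\<phi> j) z * h) + r * cnj h * \<phi> j z))
      + (0 - r * ((z - w) * cnj h + h * cnj (z - w))) * (q j z + r * cnj (z - w) * \<phi> j z)
      = ds j z * h + dbar_s j z * cnj h" for h
  proof -
    have "\<eta> z = 1 - r * ((z - w) * cnj (z - w))"
      by (rule \<eta>_def)
    with q_eq[of z j] show ?thesis
      unfolding ds_def dbar_s_def by algebra
  qed
  ultimately show ?thesis
    by (simp only:)
qed

lemma sum_\<phi>_ds: "(\<Sum>j\<in>UNIV. \<phi> j z * ds j z) * (z - w)\<^sup>2 = - (\<Sum>j\<in>UNIV. \<phi> j z * \<phi> j w)"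
proof -
  \<comment> \<open>\<open>X\<close> and \<open>Y\<close> collect the coefficients of phi . phi and
    phi . phi' after the denominators are cleared; both contractions vanish by isotropy.\<close>
  define X where "X = r * ((z - w) * cnj (z - w)) - (r * ((z - w) * cnj (z - w)))\<^sup>2 + \<eta> z"
  define Y where "Y = \<eta> z * (z - w) * (r * ((z - w) * cnj (z - w)) - 1)"
  have "\<phi> j z * ds j z * (z - w)\<^sup>2
      = - (\<phi> j z * \<phi> j w) + (X * (\<phi> j z * \<phi> j z) + Y * (\<phi> j z * deriv (\<phi> j) z))" for j
  proof -
    have "\<eta> z = 1 - r * ((z - w) * cnj (z - w))"
      by (rule \<eta>_def)
    with q_eq[of z j] deriv_q_eq[of j z] show ?thesis
      unfolding ds_def X_def Y_def by algebra
  qed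
  then have "(\<Sum>j\<in>UNIV. \<phi> j z * ds j z) * (z - w)\<^sup>2
      = - (\<Sum>j\<in>UNIV. \<phi> j z * \<phi> j w) + (X * (\<Sum>j\<in>UNIV. \<phi> j z * \<phi> j z) + Y * (\<Sum>j\<in>UNIV. \<phi> j z * deriv (\<phi> j) z))"
    by (simp only: sum_distrib_right sum_distrib_left sum.distrib sum_negf)
  then show ?thesis
    by (simp add: sum_\<phi>_square sum_\<phi>_deriv)
qed

definition u :: "complex \<Rightarrow> real ^ 'n" where "u z = (\<chi> j. Re (s j z))"
definition v :: "complex \<Rightarrow> real ^ 'n" where "v z = (\<chi> j. Im (s j z))"

lemma smooth_s: "smooth_on UNIV (s j)"
proof -
  have cnj: "smooth_on UNIV (\<lambda>z. cnj (z - w))"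
    by (intro smooth_on_bounded_linear[OF bounded_linear_cnj] smooth_on_holomorphic holomorphic_intros open_UNIV)
  note mult = smooth_on_bilinear[OF bounded_bilinear_mult open_UNIV]
  have "smooth_on UNIV (\<lambda>z. 1 + - r * ((z - w) * cnj (z - w)))"
    by (intro smooth_on_add mult cnj smooth_on_holomorphic holomorphic_intros open_UNIV)
  then have eta: "smooth_on UNIV \<eta>"
    by (simp add: \<eta>_def[abs_def])
  then show ?thesis
    unfolding s_def[abs_def]
    by (intro eta smooth_on_add mult cnj smooth_on_const smooth_on_holomorphic holomorphic_q holomorphic_\<phi> open_UNIV)
qed

lemma smooth_u: "smooth_on UNIV u" and smooth_v: "smooth_on UNIV v"
  unfolding u_def[abs_def] v_def[abs_def]
  by (intro smooth_on_vec smooth_on_bounded_linear[OF bounded_linear_Re]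
      smooth_on_bounded_linear[OF bounded_linear_Im] smooth_s open_UNIV)+

lemma pd_u: "pdx u z $ j = Re (ds j z + dbar_s j z)" "pdy u z $ j = - Im (ds j z - dbar_s j z)"
  and pd_v: "pdx v z $ j = Im (ds j z + dbar_s j z)" "pdy v z $ j = Re (ds j z - dbar_s j z)"
proof -
  have d: "s j differentiable (at z)" "u differentiable (at z)" "v differentiable (at z)"
    using smooth_onD(2)[OF smooth_s] smooth_onD(2)[OF smooth_u] smooth_onD(2)[OF smooth_v] by blast+
  have eq: "(\<lambda>z. u z $ j) = (\<lambda>z. Re (s j z))" "(\<lambda>z. v z $ j) = (\<lambda>z. Im (s j z))"
    by (simp_all add: u_def v_def)
  show "pdx u z $ j = Re (ds j z + dbar_s j z)" "pdy u z $ j = - Im (ds j z - dbar_s j z)"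
    "pdx v z $ j = Im (ds j z + dbar_s j z)" "pdy v z $ j = Re (ds j z - dbar_s j z)"
    using pd_bounded_linear(2,3)[OF bounded_linear_Re d(1)] pd_bounded_linear(2,3)[OF bounded_linear_Im d(1)]
      pdx_eq[OF s_has_derivative, of j z] pdy_eq[OF s_has_derivative, of j z]
    by (simp_all add: pd_vec_nth d eq)
qed

lemma variation_u: "area_variation F u (cball w R) UNIV" and variation_v: "area_variation F v (cball w R) UNIV"
  using smooth conformal smooth_u smooth_v by unfold_locales auto

abbreviation jacobian :: "complex \<Rightarrow> real" where
  "jacobian z \<equiv> pdx u z \<bullet> pdy v z - pdy u z \<bullet> pdx v z"

text \<open>With A and B the contractions of \<open>\<phi>\<close> with \<open>ds\<close> and with
  the conjugate of \<open>dbar_s\<close>, the two subtracted terms add up by the parallelogram law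
  to 2 |A|^2 + 2 |B|^2. The B part removes the component of \<open>dbar_s\<close> along
  \<open>\<phi>\<close>, and the A part is the gain.\<close>

lemma second_variation_le:
  assumes "pdx F z \<noteq> 0" "z \<noteq> w"
  shows "area_variation.second_variation F u z + area_variation.second_variation F v z - 2 * jacobian z
    \<le> 4 * (\<Sum>j\<in>UNIV. (cmod (\<phi> j w))\<^sup>2) / R ^ 4
      - 2 * (cmod (\<Sum>j\<in>UNIV. \<phi> j z * \<phi> j w) / (cmod (z - w))\<^sup>2)\<^sup>2 / (norm (pdx F z))\<^sup>2"
proof -
  define N where "N = (norm (pdx F z))\<^sup>2"
  define A where "A = (\<Sum>j\<in>UNIV. \<phi> j z * ds j z)"
  define B where "B = (\<Sum>j\<in>UNIV. \<phi> j z * cnj (dbar_s j z))"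
  have "N > 0"
    using assms(1) by (simp add: N_def)
  \<comment> \<open>The Dirichlet energy of a complex function exceeds twice its Jacobian by exactly
    four times the squared dbar-derivative.\<close>
  have dirichlet: "pdx u z \<bullet> pdx u z + pdy u z \<bullet> pdy u z + (pdx v z \<bullet> pdx v z + pdy v z \<bullet> pdy v z)
      - 2 * jacobian z = 4 * (\<Sum>j\<in>UNIV. (cmod (dbar_s j z))\<^sup>2)"
  proof -
    have "Re (x + y) * Re (x + y) + - Im (x - y) * - Im (x - y) + (Im (x + y) * Im (x + y) + Re (x - y) * Re (x - y))
        - 2 * (Re (x + y) * Re (x - y) - - Im (x - y) * Im (x + y)) = 4 * (cmod y)\<^sup>2" for x y
      unfolding cmod_power2 by (simp add: power2_eq_square algebra_simps)
    then show ?thesis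
      unfolding inner_vec_def inner_real_def pd_u pd_v sum_distrib_left sum.distrib[symmetric] sum_subtractf[symmetric]
      by (simp only:)
  qed
  have "Complex (pdx u z $ j) (- (pdy u z $ j)) = ds j z + cnj (dbar_s j z)"
    "Complex (pdx v z $ j) (- (pdy v z $ j)) = - \<i> * (ds j z - cnj (dbar_s j z))" for j
    by (simp_all add: pd_u pd_v complex_eq_iff)
  then have sums: "(\<Sum>j\<in>UNIV. \<phi> j z * Complex (pdx u z $ j) (- (pdy u z $ j))) = A + B"
    "(\<Sum>j\<in>UNIV. \<phi> j z * Complex (pdx v z $ j) (- (pdy v z $ j))) = - \<i> * (A - B)"
    by (simp_all only: A_def B_def distrib_left sum.distrib right_diff_distrib sum_subtractf sum_distrib_left mult.left_commute[of "- \<i>"])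
  have "2 * (cmod A)\<^sup>2 + 2 * (cmod B)\<^sup>2 = (cmod (A + B))\<^sup>2 + (cmod (- \<i> * (A - B)))\<^sup>2"
    unfolding cmod_power2 by (simp add: power2_eq_square algebra_simps)
  then have "(2 * (cmod A)\<^sup>2 + 2 * (cmod B)\<^sup>2) / N = (cmod (A + B))\<^sup>2 / N + (cmod (- \<i> * (A - B)))\<^sup>2 / N"
    by (simp only: add_divide_distrib)
  then have "area_variation.second_variation F u z + area_variation.second_variation F v z - 2 * jacobian z
      = 4 * (\<Sum>j\<in>UNIV. (cmod (dbar_s j z))\<^sup>2) - (2 * (cmod A)\<^sup>2 + 2 * (cmod B)\<^sup>2) / N"
    using dirichlet
    unfolding area_variation.second_variation_def[OF variation_u] area_variation.second_variation_def[OF variation_v]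
      contraction_\<phi> N_def[symmetric] sums by linarith
  also have "\<dots> = 4 * ((\<Sum>j\<in>UNIV. (cmod (dbar_s j z))\<^sup>2) - (cmod B)\<^sup>2 / (2 * N)) - 2 * (cmod A)\<^sup>2 / N"
    by (simp add: right_diff_distrib add_divide_distrib)
  \<comment> \<open>The multiplier 2 r eta cancels the summand of \<open>dbar_s\<close> that
    contains phi(z) and leaves the constant - r phi(w).\<close>
  also have "(\<Sum>j\<in>UNIV. (cmod (dbar_s j z))\<^sup>2) - (cmod B)\<^sup>2 / (2 * N) \<le> (\<Sum>j\<in>UNIV. (cmod (dbar_s j z - 2 * r * \<eta> z * \<phi> j z))\<^sup>2)"
    using complement_norm_le[of "\<lambda>j. \<phi> j z" "\<lambda>j. dbar_s j z" "2 * r * \<eta> z"] \<open>N > 0\<close>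
    unfolding sum_cmod_\<phi> B_def N_def by simp
  also have "\<dots> = (\<Sum>j\<in>UNIV. (cmod (\<phi> j w))\<^sup>2) / R ^ 4"
  proof -
    have "dbar_s j z - 2 * r * \<eta> z * \<phi> j z = - (r * \<phi> j w)" for j
      by (simp add: dbar_s_def algebra_simps)
    then show ?thesis
      by (simp add: norm_mult r_def power_mult_distrib norm_divide norm_power power_divide sum_divide_distrib flip: power_mult)
  qed
  also have "cmod A = cmod (\<Sum>j\<in>UNIV. \<phi> j z * \<phi> j w) / (cmod (z - w))\<^sup>2"
  proof -
    have "A = - (\<Sum>j\<in>UNIV. \<phi> j z * \<phi> j w) / (z - w)\<^sup>2"
      using sum_\<phi>_ds[of z] assms(2) by (simp add: A_def field_simps)
    then show ?thesis
      by (simp add: norm_divide norm_power)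
  qed
  finally show ?thesis
    by (simp add: N_def)
qed

lemma u_v_zero_on_frontier: "z \<in> frontier (cball w R) \<Longrightarrow> u z = 0 \<and> v z = 0"
proof -
  assume "z \<in> frontier (cball w R)"
  then have "cmod (z - w) = R"
    using R by (simp add: dist_norm norm_minus_commute)
  then have "(z - w) * cnj (z - w) = of_real (R\<^sup>2)"
    by (metis complex_norm_square)
  then have "\<eta> z = 0"
    using R by (simp add: \<eta>_def r_def)
  then show ?thesis
    by (simp add: u_def v_def s_def vec_eq_iff)
qed

text \<open>\<open>\<eta>\<close> vanishes on the bounding circle, so \<open>u\<close> and
  \<open>v\<close> are admissible variations and the Jacobian integrates to zero; subtracting it
  leaves the total unchanged.\<close>

lemma nonneg_of_stable:
  assumes "stable F"
  obtains d where "d \<ge> 0" "((\<lambda>z. area_variation.second_variation F u z + area_variation.second_variation F v z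
    - 2 * jacobian z) has_integral d) (cball w R)"
proof -
  have "stable_on F (cball w R)"
    using assms smooth_compact_domain_cball[OF R] by (simp add: stable_def)
  then have ex: "\<exists>a' d. (\<forall>\<^sub>F t in nhds 0.
      ((\<lambda>s. area_on (cball w R) (\<lambda>z. F z + s *\<^sub>R W z)) has_real_derivative a' t) (at t)) \<and>
      (a' has_real_derivative d) (at 0) \<and> d \<ge> 0"
    if "smooth_on UNIV W" "\<forall>z\<in>frontier (cball w R). W z = 0" for W
    unfolding stable_on_def using that by blast
  obtain d1 where d1: "d1 \<ge> 0" "(area_variation.second_variation F u has_integral d1) (cball w R)"
    using ex[OF smooth_u] u_v_zero_on_frontier
      area_variation.area_second_derivative[OF variation_u negligible_branch_points] by blast
  obtain d2 where d2: "d2 \<ge> 0" "(area_variation.second_variation F v has_integral d2) (cball w R)"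
    using ex[OF smooth_v] u_v_zero_on_frontier
      area_variation.area_second_derivative[OF variation_v negligible_branch_points] by blast
  have "continuous_on (cball w R) jacobian"
    by (intro continuous_intros area_variation.continuous_pd[OF variation_u] area_variation.continuous_pd[OF variation_v])
  then have "jacobian integrable_on cball w R"
    by (intro continuous_on_compact_integrable) auto
  moreover have "integral (cball w R) jacobian = 0"
    using u_v_zero_on_frontier smooth_u smooth_v
    by (intro integral_jacobian_eq_0[OF bounded_bilinear_inner _ open_UNIV]) auto
  ultimately have "(jacobian has_integral 0) (cball w R)"
    by (simp only: has_integral_iff)
  from has_integral_diff[OF has_integral_add[OF d1(2) d2(2)] has_integral_mult_right[OF this, of 2]]
  show thesis
    using d1(1) d2(1) by (intro that[of "d1 + d2"]) simp_all
qed

end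

context minimal_immersion
begin

text \<open>If phi(z) . phi(w) were nonzero, the gain density \<open>g\<close> would exceed
  \<open>g z / 2\<close> on a ball about \<open>z\<close> chosen independently of R, while the error
  is at most 4 C / R^4 times the area pi R^2 of the disc. For large R the total would be
  negative.\<close>

lemma isotropic_of_stable:
  assumes "stable F"
  shows "(\<Sum>j\<in>UNIV. \<phi> j z * \<phi> j w) = 0"
proof (rule ccontr)
  define \<Phi> where "\<Phi> z = (\<Sum>j\<in>UNIV. \<phi> j z * \<phi> j w)" for z
  assume "(\<Sum>j\<in>UNIV. \<phi> j z * \<phi> j w) \<noteq> 0"
  then have \<Phi>: "\<Phi> z \<noteq> 0"
    by (simp add: \<Phi>_def)
  have "z \<noteq> w"
    using \<Phi> sum_\<phi>_square[of w] by (auto simp: \<Phi>_def)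
  have "pdx F z \<noteq> 0"
  proof
    assume "pdx F z = 0"
    then have "\<phi> j z = 0" for j
      using sum_cmod_\<phi>[of z] sum_nonneg_eq_0_iff[of UNIV "\<lambda>j. (cmod (\<phi> j z))\<^sup>2"] by simp
    then show False
      using \<Phi> by (simp add: \<Phi>_def)
  qed
  define g where "g x = 2 * (cmod (\<Phi> x) / (cmod (x - w))\<^sup>2)\<^sup>2 / (norm (pdx F x))\<^sup>2" for x
  have "isCont (pdx F) z"
    using smooth_onD(1)[OF Fx_smooth] continuous_on_eq_continuous_at[OF open_UNIV] by blast
  moreover have "isCont (\<phi> j) z" for j
    using \<phi>_deriv DERIV_isCont by blast
  ultimately have "isCont g z"
    unfolding g_def \<Phi>_def using \<open>z \<noteq> w\<close> \<open>pdx F z \<noteq> 0\<close> by (intro continuous_intros) auto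
  have "g z > 0"
    using \<Phi> \<open>z \<noteq> w\<close> \<open>pdx F z \<noteq> 0\<close> by (simp add: g_def)
  have "\<forall>\<^sub>F x in nhds z. g x > g z / 2"
    using \<open>isCont g z\<close> \<open>g z > 0\<close> by (intro order_tendstoD(1)[of g "g z"])
      (auto simp: isCont_def tendsto_at_iff_tendsto_nhds)
  then obtain \<rho> where \<rho>: "\<rho> > 0" "\<And>x. dist x z < \<rho> \<Longrightarrow> g x > g z / 2"
    unfolding eventually_nhds_metric by blast
  define C where "C = (\<Sum>j\<in>UNIV. (cmod (\<phi> j w))\<^sup>2)"
  have "C \<ge> 0"
    unfolding C_def by (intro sum_nonneg) simp
  define m where "m = measure lebesgue (ball z \<rho>)"
  have "m > 0"
    using \<rho>(1) content_ball_pos[of \<rho> z] by (simp add: m_def)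
  have bound: "g z / 2 * m \<le> 4 * C / R ^ 4 * (pi * R\<^sup>2)" if radius: "R > 0" "ball z \<rho> \<subseteq> cball w R" for R
  proof -
    interpret test_field F w R
      using radius(1) by unfold_locales
    obtain d where d: "d \<ge> 0" "((\<lambda>z. area_variation.second_variation F u z + area_variation.second_variation F v z
      - 2 * jacobian z) has_integral d) (cball w R)"
      using nonneg_of_stable[OF assms] by blast
    let ?h = "\<lambda>x. 4 * C / R ^ 4 - (if x \<in> ball z \<rho> then g z / 2 else 0)"
    let ?S = "\<lambda>z. area_variation.second_variation F u z + area_variation.second_variation F v z - 2 * jacobian z"
    have const: "((\<lambda>x. c) has_integral c * measure lebesgue S) S" if "S \<in> lmeasurable" for c and S :: "complex set"
      using has_integral_mult_right[OF integrable_integral[OF integrable_on_const[OF that, of 1]], of c]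
      by (simp add: lmeasure_integral[OF that])
    have "((\<lambda>x. if x \<in> ball z \<rho> then g z / 2 else 0) has_integral g z / 2 * m) (cball w R)"
      unfolding has_integral_restrict[OF radius(2)] m_def by (rule const) simp
    then have h: "(?h has_integral 4 * C / R ^ 4 * measure lebesgue (cball w R) - g z / 2 * m) (cball w R)"
      by (intro has_integral_diff const) simp_all
    have "negligible ({x. pdx F x = 0} \<union> {w})"
      using negligible_branch_points by (intro negligible_Un) auto
    \<comment> \<open>The pointwise estimate is available only off the branch points and
      \<open>w\<close>. On this null set the integrand is replaced by its intended upper bound, so
      that the comparison holds everywhere.\<close>
    from has_integral_spike[OF this _ d(2), of "\<lambda>x. if x \<in> {x. pdx F x = 0} \<union> {w} then ?h x else ?S x"]
    have "((\<lambda>x. if x \<in> {x. pdx F x = 0} \<union> {w} then ?h x else ?S x) has_integral d) (cball w R)"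
      by simp
    then have "d \<le> 4 * C / R ^ 4 * measure lebesgue (cball w R) - g z / 2 * m"
    proof (rule has_integral_le[OF _ h])
      fix x assume "x \<in> cball w R"
      show "(if x \<in> {x. pdx F x = 0} \<union> {w} then ?h x else ?S x) \<le> ?h x"
      proof (cases "x \<in> {x. pdx F x = 0} \<union> {w}")
        case False
        then have "?S x \<le> 4 * C / R ^ 4 - g x"
          using second_variation_le[of x] by (simp add: g_def C_def \<Phi>_def)
        moreover have "g x \<ge> (if x \<in> ball z \<rho> then g z / 2 else 0)"
          using \<rho>(2)[of x] by (auto simp: g_def dist_commute)
        ultimately show ?thesis
          using False by simp
      qed simp
    qed
    moreover have "measure lebesgue (cball w R) = pi * R\<^sup>2"
      using content_cball[of R w] radius(1) by (simp add: unit_ball_vol_2)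
    ultimately show ?thesis
      using d(1) by simp
  qed
  have "((\<lambda>R. 4 * C / R ^ 4 * (pi * R\<^sup>2)) \<longlongrightarrow> 0) at_top"
    by real_asymp
  moreover have "g z / 2 * m > 0"
    using \<open>g z > 0\<close> \<open>m > 0\<close> by simp
  ultimately have "\<forall>\<^sub>F R in at_top. 4 * C / R ^ 4 * (pi * R\<^sup>2) < g z / 2 * m"
    by (rule order_tendstoD(2))
  moreover have "\<forall>\<^sub>F R in at_top. R > 0 \<and> R \<ge> dist w z + \<rho>"
    by (intro eventually_conj eventually_gt_at_top eventually_ge_at_top)
  ultimately have "\<forall>\<^sub>F R::real in at_top. False"
  proof eventually_elim
    case (elim R)
    have "ball z \<rho> \<subseteq> cball w R"
    proof
      fix x assume "x \<in> ball z \<rho>"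
      then show "x \<in> cball w R"
        using elim dist_triangle[of w x z] by simp
    qed
    then show ?case
      using bound[of R] elim by simp
  qed
  then show False
    by simp
qed

lemma holomorphic_of_stable:
  assumes "stable F"
  shows "holomorphic_up_to_rigid_motion F"
proof (rule holomorphic_of_isotropic)
  fix z w
  have "Re (\<Sum>j\<in>UNIV. \<phi> j z * \<phi> j w) = pdx F z \<bullet> pdx F w - pdy F z \<bullet> pdy F w"
    "Im (\<Sum>j\<in>UNIV. \<phi> j z * \<phi> j w) = - (pdx F z \<bullet> pdy F w + pdy F z \<bullet> pdx F w)"
    by (simp_all add: \<phi>_def inner_vec_def sum_subtractf sum_negf)
  then show "pdx F z \<bullet> pdx F w = pdy F z \<bullet> pdy F w" "pdx F z \<bullet> pdy F w = - (pdy F z \<bullet> pdx F w)"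
    unfolding isotropic_of_stable[OF assms] by simp_all
qed

end

theorem theorem1p1:
  fixes F :: "complex \<Rightarrow> real ^ 'n"
  assumes "branched_minimal_immersion F"
  shows "stable F \<longleftrightarrow> holomorphic_up_to_rigid_motion F"
proof -
  interpret minimal_immersion F
    using assms by unfold_locales
  show ?thesis
    using holomorphic_of_stable calibration_of_holomorphic calibrated_immersion.stable by blast
qed

end
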